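(* Let $m\ge3$, let $f:(\mathbb{R}^2,a)\to(\mathbb{R}^m,b)$ be a frontal of corank $1$, and let $\lambda$ be a Jacobian of $f$ and $\eta$ a kernel field of $f$. Then the following conditions are equivalent to each other: (1) $f$ is $\mathcal{A}$-equivalent to the cuspidal edge, i.e. to the tangent surface of a curve of type $(1,2,3,\dots)$ in $\mathbb{R}^m$. (1') $f$ is $\mathcal{A}$-equivalent to the germ $(t_1,t_2)\mapsto(t_1,\,t_2^2,\,t_2^3,\,0,\dots,0)$ at the origin. (2) $f$ is a front and $(\eta\lambda)(a)\neq 0$. (3) $(\eta\lambda)(a)\neq 0$ and $\mathrm{ord}_a^\eta(f_i)=3$ for some $i$ with $3\le i\le m$, for an adapted system of coordinates $(x_1,x_2,x_3,\dots,x_m)$ of $(\mathbb{R}^m,b)$, where $f_i=x_i\circ f$.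
   Context: All manifolds, maps and germs are $C^\infty$. Two map-germs $f:(\mathbb{R}^n,a)\to(\mathbb{R}^m,b)$ and $f':(\mathbb{R}^n,a')\to(\mathbb{R}^m,b')$ are $\mathcal{A}$-equivalent if $\tau\circ f=f'\circ\sigma$ for some diffeomorphism-germs $\sigma:(\mathbb{R}^n,a)\to(\mathbb{R}^n,a')$, $\tau:(\mathbb{R}^m,b)\to(\mathbb{R}^m,b')$. $\mathcal{E}_a$ is the $\mathbb{R}$-algebra of smooth function-germs on $(\mathbb{R}^n,a)$ and $\mathcal{V}_a$ the $\mathcal{E}_a$-module of germs of vector fields. Frontals. Let $n\le m$. A germ $f:(\mathbb{R}^n,a)\to(\mathbb{R}^m,b)$ is a frontal if there is a smooth germ $\widetilde f:(\mathbb{R}^n,a)\to\mathrm{Gr}(n,T\mathbb{R}^m)$ (the bundle of $n$-planes in tangent spaces of $\mathbb{R}^m$) lifting $f$ with $T_tf(T_t\mathbb{R}^n)\subset\widetilde f(t)\subset T_{f(t)}\mathbb{R}^m$ for all $t$ near $a$; $\widetilde f$ is called a Legendre lift of $f$. A frontal is a front if it has a Legendre lift that is an immersion. $f$ is of corank $k$ if $\dim_{\mathbb R}\mathrm{Ker}(T_af)=k$. Jacobian and kernel field. The Jacobi ideal $J_f\subset\mathcal{E}_a$ is generated by all $n\times n$ minors of the Jacobi matrix of $f$. For a frontal it is principal; a generator $\lambda$ of $J_f$ is called a Jacobian of $f$. Put $\mathcal{N}_f=\{\eta\in\mathcal{V}_a\mid \eta f_i\in J_f,\ 1\le i\le m\}$.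 For a frontal $f$ of corank $1$, a kernel field is an $\eta\in\mathcal{N}_f$ whose class generates the $\mathcal{E}_a$-module $\mathcal{N}_f/\lambda\mathcal{V}_a$. Adapted coordinates. Local coordinates $(x_1,\dots,x_m)$ of $\mathbb{R}^m$ centered at $b$ are adapted to $f$ if $\widetilde f(a)=\langle(\partial/\partial x_1)_b,\dots,(\partial/\partial x_n)_b\rangle_{\mathbb R}$ for a Legendre lift $\widetilde f$ of $f$. Vanishing order. $\mathrm{ord}_a^\eta(h)=\inf\{i\in\mathbb{N}\cup\{0\}\mid(\eta^ih)(a)\ne0\}$ for $h\in\mathcal{E}_a$. Tangent surfaces. A curve-germ $\gamma:(\mathbb{R},0)\to\mathbb{R}^m$ is of type $(\ell_1,\dots,\ell_m)$, $1\le\ell_1<\ell_2<\cdots<\ell_m$, if in some affine coordinates centered at $\gamma(0)$ it has the form $\gamma(t)=(t^{\ell_1}+\cdots,\dots,t^{\ell_m}+\cdots)$, dots being higher order terms. Type $(1,2,3,\dots)$ means $\ell_1=1,\ell_2=2,\ell_3=3$ with the remaining $\ell_i$ arbitrary. The tangent surface of $\gamma$ is the germ at $(0,0)$ of $\mathrm{Tan}(\gamma)(t,u)=\gamma(t)+u\,\gamma'(t)/t^{\ell_1-1}$. It is known that all tangent surfaces in $\mathbb{R}^m$ of curves of type $(1,2,3,\dots)$ are $\mathcal{A}$-equivalent. *)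

theory Defs
  imports "HOL-Analysis.Analysis"
begin

text \<open>
  Conventions. A germ at \<open>a\<close> is represented by a total function; every notion below only
  depends on its values near \<open>a\<close>. The space \<open>R^m\<close> is \<^typ>\<open>real ^ 'm\<close> for a finite linearly
  ordered index type; \<open>pos i\<close> is the position \<open>1, \<dots>, m\<close> of the index \<open>i\<close>.
\<close>

definition pos :: "'m::{finite,linorder} \<Rightarrow> nat" where
  "pos i = card {j. j \<le> i}"


subsection \<open>Smooth map-germs\<close>

primrec Ck_on :: "nat \<Rightarrow> ('a::euclidean_space \<Rightarrow> 'b::euclidean_space) \<Rightarrow> 'a set \<Rightarrow> bool" where
  "Ck_on 0 f S \<longleftrightarrow> continuous_on S f"
| "Ck_on (Suc k) f S \<longleftrightarrow>
     (\<forall>x\<in>S. f differentiable (at x)) \<and> (\<forall>v. Ck_on k (\<lambda>x. frechet_derivative f (at x) v) S)"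

definition smooth_germ :: "('a::euclidean_space \<Rightarrow> 'b::euclidean_space) \<Rightarrow> 'a \<Rightarrow> bool" where
  "smooth_germ f a \<longleftrightarrow> (\<exists>U. open U \<and> a \<in> U \<and> (\<forall>k. Ck_on k f U))"

definition diffeo_germ ::
    "('a::euclidean_space \<Rightarrow> 'b::euclidean_space) \<Rightarrow> 'a \<Rightarrow> 'b \<Rightarrow> bool" where
  "diffeo_germ s a a' \<longleftrightarrow> smooth_germ s a \<and> s a = a' \<and>
     (\<exists>r. smooth_germ r a' \<and> r a' = a \<and>
        (\<forall>\<^sub>F t in nhds a. r (s t) = t) \<and> (\<forall>\<^sub>F t in nhds a'. s (r t) = t))"

definition A_equivalent ::
    "('a::euclidean_space \<Rightarrow> 'b::euclidean_space) \<Rightarrow> 'a \<Rightarrow> ('a \<Rightarrow> 'b) \<Rightarrow> 'a \<Rightarrow> bool" where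
  "A_equivalent f a f' a' \<longleftrightarrow> (\<exists>\<sigma> \<tau>. diffeo_germ \<sigma> a a' \<and> diffeo_germ \<tau> (f a) (f' a') \<and>
     (\<forall>\<^sub>F t in nhds a. \<tau> (f t) = f' (\<sigma> t)))"


subsection \<open>Frontals and fronts\<close>

text \<open>
  Standard affine charts of \<open>Gr(n, R^m)\<close>: for an injective selection \<open>s\<close> of \<open>n\<close> rows, the
  planes \<open>W\<close> projecting isomorphically to the coordinate plane selected by \<open>s\<close> are exactly the
  column spaces of the \<open>m \<times> n\<close> matrices \<open>M\<close> whose rows selected by \<open>s\<close> form the identity
  matrix. Such an \<open>M\<close> is unique, and its other entries are the chart coordinates of \<open>W\<close>.
\<close>

definition gr_coords :: "('n::finite \<Rightarrow> 'm::finite) \<Rightarrow> (real ^ 'm) set \<Rightarrow> real ^ 'n ^ 'm \<Rightarrow> bool" where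
  "gr_coords s W M \<longleftrightarrow> inj s \<and> W = range (\<lambda>v. M *v v) \<and> (\<forall>i. M $ s i = axis i 1)"

definition smooth_plane_field_coords ::
    "(real ^ 'n::finite \<Rightarrow> (real ^ 'm::finite) set) \<Rightarrow> real ^ 'n \<Rightarrow>
     ('n \<Rightarrow> 'm) \<Rightarrow> (real ^ 'n \<Rightarrow> real ^ 'n ^ 'm) \<Rightarrow> bool" where
  "smooth_plane_field_coords W a s M \<longleftrightarrow>
     smooth_germ M a \<and> (\<forall>\<^sub>F t in nhds a. gr_coords s (W t) (M t))"

text \<open>
  The bundle \<open>Gr(n, T R^m)\<close> is \<open>R^m \<times> Gr(n, R^m)\<close>. A lift of \<open>f\<close> is \<open>t \<mapsto> (f t, W t)\<close>; only
  the plane component \<open>W\<close> is recorded. In a chart the lift is \<open>t \<mapsto> (f t, M t)\<close>.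
\<close>

definition legendre_lift ::
    "(real ^ 'n::finite \<Rightarrow> real ^ 'm::finite) \<Rightarrow> real ^ 'n \<Rightarrow> (real ^ 'n \<Rightarrow> (real ^ 'm) set) \<Rightarrow> bool" where
  "legendre_lift f a W \<longleftrightarrow> (\<exists>s M. smooth_plane_field_coords W a s M) \<and>
     (\<forall>\<^sub>F t in nhds a. range (frechet_derivative f (at t)) \<subseteq> W t)"

definition immersive_lift ::
    "(real ^ 'n::finite \<Rightarrow> real ^ 'm::finite) \<Rightarrow> real ^ 'n \<Rightarrow> (real ^ 'n \<Rightarrow> (real ^ 'm) set) \<Rightarrow> bool" where
  "immersive_lift f a W \<longleftrightarrow> (\<exists>s M. smooth_plane_field_coords W a s M \<and>
     inj (frechet_derivative (\<lambda>t. (f t, M t)) (at a)))"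

definition frontal :: "(real ^ 'n::finite \<Rightarrow> real ^ 'm::finite) \<Rightarrow> real ^ 'n \<Rightarrow> bool" where
  "frontal f a \<longleftrightarrow> smooth_germ f a \<and> (\<exists>W. legendre_lift f a W)"

definition front :: "(real ^ 'n::finite \<Rightarrow> real ^ 'm::finite) \<Rightarrow> real ^ 'n \<Rightarrow> bool" where
  "front f a \<longleftrightarrow> frontal f a \<and> (\<exists>W. legendre_lift f a W \<and> immersive_lift f a W)"

definition corank :: "(real ^ 'n::finite \<Rightarrow> real ^ 'm::finite) \<Rightarrow> real ^ 'n \<Rightarrow> nat" where
  "corank f a = dim {v. frechet_derivative f (at a) v = 0}"


subsection \<open>Jacobians and kernel fields\<close>

text \<open>
  Ideals of the algebra of smooth function-germs at \<open>a\<close> are given by the sets of all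
  representatives of their elements.
\<close>

definition germ_ideal :: "'a::euclidean_space \<Rightarrow> ('a \<Rightarrow> real) set \<Rightarrow> ('a \<Rightarrow> real) set" where
  "germ_ideal a G = {h. smooth_germ h a \<and>
     (\<exists>S c. finite S \<and> S \<subseteq> G \<and> (\<forall>g\<in>S. smooth_germ (c g) a) \<and>
        (\<forall>\<^sub>F t in nhds a. h t = (\<Sum>g\<in>S. c g t * g t)))}"

definition jacobi_ideal ::
    "(real ^ 'n::finite \<Rightarrow> real ^ 'm::finite) \<Rightarrow> real ^ 'n \<Rightarrow> (real ^ 'n \<Rightarrow> real) set" where
  "jacobi_ideal f a =
     germ_ideal a {(\<lambda>t. det (\<chi> i. jacobian f (at t) $ s i)) | s :: 'n \<Rightarrow> 'm. inj s}"

definition is_jacobian ::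
    "(real ^ 'n::finite \<Rightarrow> real ^ 'm::finite) \<Rightarrow> real ^ 'n \<Rightarrow> (real ^ 'n \<Rightarrow> real) \<Rightarrow> bool" where
  "is_jacobian f a l \<longleftrightarrow> smooth_germ l a \<and> germ_ideal a {l} = jacobi_ideal f a"

definition field_deriv ::
    "(real ^ 'n::finite \<Rightarrow> real ^ 'n) \<Rightarrow> (real ^ 'n \<Rightarrow> real) \<Rightarrow> real ^ 'n \<Rightarrow> real" where
  "field_deriv \<eta> h = (\<lambda>t. frechet_derivative h (at t) (\<eta> t))"

definition kernel_module ::
    "(real ^ 'n::finite \<Rightarrow> real ^ 'm::finite) \<Rightarrow> real ^ 'n \<Rightarrow> (real ^ 'n \<Rightarrow> real ^ 'n) set" where
  "kernel_module f a =
     {\<eta>. smooth_germ \<eta> a \<and> (\<forall>i. field_deriv \<eta> (\<lambda>t. f t $ i) \<in> jacobi_ideal f a)}"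

text \<open>
  The argument \<open>l\<close> is a Jacobian of \<open>f\<close>. As the submodule of multiples of \<open>l\<close> is the product
  of the Jacobi ideal with all vector fields, the notion does not depend on its choice.
\<close>

definition kernel_field ::
    "(real ^ 'n::finite \<Rightarrow> real ^ 'm::finite) \<Rightarrow> real ^ 'n \<Rightarrow> (real ^ 'n \<Rightarrow> real) \<Rightarrow>
     (real ^ 'n \<Rightarrow> real ^ 'n) \<Rightarrow> bool" where
  "kernel_field f a l \<eta> \<longleftrightarrow> \<eta> \<in> kernel_module f a \<and>
     (\<forall>\<xi>\<in>kernel_module f a. \<exists>c \<zeta>. smooth_germ c a \<and> smooth_germ \<zeta> a \<and>
        (\<forall>\<^sub>F t in nhds a. \<xi> t = c t *\<^sub>R \<eta> t + l t *\<^sub>R \<zeta> t))"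

definition ord_along ::
    "(real ^ 'n::finite \<Rightarrow> real ^ 'n) \<Rightarrow> real ^ 'n \<Rightarrow> (real ^ 'n \<Rightarrow> real) \<Rightarrow> enat" where
  "ord_along \<eta> a h = (INF i \<in> {i. (field_deriv \<eta> ^^ i) h a \<noteq> 0}. enat i)"


subsection \<open>Adapted coordinates\<close>

text \<open>
  The coordinate vector field of \<open>x_i\<close> at \<open>b\<close> is the vector sent to the \<open>i\<close>-th unit vector
  by the derivative of \<open>x\<close> at \<open>b\<close>.
\<close>

definition adapted_coords ::
    "(real ^ 'n::finite \<Rightarrow> real ^ 'm::{finite,linorder}) \<Rightarrow> real ^ 'n \<Rightarrow>
     (real ^ 'm::{finite,linorder} \<Rightarrow> real ^ 'm::{finite,linorder}) \<Rightarrow> bool" where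
  "adapted_coords f a x \<longleftrightarrow> diffeo_germ x (f a) 0 \<and>
     (\<exists>W. legendre_lift f a W \<and>
        W a = span ((\<lambda>i. inv (frechet_derivative x (at (f a))) (axis i 1)) ` {i. pos i \<le> CARD('n)}))"


subsection \<open>Tangent surfaces and the cuspidal edge\<close>

definition curve_of_type ::
    "(real \<Rightarrow> real ^ 'm::{finite,linorder}) \<Rightarrow> ('m::{finite,linorder} \<Rightarrow> nat) \<Rightarrow> bool" where
  "curve_of_type \<gamma> l \<longleftrightarrow> smooth_germ \<gamma> 0 \<and> strict_mono l \<and> (\<forall>i. 1 \<le> l i) \<and>
     (\<exists>L. linear L \<and> bij L \<and>
        (\<forall>i. \<exists>r. smooth_germ r 0 \<and>
           (\<forall>\<^sub>F t in nhds 0. L (\<gamma> t - \<gamma> 0) $ i = t ^ l i + t ^ Suc (l i) * r t)))"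

text \<open>
  The number \<open>l1\<close> is the first entry of the type of \<open>\<gamma>\<close>; the direction field
  \<open>\<gamma>'(t) / t^(l1 - 1)\<close> is extended continuously to \<open>t = 0\<close>.
\<close>

definition tangent_direction :: "nat \<Rightarrow> (real \<Rightarrow> real ^ 'm::finite) \<Rightarrow> real \<Rightarrow> real ^ 'm" where
  "tangent_direction l1 \<gamma> t =
     (let q = (\<lambda>t. vector_derivative \<gamma> (at t) /\<^sub>R t ^ (l1 - 1)) in
      if t = 0 then Lim (at 0) q else q t)"

definition tangent_surface :: "nat \<Rightarrow> (real \<Rightarrow> real ^ 'm::finite) \<Rightarrow> real ^ 2 \<Rightarrow> real ^ 'm" where
  "tangent_surface l1 \<gamma> p = \<gamma> (p $ 1) + (p $ 2) *\<^sub>R tangent_direction l1 \<gamma> (p $ 1)"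

definition type_123 :: "('m::{finite,linorder} \<Rightarrow> nat) \<Rightarrow> bool" where
  "type_123 l \<longleftrightarrow> (\<forall>i. pos i \<le> 3 \<longrightarrow> l i = pos i)"

definition is_cuspidal_edge :: "(real ^ 2 \<Rightarrow> real ^ 'm::{finite,linorder}) \<Rightarrow> real ^ 2 \<Rightarrow> bool" where
  "is_cuspidal_edge f a \<longleftrightarrow>
     (\<exists>\<gamma> l. curve_of_type \<gamma> l \<and> type_123 l \<and> A_equivalent f a (tangent_surface 1 \<gamma>) 0)"

definition cuspidal_edge_normal_form :: "real ^ 2 \<Rightarrow> real ^ 'm::{finite,linorder}" where
  "cuspidal_edge_normal_form t =
     (\<chi> i. if pos i = 1 then t $ 1
          else if pos i = 2 then (t $ 2) ^ 2
          else if pos i = 3 then (t $ 2) ^ 3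
          else 0)"

end

theory Submission
  imports Defs
begin

text \<open>
  The proof recognizes the cuspidal edge by the behaviour of a germ \<open>f\<close> along a vector field
  \<open>X\<close>. Assume \<open>df(X) = \<Lambda> G\<close>, where \<open>\<Lambda>(a) = 0\<close> and \<open>(X\<Lambda>)(a) \<noteq> 0\<close>, and \<open>Xp = 0\<close> for a
  function \<open>p\<close> with \<open>dp(a) \<noteq> 0\<close>. In the coordinates \<open>z = (p - p(a), \<Lambda>)\<close> the field \<open>X\<close> is a multiple of
  the second coordinate field, so the second partial derivative of \<open>f\<close> is divisible by \<open>z\<^sub>2\<close>.
  Decomposing into even and odd parts, \<open>f = A(z\<^sub>1, z\<^sub>2\<^sup>2) + z\<^sub>2 B(z\<^sub>1, z\<^sub>2\<^sup>2)\<close>; divisibility forces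
  \<open>B(z\<^sub>1, 0) = 0\<close>, and Hadamard's lemma turns this into \<open>f = A(z\<^sub>1, z\<^sub>2\<^sup>2) + z\<^sub>2\<^sup>3 C(z\<^sub>1, z\<^sub>2\<^sup>2)\<close>. Thus \<open>f\<close>
  is \<open>(z\<^sub>1, z\<^sub>2\<^sup>2, z\<^sub>2\<^sup>3, 0, \<dots>)\<close> followed by the map \<open>x \<mapsto> A(x\<^sub>1, x\<^sub>2) + x\<^sub>3 C(x\<^sub>1, x\<^sub>2) + L x\<close>,
  in which \<open>L\<close> is linear and kills the first three axes. That map can be made a
  diffeomorphism-germ as soon as the vectors \<open>df(w)\<close> (with \<open>dp(w) \<noteq> 0\<close>), \<open>G\<close> and \<open>XG\<close> are linearly
  independent at \<open>a\<close>. This is \<open>cuspidal_edge_recognition\<close>.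

  The analytic core is Whitney's theorem that a smooth even function of \<open>z\<^sub>2\<close> is a smooth function of
  \<open>z\<^sub>2\<^sup>2\<close>, on both sides of \<open>0\<close> (\<open>whitney_even\<close>). After the substitution \<open>z\<^sub>2 = \<rho> sin \<theta>\<close> the function is
  even and periodic in \<open>\<theta>\<close>, hence a cosine series with rapidly decreasing coefficients. Let \<open>K\<close> be a
  smooth function on the line with all derivatives bounded and \<open>K(t\<^sup>2) = cos t\<close>. Replacing each
  \<open>cos(n \<theta>)\<close> by \<open>K(n\<^sup>2 y)\<close> gives a series that is smooth for all real \<open>y\<close> and agrees with the
  original one at \<open>y = \<theta>\<^sup>2\<close>.

  For the tangent surface of \<open>\<gamma>\<close> one takes \<open>p = t + u\<close>, \<open>\<Lambda> = u\<close>, \<open>X = \<partial>\<^sub>t - \<partial>\<^sub>u\<close> and \<open>G = \<gamma>''(t)\<close>, so that (1)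
  and (1') agree. A frontal in a chart of the Grassmannian satisfies \<open>df = M d(P, Q)\<close>, where \<open>P\<close> and \<open>Q\<close>
  are two components of \<open>f\<close> and the columns of \<open>M\<close> span the lift; there \<open>\<Lambda>\<close> is the determinant of
  \<open>d(P, Q)\<close>, \<open>X\<close> is its adjugate applied to a constant vector \<open>e\<close>, and \<open>G = M e\<close>.

  The conditions (2) and (3) are compared with the normal form by the Leibniz rule. For a kernel
  field \<open>\<eta>\<close> put \<open>\<rho> = (\<eta>\<eta>P, \<eta>\<eta>Q)(a)\<close>. Then \<open>(\<eta>\<lambda>)(a) \<noteq> 0\<close> says that \<open>\<rho>\<close> is not in the image of \<open>d(P, Q)(a)\<close>,
  and the lift is immersive iff \<open>(\<eta>M)(a) \<noteq> 0\<close>. Symmetry of second derivatives makes \<open>(\<eta>M)(a)\<close> vanish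
  on that image, so under \<open>(\<eta>\<lambda>)(a) \<noteq> 0\<close> the lift is immersive iff \<open>(\<eta>M)(a) \<rho> \<noteq> 0\<close>. Finally a coordinate
  function \<open>\<phi> = x\<^sub>i \<circ> f\<close> whose differential \<open>l\<close> at \<open>f(a)\<close> kills the plane of the lift has \<open>(\<eta>\<phi>)(a) = (\<eta>\<eta>\<phi>)(a) = 0\<close>
  and \<open>(\<eta>\<eta>\<eta>\<phi>)(a) = 2 l((\<eta>M)(a) \<rho>)\<close>, which is how the vanishing order \<open>3\<close> detects fronts.
\<close>

section \<open>Smooth maps on open sets\<close>

abbreviation (input) FD :: "('a::real_normed_vector \<Rightarrow> 'b::real_normed_vector) \<Rightarrow> 'a \<Rightarrow> 'a \<Rightarrow> 'b" where
  "FD f x \<equiv> frechet_derivative f (at x)"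

lemma FD_cong_nhds:
  assumes "\<forall>\<^sub>F y in nhds x. f y = g y"
  shows "FD f x = FD g x"
proof -
  have "(f has_derivative D) (at x) \<longleftrightarrow> (g has_derivative D) (at x)" for D
  proof -
    obtain S where S: "open S" "x \<in> S" "\<And>y. y \<in> S \<Longrightarrow> f y = g y"
      using assms unfolding eventually_nhds by blast
    show ?thesis
      using has_derivative_transform_within_open[of f D x UNIV S g]
            has_derivative_transform_within_open[of g D x UNIV S f] S by auto
  qed
  then show ?thesis unfolding frechet_derivative_def by simp
qed

lemma differentiable_cong_nhds:
  assumes "\<forall>\<^sub>F y in nhds x. f y = g y" and "f differentiable (at x)"
  shows "g differentiable (at x)"
proof -
  obtain S where S: "open S" "x \<in> S" "\<And>y. y \<in> S \<Longrightarrow> f y = g y"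
    using assms unfolding eventually_nhds by blast
  then show ?thesis
    using has_derivative_transform_within_open[of f _ x UNIV S g] assms(2)
    unfolding differentiable_def by blast
qed

lemma Ck_on_cong:
  assumes "open S" "\<And>x. x \<in> S \<Longrightarrow> f x = g x" "Ck_on k f S"
  shows "Ck_on k g S"
  using assms
proof (induction k arbitrary: f g)
  case 0
  then show ?case by (simp cong: continuous_on_cong)
next
  case (Suc k)
  have ev: "\<forall>\<^sub>F y in nhds x. f y = g y" if "x \<in> S" for x
    using Suc.prems that unfolding eventually_nhds by blast
  have "Ck_on k (\<lambda>x. FD g x v) S" for v
    using Suc.IH[of "\<lambda>x. FD f x v" "\<lambda>x. FD g x v"]
      Suc.prems FD_cong_nhds[OF ev] by auto
  then show ?case
    using Suc.prems differentiable_cong_nhds[OF ev] by auto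
qed

lemma Ck_on_SucI:
  assumes "open S" "\<And>x. x \<in> S \<Longrightarrow> (f has_derivative D x) (at x)" "\<And>v. Ck_on k (\<lambda>x. D x v) S"
  shows "Ck_on (Suc k) f S"
proof -
  have eq: "D x = FD f x" if "x \<in> S" for x
    using assms(2)[OF that] frechet_derivative_at by blast
  have "Ck_on k (\<lambda>x. FD f x v) S" for v
    by (rule Ck_on_cong[OF assms(1) _ assms(3)[of v]]) (simp add: eq)
  then show ?thesis using assms(2) by (auto simp: differentiable_def)
qed

lemma Ck_on_has_derivative:
  "Ck_on (Suc k) f S \<Longrightarrow> x \<in> S \<Longrightarrow> (f has_derivative FD f x) (at x)"
  by (simp add: frechet_derivative_works)

lemma Ck_on_FD: "Ck_on (Suc k) f S \<Longrightarrow> Ck_on k (\<lambda>x. FD f x v) S"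
  by (simp only: Ck_on.simps)

lemma Ck_on_SucD: "Ck_on (Suc k) f S \<Longrightarrow> Ck_on k f S"
proof (induction k arbitrary: f)
  case 0
  then show ?case
    by (auto intro!: continuous_at_imp_continuous_on differentiable_imp_continuous_within)
next
  case (Suc k)
  have "Ck_on k (\<lambda>x. FD f x v) S" for v
    by (rule Suc.IH) (rule Ck_on_FD[OF Suc.prems])
  then show ?case using Suc.prems by (simp only: Ck_on.simps) blast
qed

lemma Ck_on_subset: "Ck_on k f S \<Longrightarrow> T \<subseteq> S \<Longrightarrow> Ck_on k f T"
proof (induction k arbitrary: f)
  case (Suc k)
  have "Ck_on k (\<lambda>x. FD f x v) T" for v
    by (rule Suc.IH) (rule Ck_on_FD Suc.prems)+
  then show ?case using Suc.prems by (simp only: Ck_on.simps) blast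
qed (auto intro: continuous_on_subset)

lemma Ck_on_const: "Ck_on k (\<lambda>x. c) S"
  by (induction k arbitrary: c) (simp_all add: frechet_derivative_const)

lemma Ck_on_add:
  assumes "open S" "Ck_on k f S" "Ck_on k g S"
  shows "Ck_on k (\<lambda>x. f x + g x) S"
  using assms(2,3)
proof (induction k arbitrary: f g)
  case 0
  then show ?case by (simp add: continuous_on_add)
next
  case (Suc k)
  show ?case
  proof (rule Ck_on_SucI[OF assms(1)])
    show "((\<lambda>x. f x + g x) has_derivative
        (\<lambda>v. FD f x v + FD g x v)) (at x)" if "x \<in> S" for x
      by (rule has_derivative_add)
        (rule Ck_on_has_derivative[OF Suc.prems(1) that] Ck_on_has_derivative[OF Suc.prems(2) that])+
    show "Ck_on k (\<lambda>x. FD f x v + FD g x v) S" for v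
      by (intro Suc.IH Ck_on_FD Suc.prems)
  qed
qed

lemma Ck_on_bounded_linear:
  assumes "bounded_linear L" "open S" "Ck_on k f S"
  shows "Ck_on k (\<lambda>x. L (f x)) S"
  using assms(3)
proof (induction k arbitrary: f)
  case 0
  from bounded_linear.continuous_on[OF assms(1)] 0 show ?case unfolding Ck_on.simps by blast
next
  case (Suc k)
  show ?case
  proof (rule Ck_on_SucI[OF assms(2)])
    show "((\<lambda>x. L (f x)) has_derivative (\<lambda>v. L (FD f x v))) (at x)"
      if "x \<in> S" for x
      by (rule bounded_linear.has_derivative[OF assms(1) Ck_on_has_derivative[OF Suc.prems that]])
    show "Ck_on k (\<lambda>x. L (FD f x v)) S" for v
      by (intro Suc.IH Ck_on_FD Suc.prems)
  qed
qed

lemma Ck_on_sum: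
  assumes "open S" "\<And>i. i \<in> I \<Longrightarrow> Ck_on k (f i) S"
  shows "Ck_on k (\<lambda>x. \<Sum>i\<in>I. f i x) S"
  using assms(2)
  by (induction I rule: infinite_finite_induct) (simp_all add: Ck_on_const Ck_on_add assms(1))

lemma Ck_on_bilinear:
  assumes "bounded_bilinear pr" "open S" "Ck_on k f S" "Ck_on k g S"
  shows "Ck_on k (\<lambda>x. pr (f x) (g x)) S"
  using assms(3,4)
proof (induction k arbitrary: f g)
  case 0
  from bounded_bilinear.continuous_on[OF assms(1)] 0 show ?case unfolding Ck_on.simps by blast
next
  case (Suc k)
  show ?case
  proof (rule Ck_on_SucI[OF assms(2)])
    show "((\<lambda>x. pr (f x) (g x)) has_derivative
        (\<lambda>v. pr (f x) (FD g x v) + pr (FD f x v) (g x))) (at x)"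
      if "x \<in> S" for x
      by (rule bounded_bilinear.FDERIV[OF assms(1)])
        (rule Ck_on_has_derivative[OF Suc.prems(1) that] Ck_on_has_derivative[OF Suc.prems(2) that])+
    show "Ck_on k (\<lambda>x. pr (f x) (FD g x v) + pr (FD f x v) (g x)) S" for v
      by (intro Ck_on_add[OF assms(2)] Suc.IH Ck_on_SucD[OF Suc.prems(1)] Ck_on_SucD[OF Suc.prems(2)]
          Ck_on_FD Suc.prems)
  qed
qed

text \<open>
  By the chain rule a derivative of the composite is a sum of products of coordinates of a derivative
  of \<open>f\<close> with composites of partial derivatives of \<open>g\<close> and \<open>f\<close>, so the order of differentiability can
  be raised by induction.
\<close>

lemma Ck_on_compose:
  fixes f :: "'a::euclidean_space \<Rightarrow> 'b::euclidean_space" and g :: "'b \<Rightarrow> 'c::euclidean_space"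
  assumes "open S" "open T" "Ck_on k f S" "Ck_on k g T" "\<And>x. x \<in> S \<Longrightarrow> f x \<in> T"
  shows "Ck_on k (\<lambda>x. g (f x)) S"
  using assms(3,4)
proof (induction k arbitrary: g)
  case 0
  then show ?case using assms(5) by (auto intro: continuous_on_compose2)
next
  case (Suc k)
  let ?D = "\<lambda>x v. \<Sum>b\<in>Basis. (FD f x v \<bullet> b) *\<^sub>R FD g (f x) b"
  show ?case
  proof (rule Ck_on_SucI[OF assms(1)])
    fix x assume x: "x \<in> S"
    note f' = Ck_on_has_derivative[OF Suc.prems(1) x]
    note g' = Ck_on_has_derivative[OF Suc.prems(2) assms(5)[OF x]]
    have "?D x v = FD g (f x) (FD f x v)" for v
    proof -
      interpret g: linear "FD g (f x)"
        using g' has_derivative_linear by blast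
      show ?thesis
        by (simp flip: g.scaleR g.sum add: euclidean_representation)
    qed
    then show "((\<lambda>x. g (f x)) has_derivative ?D x) (at x)"
      using has_derivative_compose[OF f' g'] by simp
  next
    fix v
    have f: "Ck_on k (\<lambda>x. FD f x v \<bullet> b) S" for b
      using Suc.prems by (intro Ck_on_bounded_linear[OF bounded_linear_inner_left assms(1)] Ck_on_FD Suc.prems)
    have g: "Ck_on k (\<lambda>x. FD g (f x) b) S" for b
      by (rule Suc.IH[OF Ck_on_SucD[OF Suc.prems(1)] Ck_on_FD[OF Suc.prems(2)]])
    show "Ck_on k (\<lambda>x. ?D x v) S"
      by (intro Ck_on_sum assms(1) Ck_on_bilinear[OF bounded_bilinear_scaleR] f g)
  qed
qed

definition smooth_on :: "('a::euclidean_space \<Rightarrow> 'b::euclidean_space) \<Rightarrow> 'a set \<Rightarrow> bool" where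
  "smooth_on f S \<longleftrightarrow> (\<forall>k. Ck_on k f S)"

lemma smooth_germ_iff: "smooth_germ f a \<longleftrightarrow> (\<exists>U. open U \<and> a \<in> U \<and> smooth_on f U)"
  by (simp add: smooth_germ_def smooth_on_def)

text \<open>
  A class of functions consists of smooth functions as soon as it is closed under partial
  derivatives. This replaces the computation of higher derivatives: the integrals, series and
  piecewise defined functions below each belong to an explicit class with this property.
\<close>

lemma smooth_on_coinduct:
  fixes P :: "('a::euclidean_space \<Rightarrow> 'b::euclidean_space) \<Rightarrow> bool"
  assumes "open S" "P f"
    and step: "\<And>f. P f \<Longrightarrow> \<exists>g. (\<forall>b\<in>Basis. P (g b)) \<and>
      (\<forall>x\<in>S. (f has_derivative (\<lambda>v. \<Sum>b\<in>Basis. (v \<bullet> b) *\<^sub>R g b x)) (at x))"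
  shows "smooth_on f S"
proof -
  have "Ck_on k f S" if "P f" for k f
    using that
  proof (induction k arbitrary: f)
    case 0
    obtain g where "\<And>x. x \<in> S \<Longrightarrow> (f has_derivative (\<lambda>v. \<Sum>b\<in>Basis. (v \<bullet> b) *\<^sub>R g b x)) (at x)"
      using step[OF 0] by blast
    then show ?case
      unfolding Ck_on.simps using continuous_at_imp_continuous_on has_derivative_continuous by blast
  next
    case (Suc k)
    obtain g where g: "\<And>b. b \<in> Basis \<Longrightarrow> P (g b)"
      "\<And>x. x \<in> S \<Longrightarrow> (f has_derivative (\<lambda>v. \<Sum>b\<in>Basis. (v \<bullet> b) *\<^sub>R g b x)) (at x)"
      using step[OF Suc.prems] by blast
    have "Ck_on k (\<lambda>x. \<Sum>b\<in>Basis. (v \<bullet> b) *\<^sub>R g b x) S" for v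
      by (intro Ck_on_sum assms(1) Ck_on_bounded_linear[OF bounded_linear_scaleR_right] Suc.IH g(1))
    then show ?case
      using Ck_on_SucI[OF assms(1) g(2)] by blast
  qed
  then show ?thesis using assms(2) by (simp add: smooth_on_def)
qed

lemma smooth_on_coinduct_real:
  fixes P :: "(real \<Rightarrow> 'b::euclidean_space) \<Rightarrow> bool"
  assumes "open S" "P f"
    and "\<And>f. P f \<Longrightarrow> \<exists>g. P g \<and> (\<forall>x\<in>S. (f has_vector_derivative g x) (at x))"
  shows "smooth_on f S"
proof (rule smooth_on_coinduct[where P = P, OF assms(1,2)])
  fix f assume "P f"
  then obtain g where "P g" "\<forall>x\<in>S. (f has_vector_derivative g x) (at x)" using assms(3) by blast
  then show "\<exists>g. (\<forall>b\<in>Basis. P (g b)) \<and>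
      (\<forall>x\<in>S. (f has_derivative (\<lambda>v. \<Sum>b\<in>Basis. (v \<bullet> b) *\<^sub>R g b x)) (at x))"
    by (intro exI[of _ "\<lambda>_. g"]) (simp add: has_vector_derivative_def)
qed

lemma smooth_on_subset: "smooth_on f S \<Longrightarrow> T \<subseteq> S \<Longrightarrow> smooth_on f T"
  unfolding smooth_on_def using Ck_on_subset by blast

lemma smooth_on_cong:
  assumes "open S" "\<And>x. x \<in> S \<Longrightarrow> f x = g x" "smooth_on f S"
  shows "smooth_on g S"
  using assms Ck_on_cong unfolding smooth_on_def by blast

lemma smooth_on_has_derivative:
  "smooth_on f S \<Longrightarrow> x \<in> S \<Longrightarrow> (f has_derivative FD f x) (at x)"
  unfolding smooth_on_def using Ck_on_has_derivative by blast

lemma smooth_on_FD: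
  "smooth_on f S \<Longrightarrow> smooth_on (\<lambda>x. FD f x v) S"
  unfolding smooth_on_def using Ck_on_FD by blast

lemma smooth_on_imp_continuous_on: "smooth_on f S \<Longrightarrow> continuous_on S f"
  unfolding smooth_on_def by (meson Ck_on.simps(1))

lemma smooth_on_SucI:
  assumes "open S" "\<And>x. x \<in> S \<Longrightarrow> (f has_derivative D x) (at x)" "\<And>v. smooth_on (\<lambda>x. D x v) S"
  shows "smooth_on f S"
  unfolding smooth_on_def
proof
  fix k
  have "Ck_on (Suc k) f S"
    using assms by (intro Ck_on_SucI) (auto simp: smooth_on_def)
  then show "Ck_on k f S" by (rule Ck_on_SucD)
qed

named_theorems smooth_intros

lemma smooth_on_const [smooth_intros]: "smooth_on (\<lambda>x. c) S"
  by (simp add: smooth_on_def Ck_on_const)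

lemma smooth_on_bounded_linear:
  assumes "bounded_linear L" "open S" "smooth_on f S"
  shows "smooth_on (\<lambda>x. L (f x)) S"
  using assms Ck_on_bounded_linear unfolding smooth_on_def by blast

lemma smooth_on_id [smooth_intros]: "open S \<Longrightarrow> smooth_on (\<lambda>x. x) S"
  by (rule smooth_on_SucI[where D = "\<lambda>x v. v"]) (auto intro: smooth_on_const)

lemma smooth_on_add:
  "open S \<Longrightarrow> smooth_on f S \<Longrightarrow> smooth_on g S \<Longrightarrow> smooth_on (\<lambda>x. f x + g x) S"
  unfolding smooth_on_def using Ck_on_add by blast

lemma smooth_on_bilinear:
  "bounded_bilinear pr \<Longrightarrow> open S \<Longrightarrow> smooth_on f S \<Longrightarrow> smooth_on g S \<Longrightarrow> smooth_on (\<lambda>x. pr (f x) (g x)) S"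
  unfolding smooth_on_def using Ck_on_bilinear by blast

lemma smooth_on_compose:
  assumes "open S" "open T" "smooth_on f S" "smooth_on g T" "\<And>x. x \<in> S \<Longrightarrow> f x \<in> T"
  shows "smooth_on (\<lambda>x. g (f x)) S"
  using assms Ck_on_compose unfolding smooth_on_def by blast

lemma smooth_on_inverse_real: "smooth_on (inverse :: real \<Rightarrow> real) (- {0})"
  unfolding smooth_on_def
proof
  fix k
  show "Ck_on k (inverse :: real \<Rightarrow> real) (- {0})"
  proof (induction k)
    case 0
    show ?case by (auto intro!: continuous_intros)
  next
    case (Suc k)
    show ?case
    proof (rule Ck_on_SucI)
      show "(inverse has_derivative (\<lambda>v. - (inverse x * v * inverse x))) (at x)" if "x \<in> - {0}" for x :: real
        using that by (auto intro!: derivative_eq_intros simp: mult_ac)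
      show "Ck_on k (\<lambda>x. - (inverse x * v * inverse x)) (- {0})" for v :: real
        by (intro Ck_on_bounded_linear[OF bounded_linear_minus[OF bounded_linear_ident]]
            Ck_on_bilinear[OF bounded_bilinear_mult] Suc Ck_on_const) auto
    qed auto
  qed
qed

section \<open>Smooth germs\<close>

lemma smooth_germ_cong:
  assumes "\<forall>\<^sub>F t in nhds a. f t = g t" "smooth_germ f a"
  shows "smooth_germ g a"
proof -
  obtain S where S: "open S" "a \<in> S" "\<And>t. t \<in> S \<Longrightarrow> f t = g t"
    using assms(1) unfolding eventually_nhds by blast
  obtain U where U: "open U" "a \<in> U" "smooth_on f U" using assms(2) smooth_germ_iff by blast
  have "smooth_on g (S \<inter> U)"
    by (rule smooth_on_cong[of _ f]) (use S U smooth_on_subset[of f U "S \<inter> U"] in auto)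
  then show ?thesis unfolding smooth_germ_iff using S U by (intro exI[of _ "S \<inter> U"]) auto
qed

lemma smooth_germ_eventually: "smooth_germ f a \<Longrightarrow> \<forall>\<^sub>F t in nhds a. smooth_germ f t"
  unfolding smooth_germ_iff eventually_nhds by blast

lemma smooth_germ_has_derivative:
  "smooth_germ f a \<Longrightarrow> (f has_derivative FD f a) (at a)"
  unfolding smooth_germ_iff using smooth_on_has_derivative by blast

lemma linear_sum_Basis:
  assumes "linear L"
  shows "(\<Sum>b\<in>Basis. (v \<bullet> b) *\<^sub>R L b) = L v"
proof -
  interpret linear L by fact
  show ?thesis by (simp flip: scaleR sum add: euclidean_representation)
qed

lemma smooth_germ_linear_derivative: "smooth_germ f a \<Longrightarrow> linear (FD f a)"
  using smooth_germ_has_derivative has_derivative_linear by blast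

lemma smooth_germ_FD [smooth_intros]:
  "smooth_germ f a \<Longrightarrow> smooth_germ (\<lambda>x. FD f x v) a"
  unfolding smooth_germ_iff using smooth_on_FD by blast

lemma smooth_germ_isCont: "smooth_germ f a \<Longrightarrow> isCont f a"
  using smooth_germ_has_derivative has_derivative_continuous by blast


lemma smooth_germ_const [smooth_intros]: "smooth_germ (\<lambda>x. c) a"
  unfolding smooth_germ_iff by (auto intro!: exI[of _ UNIV] smooth_intros)

lemma smooth_germ_id [smooth_intros]: "smooth_germ (\<lambda>x. x) a"
  unfolding smooth_germ_iff by (auto intro!: exI[of _ UNIV] smooth_intros)

lemma smooth_germ_bounded_linear:
  "bounded_linear L \<Longrightarrow> smooth_germ f a \<Longrightarrow> smooth_germ (\<lambda>x. L (f x)) a"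
  unfolding smooth_germ_iff using smooth_on_bounded_linear by blast

lemma smooth_germ_bilinear:
  assumes "bounded_bilinear pr" "smooth_germ f a" "smooth_germ g a"
  shows "smooth_germ (\<lambda>x. pr (f x) (g x)) a"
proof -
  obtain U V where "open U" "a \<in> U" "smooth_on f U" "open V" "a \<in> V" "smooth_on g V"
    using assms(2,3) unfolding smooth_germ_iff by blast
  then show ?thesis unfolding smooth_germ_iff
    by (intro exI[of _ "U \<inter> V"] conjI smooth_on_bilinear[OF assms(1)])
      (auto intro: smooth_on_subset)
qed

lemmas smooth_germ_scaleR [smooth_intros] = smooth_germ_bilinear[OF bounded_bilinear_scaleR]
lemmas smooth_germ_inner [smooth_intros] = smooth_germ_bilinear[OF bounded_bilinear_inner]
lemmas smooth_germ_mult [smooth_intros] =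
  smooth_germ_bilinear[OF bounded_bilinear_mult[where 'a = real]]

lemma smooth_germ_add [smooth_intros]:
  assumes "smooth_germ f a" "smooth_germ g a"
  shows "smooth_germ (\<lambda>x. f x + g x) a"
proof -
  obtain U V where "open U" "a \<in> U" "smooth_on f U" "open V" "a \<in> V" "smooth_on g V"
    using assms unfolding smooth_germ_iff by blast
  then have "smooth_on (\<lambda>x. f x + g x) (U \<inter> V)"
    by (intro smooth_on_add) (auto intro: smooth_on_subset)
  then show ?thesis unfolding smooth_germ_iff
    by (meson IntI \<open>a \<in> U\<close> \<open>a \<in> V\<close> \<open>open U\<close> \<open>open V\<close> open_Int)
qed

lemma smooth_germ_minus [smooth_intros]: "smooth_germ f a \<Longrightarrow> smooth_germ (\<lambda>x. - f x) a"
  by (rule smooth_germ_bounded_linear[OF bounded_linear_minus[OF bounded_linear_ident]])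

lemma smooth_germ_diff [smooth_intros]:
  "smooth_germ f a \<Longrightarrow> smooth_germ g a \<Longrightarrow> smooth_germ (\<lambda>x. f x - g x) a"
  using smooth_germ_add[OF _ smooth_germ_minus, of f a g] by simp

lemma smooth_germ_sum [smooth_intros]:
  "(\<And>i. i \<in> I \<Longrightarrow> smooth_germ (f i) a) \<Longrightarrow> smooth_germ (\<lambda>x. \<Sum>i\<in>I. f i x) a"
  by (induction I rule: infinite_finite_induct) (auto intro: smooth_intros)

lemma smooth_germ_prod [smooth_intros]:
  fixes f :: "'i \<Rightarrow> 'a::euclidean_space \<Rightarrow> real"
  shows "(\<And>i. i \<in> I \<Longrightarrow> smooth_germ (f i) a) \<Longrightarrow> smooth_germ (\<lambda>x. \<Prod>i\<in>I. f i x) a"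
  by (induction I rule: infinite_finite_induct) (auto intro: smooth_intros)

lemma smooth_germ_power [smooth_intros]:
  fixes f :: "'a::euclidean_space \<Rightarrow> real"
  shows "smooth_germ f a \<Longrightarrow> smooth_germ (\<lambda>x. f x ^ n) a"
  by (induction n) (auto intro: smooth_intros)

lemma smooth_germ_vec_nth [smooth_intros]:
  "smooth_germ f a \<Longrightarrow> smooth_germ (\<lambda>x. f x $ i) a"
  by (rule smooth_germ_bounded_linear[OF bounded_linear_vec_nth])

lemma smooth_germ_componentwise:
  assumes "\<And>b. b \<in> Basis \<Longrightarrow> smooth_germ (\<lambda>x. f x \<bullet> b) a"
  shows "smooth_germ f a"
proof -
  have "smooth_germ (\<lambda>x. \<Sum>b\<in>Basis. (f x \<bullet> b) *\<^sub>R b) a"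
    by (intro smooth_intros assms) auto
  then show ?thesis by (simp add: euclidean_representation)
qed

lemma smooth_germ_vec_lambda [smooth_intros]:
  fixes f :: "'i::finite \<Rightarrow> 'a::euclidean_space \<Rightarrow> 'b::euclidean_space"
  assumes "\<And>i. smooth_germ (f i) a"
  shows "smooth_germ (\<lambda>x. \<chi> i. f i x) a"
proof (rule smooth_germ_componentwise)
  fix b :: "'b^'i" assume "b \<in> Basis"
  then obtain i u where b: "b = axis i u" by (auto simp: Basis_vec_def)
  have "smooth_germ (\<lambda>x. f i x \<bullet> u) a"
    by (intro smooth_intros assms)
  then show "smooth_germ (\<lambda>x. (\<chi> i. f i x) \<bullet> b) a"
    by (simp add: b inner_axis)
qed

lemma smooth_germ_compose:
  assumes "smooth_germ g (f a)" "smooth_germ f a"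
  shows "smooth_germ (\<lambda>x. g (f x)) a"
proof -
  obtain U V where U: "open U" "a \<in> U" "smooth_on f U" and V: "open V" "f a \<in> V" "smooth_on g V"
    using assms unfolding smooth_germ_iff by blast
  let ?W = "f -` V \<inter> U"
  have W: "open ?W"
    using U(1,3) V(1) continuous_open_preimage[of U f V] smooth_on_imp_continuous_on
    by (auto simp: Int_commute)
  have "smooth_on (\<lambda>x. g (f x)) ?W"
    by (rule smooth_on_compose[OF W V(1) _ V(3)]) (use smooth_on_subset[OF U(3)] in auto)
  then show ?thesis unfolding smooth_germ_iff using W U V by (intro exI[of _ ?W]) auto
qed

lemma smooth_germ_inverse [smooth_intros]:
  fixes f :: "'a::euclidean_space \<Rightarrow> real"
  assumes "smooth_germ f a" "f a \<noteq> 0"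
  shows "smooth_germ (\<lambda>x. inverse (f x)) a"
proof -
  have "smooth_germ inverse (f a)"
    unfolding smooth_germ_iff using assms(2) smooth_on_inverse_real
    by (intro exI[of _ "- {0}"]) auto
  then show ?thesis using smooth_germ_compose assms(1) by blast
qed

lemma smooth_germ_divide [smooth_intros]:
  fixes f :: "'a::euclidean_space \<Rightarrow> real"
  shows "smooth_germ f a \<Longrightarrow> smooth_germ g a \<Longrightarrow> g a \<noteq> 0 \<Longrightarrow> smooth_germ (\<lambda>x. f x / g x) a"
  unfolding divide_inverse by (intro smooth_intros)

lemma smooth_germ_det [smooth_intros]:
  fixes A :: "'a::euclidean_space \<Rightarrow> real^'n^'n"
  shows "(\<And>i j. smooth_germ (\<lambda>x. A x $ i $ j) a) \<Longrightarrow> smooth_germ (\<lambda>x. det (A x)) a"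
  unfolding det_def
  by (intro smooth_germ_sum smooth_germ_mult smooth_germ_const smooth_germ_prod)

lemma smooth_germ_FD_field:
  assumes "smooth_germ f a" "smooth_germ X a"
  shows "smooth_germ (\<lambda>x. FD f x (X x)) a"
proof -
  have "smooth_germ (\<lambda>x. \<Sum>b\<in>Basis. (X x \<bullet> b) *\<^sub>R FD f x b) a"
    by (intro smooth_intros assms)
  moreover have "\<forall>\<^sub>F x in nhds a. (\<Sum>b\<in>Basis. (X x \<bullet> b) *\<^sub>R FD f x b)
      = FD f x (X x)"
    using smooth_germ_eventually[OF assms(1)]
  proof eventually_elim
    case (elim x)
    interpret linear "FD f x"
      using smooth_germ_has_derivative[OF elim] has_derivative_linear by blast
    show ?case by (simp flip: scaleR sum add: euclidean_representation)
  qed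
  ultimately show ?thesis by (rule smooth_germ_cong[rotated])
qed


text \<open>
  Functions that are smooth germs at all points of \<open>S\<close> are closed under partial derivatives.
\<close>

lemma smooth_on_iff_germs:
  assumes "open S"
  shows "smooth_on f S \<longleftrightarrow> (\<forall>x\<in>S. smooth_germ f x)"
proof
  show "\<forall>x\<in>S. smooth_germ f x" if "smooth_on f S"
    using that assms smooth_germ_iff by blast
next
  assume *: "\<forall>x\<in>S. smooth_germ f x"
  show "smooth_on f S"
  proof (rule smooth_on_coinduct[where P = "\<lambda>f. \<forall>x\<in>S. smooth_germ f x", OF assms *])
    fix f :: "'a \<Rightarrow> 'b" assume f: "\<forall>x\<in>S. smooth_germ f x"
    have "(f has_derivative (\<lambda>v. \<Sum>b\<in>Basis. (v \<bullet> b) *\<^sub>R FD f x b)) (at x)"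
      if "x \<in> S" for x
    proof -
      have d: "(f has_derivative FD f x) (at x)"
        using f that smooth_germ_has_derivative by blast
      then interpret linear "FD f x" using has_derivative_linear by blast
      have "(\<Sum>b\<in>Basis. (v \<bullet> b) *\<^sub>R FD f x b) = FD f x v" for v
        by (simp flip: scaleR sum add: euclidean_representation)
      with d show ?thesis by simp
    qed
    then show "\<exists>g. (\<forall>b\<in>Basis. \<forall>x\<in>S. smooth_germ (g b) x) \<and>
        (\<forall>x\<in>S. (f has_derivative (\<lambda>v. \<Sum>b\<in>Basis. (v \<bullet> b) *\<^sub>R g b x)) (at x))"
      by (intro exI[of _ "\<lambda>b x. FD f x b"] conjI ballI smooth_germ_FD)
        (use f in auto)
  qed
qed

lemma smooth_germ_tendsto: "smooth_germ f a \<Longrightarrow> filterlim f (nhds (f a)) (nhds a)"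
  using smooth_germ_isCont by (simp add: isCont_def tendsto_nhds_iff)

lemma smooth_germ_eventually_compose:
  assumes "smooth_germ f a" "\<forall>\<^sub>F y in nhds (f a). P y"
  shows "\<forall>\<^sub>F x in nhds a. P (f x)"
  using smooth_germ_tendsto[OF assms(1)] assms(2) by (auto simp: filterlim_iff)

section \<open>The inverse function theorem for smooth germs\<close>

text \<open>
  The local inverse \<open>g\<close> provided by the inverse function theorem has the derivative
  \<open>v \<mapsto> (s'(g y))\<^sup>-\<^sup>1 v\<close>, which by Cramer's rule is a smooth function of \<open>g y\<close>. Hence if \<open>g\<close> is of class
  \<open>k\<close>, its derivative is of class \<open>k\<close> too, and \<open>g\<close> is of class \<open>k + 1\<close>.
\<close>

theorem diffeo_germ_inj_derivative:
  fixes s :: "real^'n \<Rightarrow> real^'n"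
  assumes s: "smooth_germ s a" and inj: "inj (FD s a)"
  shows "diffeo_germ s a (s a)"
proof -
  let ?D = "\<lambda>x. FD s x"
  let ?J = "\<lambda>x. matrix (?D x)"
  obtain U where U: "open U" "a \<in> U" "smooth_on s U" using s smooth_germ_iff by blast
  have germ: "smooth_germ s x" if "x \<in> U" for x using that U smooth_germ_iff by blast
  have lin: "linear (?D x)" if "x \<in> U" for x by (rule smooth_germ_linear_derivative[OF germ[OF that]])
  have Jgerm: "smooth_germ (\<lambda>x. ?J x $ i $ j) x" if "x \<in> U" for x i j
    unfolding matrix_def using germ[OF that] by (simp add: smooth_intros)
  have "continuous_on U (\<lambda>x. det (?J x))"
    by (intro continuous_at_imp_continuous_on ballI smooth_germ_isCont smooth_germ_det Jgerm)
  then have "open (U \<inter> (\<lambda>x. det (?J x)) -` (- {0}))"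
    using U(1) by (intro continuous_open_preimage) auto
  then obtain U0 where U0: "open U0" "\<And>x. x \<in> U0 \<longleftrightarrow> x \<in> U \<and> det (?J x) \<noteq> 0"
    by (metis (no_types, lifting) ComplD ComplI IntD1 IntD2 IntI singletonD singletonI vimageD vimageI)
  have a0: "a \<in> U0" using U0(2) U(2) inj det_nz_iff_inj[OF lin] by blast
  have bl: "blinfun_apply (Blinfun (?D x)) = ?D x" if "x \<in> U" for x
    using lin[OF that] by (simp add: bounded_linear_Blinfun_apply linear_conv_bounded_linear)
  have der: "(s has_derivative blinfun_apply (Blinfun (?D x))) (at x)" if "x \<in> U0" for x
    using bl that U0(2) germ smooth_germ_has_derivative by metis
  have "continuous_on U0 (\<lambda>x. blinfun_apply (Blinfun (?D x)) i)" for i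
  proof (rule continuous_on_eq)
    show "continuous_on U0 (\<lambda>x. ?D x i)"
      using U0(2) germ
      by (intro continuous_at_imp_continuous_on ballI smooth_germ_isCont smooth_germ_FD) auto
  qed (use bl U0(2) in auto)
  then have cont: "continuous_on U0 (\<lambda>x. Blinfun (?D x))"
    by (rule continuous_on_blinfun_componentwise)
  obtain L where L: "linear L" "L \<circ> ?D a = id"
    using linear_injective_left_inverse[OF lin[OF U(2)] inj] by blast
  have inv: "Blinfun L o\<^sub>L Blinfun (?D a) = id_blinfun"
    using L bl[OF U(2)]
    by (intro blinfun_eqI) (simp add: bounded_linear_Blinfun_apply linear_conv_bounded_linear pointfree_idE)
  obtain U' V g g' where V: "open U'" "U' \<subseteq> U0" "a \<in> U'" "open V" "s a \<in> V" "homeomorphism U' V s g"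
    and g: "\<And>y. y \<in> V \<Longrightarrow> (g has_derivative (g' y)) (at y)"
    "\<And>y. y \<in> V \<Longrightarrow> g' y = inv (blinfun_apply (Blinfun (?D (g y))))"
    "\<And>y. y \<in> V \<Longrightarrow> bij (blinfun_apply (Blinfun (?D (g y))))"
    by (rule inverse_function_theorem[OF U0(1) _ cont a0 inv]) (erule der, rule that, assumption+)
  have gV: "g y \<in> U0" if "y \<in> V" for y using V that by (auto simp: homeomorphism_def)
  let ?\<Phi> = "\<lambda>v x. \<chi> k. det (\<chi> i j. if j = k then v $ i else ?J x $ i $ j) / det (?J x)"
  have \<Phi>: "?\<Phi> v (g y) = g' y v" if y: "y \<in> V" for v y
  proof -
    have U: "g y \<in> U" "det (?J (g y)) \<noteq> 0" using gV[OF y] U0(2) by auto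
    have "?J (g y) *v g' y v = v"
      using g(2,3)[OF y] bl[OF U(1)] lin[OF U(1)] by (simp add: matrix_works bij_is_surj surj_f_inv_f)
    then show ?thesis by (rule cramer[OF U(2), THEN iffD1, symmetric])
  qed
  have \<Phi>s: "smooth_on (?\<Phi> v) U0" for v
    unfolding smooth_on_iff_germs[OF U0(1)]
  proof
    fix x assume x: "x \<in> U0"
    have "smooth_germ (\<lambda>x. if j = k then v $ i else ?J x $ i $ j) x" for i j k
      using Jgerm x U0(2) by (cases "j = k") (auto intro: smooth_intros)
    then show "smooth_germ (?\<Phi> v) x"
      using Jgerm x U0(2) by (intro smooth_germ_vec_lambda smooth_germ_divide smooth_germ_det) auto
  qed
  have "Ck_on k g V" for k
  proof (induction k)
    case 0
    show ?case using V(6) by (simp add: homeomorphism_def)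
  next
    case (Suc k)
    show ?case
    proof (rule Ck_on_SucI[OF V(4) g(1)])
      fix v
      have "Ck_on k (\<lambda>y. ?\<Phi> v (g y)) V"
        by (rule Ck_on_compose[OF V(4) U0(1) Suc]) (use \<Phi>s gV in \<open>auto simp: smooth_on_def\<close>)
      then show "Ck_on k (\<lambda>y. g' y v) V" by (rule Ck_on_cong[OF V(4), rotated]) (rule \<Phi>)
    qed
  qed
  then have "smooth_germ g (s a)" using V(4,5) smooth_germ_def by blast
  moreover have "\<forall>\<^sub>F t in nhds a. g (s t) = t" "\<forall>\<^sub>F t in nhds (s a). s (g t) = t" "g (s a) = a"
    using V by (auto simp: homeomorphism_def eventually_nhds)
  ultimately show ?thesis unfolding diffeo_germ_def using s by blast
qed

section \<open>A-equivalence\<close>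

lemma diffeo_germE:
  assumes "diffeo_germ s a a'"
  obtains r where "diffeo_germ r a' a" "\<forall>\<^sub>F t in nhds a. r (s t) = t" "\<forall>\<^sub>F t in nhds a'. s (r t) = t"
  using assms unfolding diffeo_germ_def by blast

lemma diffeo_germ_compose:
  assumes "diffeo_germ s a b" "diffeo_germ s' b c"
  shows "diffeo_germ (\<lambda>t. s' (s t)) a c"
proof -
  obtain r where r: "diffeo_germ r b a" "\<forall>\<^sub>F t in nhds a. r (s t) = t" "\<forall>\<^sub>F t in nhds b. s (r t) = t"
    using diffeo_germE[OF assms(1)] .
  obtain r' where r': "diffeo_germ r' c b" "\<forall>\<^sub>F t in nhds b. r' (s' t) = t" "\<forall>\<^sub>F t in nhds c. s' (r' t) = t"
    using diffeo_germE[OF assms(2)] .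
  have sm: "smooth_germ s a" "s a = b" "smooth_germ s' b" "s' b = c"
     "smooth_germ r b" "r b = a" "smooth_germ r' c" "r' c = b"
    using assms r(1) r'(1) by (auto simp: diffeo_germ_def)
  have "smooth_germ (\<lambda>t. s' (s t)) a" "smooth_germ (\<lambda>t. r (r' t)) c"
    using sm by (auto intro: smooth_germ_compose)
  moreover have "\<forall>\<^sub>F t in nhds a. r (r' (s' (s t))) = t"
    using r(2) smooth_germ_eventually_compose[OF sm(1), unfolded sm(2), OF r'(2)]
    by eventually_elim simp
  moreover have "\<forall>\<^sub>F t in nhds c. s' (s (r (r' t))) = t"
    using r'(3) smooth_germ_eventually_compose[OF sm(7), unfolded sm(8), OF r(3)]
    by eventually_elim simp
  ultimately show ?thesis unfolding diffeo_germ_def using sm by (auto intro!: exI[of _ "\<lambda>t. r (r' t)"])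
qed

text \<open>
  For maps in the factored form \<open>f = T \<circ> f' \<circ> \<sigma>\<close> the target diffeomorphism is a local inverse of \<open>T\<close>.
\<close>

lemma A_equivalentI:
  assumes "diffeo_germ \<sigma> a a'" "diffeo_germ T (f' a') (f a)" "\<forall>\<^sub>F t in nhds a. f t = T (f' (\<sigma> t))"
    and "smooth_germ f' a'"
  shows "A_equivalent f a f' a'"
proof -
  obtain \<tau> where \<tau>: "diffeo_germ \<tau> (f a) (f' a')" "\<forall>\<^sub>F t in nhds (f' a'). \<tau> (T t) = t"
    using diffeo_germE[OF assms(2)] .
  have \<sigma>: "smooth_germ \<sigma> a" "\<sigma> a = a'" using assms(1) by (auto simp: diffeo_germ_def)
  have "\<forall>\<^sub>F t in nhds a. \<tau> (T (f' (\<sigma> t))) = f' (\<sigma> t)"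
    using smooth_germ_eventually_compose[OF assms(4) \<tau>(2)]
      smooth_germ_eventually_compose[OF \<sigma>(1)] \<sigma>(2) by blast
  with assms(3) have "\<forall>\<^sub>F t in nhds a. \<tau> (f t) = f' (\<sigma> t)" by eventually_elim simp
  then show ?thesis unfolding A_equivalent_def using assms(1) \<tau>(1) by blast
qed

lemma A_equivalent_sym:
  assumes "A_equivalent f a f' a'" "smooth_germ f a"
  shows "A_equivalent f' a' f a"
proof -
  obtain \<sigma> \<tau> where *: "diffeo_germ \<sigma> a a'" "diffeo_germ \<tau> (f a) (f' a')"
    "\<forall>\<^sub>F t in nhds a. \<tau> (f t) = f' (\<sigma> t)"
    using assms(1) unfolding A_equivalent_def by blast
  obtain r where r: "diffeo_germ r a' a" "\<forall>\<^sub>F t in nhds a'. \<sigma> (r t) = t"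
    using diffeo_germE[OF *(1)] .
  have rs: "smooth_germ r a'" "r a' = a" using r(1) by (auto simp: diffeo_germ_def)
  have "\<forall>\<^sub>F t in nhds a'. \<tau> (f (r t)) = f' (\<sigma> (r t))"
    using smooth_germ_eventually_compose[OF rs(1)] rs(2) *(3) by blast
  with r(2) have "\<forall>\<^sub>F t in nhds a'. f' t = \<tau> (f (r t))" by eventually_elim simp
  then show ?thesis using A_equivalentI[where \<sigma> = r and T = \<tau> and f = f' and f' = f, OF r(1) *(2)] assms(2) by blast
qed

lemma A_equivalent_trans:
  assumes "A_equivalent f a g b" "A_equivalent g b h c"
  shows "A_equivalent f a h c"
proof -
  obtain \<sigma> \<tau> where 1: "diffeo_germ \<sigma> a b" "diffeo_germ \<tau> (f a) (g b)"
    "\<forall>\<^sub>F t in nhds a. \<tau> (f t) = g (\<sigma> t)"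
    using assms(1) unfolding A_equivalent_def by blast
  obtain \<sigma>' \<tau>' where 2: "diffeo_germ \<sigma>' b c" "diffeo_germ \<tau>' (g b) (h c)"
    "\<forall>\<^sub>F t in nhds b. \<tau>' (g t) = h (\<sigma>' t)"
    using assms(2) unfolding A_equivalent_def by blast
  have \<sigma>: "smooth_germ \<sigma> a" "\<sigma> a = b" using 1(1) by (auto simp: diffeo_germ_def)
  have "\<forall>\<^sub>F t in nhds a. \<tau>' (g (\<sigma> t)) = h (\<sigma>' (\<sigma> t))"
    using smooth_germ_eventually_compose[OF \<sigma>(1)] \<sigma>(2) 2(3) by blast
  with 1(3) have "\<forall>\<^sub>F t in nhds a. \<tau>' (\<tau> (f t)) = h (\<sigma>' (\<sigma> t))" by eventually_elim simp
  then show ?thesis unfolding A_equivalent_def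
    using diffeo_germ_compose[OF 1(1) 2(1)] diffeo_germ_compose[OF 1(2) 2(2)] by blast
qed

section \<open>Integrals depending smoothly on a parameter\<close>

text \<open>
  Differentiation under the integral sign produces integrals of the same form.
\<close>

lemma smooth_on_integral:
  fixes F :: "'a::euclidean_space \<times> real \<Rightarrow> 'b::euclidean_space"
  assumes U: "open U" "convex U" and W: "open W" "U \<times> {c..d} \<subseteq> W" and F: "smooth_on F W"
  shows "smooth_on (\<lambda>x. integral {c..d} (\<lambda>s. F (x, s))) U"
proof (rule smooth_on_coinduct[where P = "\<lambda>h. \<exists>F. smooth_on F W \<and> h = (\<lambda>x. integral {c..d} (\<lambda>s. F (x, s)))"])
  show "\<exists>G. smooth_on G W \<and> (\<lambda>x. integral {c..d} (\<lambda>s. F (x, s))) = (\<lambda>x. integral {c..d} (\<lambda>s. G (x, s)))"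
    using F by blast
next
  fix h assume "\<exists>F. smooth_on F W \<and> h = (\<lambda>x::'a. integral {c..d} (\<lambda>s. F (x, s) :: 'b))"
  then obtain F where F: "smooth_on F W" and h: "h = (\<lambda>x::'a. integral {c..d} (\<lambda>s. F (x, s) :: 'b))"
    by blast
  let ?D = "\<lambda>x s v. FD F (x, s) (v, 0)"
  have der: "(F has_derivative FD F (x, s)) (at (x, s))"
    if "x \<in> U" "s \<in> {c..d}" for x s
    using smooth_on_has_derivative[OF F] W(2) that by blast
  have der': "((\<lambda>x. F (x, s)) has_derivative ?D x s) (at x)" if "x \<in> U" "s \<in> {c..d}" for x s
  proof -
    have "((\<lambda>x. (x, s)) has_derivative (\<lambda>v. (v, 0))) (at x)"
      by (auto intro!: derivative_eq_intros)
    from has_derivative_compose[OF this der[OF that]] show ?thesis .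
  qed
  have bl: "blinfun_apply (Blinfun (?D x s)) = ?D x s" if "x \<in> U" "s \<in> {c..d}" for x s
    using has_derivative_bounded_linear[OF der'[OF that]] by (rule bounded_linear_Blinfun_apply)
  have contD: "continuous_on (U \<times> {c..d}) (\<lambda>p. FD F p (v, 0))" for v
    using smooth_on_imp_continuous_on[OF smooth_on_FD[OF F]] W(2)
    by (rule continuous_on_subset)
  have "continuous_on (U \<times> cbox c d) (\<lambda>p. blinfun_apply (Blinfun (?D (fst p) (snd p))) i)" for i
    by (rule continuous_on_eq[OF contD[of i, folded box_real(2)]]) (auto simp: bl)
  then have cont: "continuous_on (U \<times> cbox c d) (\<lambda>(x, s). Blinfun (?D x s))"
    unfolding case_prod_beta by (rule continuous_on_blinfun_componentwise)
  have contF: "continuous_on {c..d} (\<lambda>s. F (x, s))" if "x \<in> U" for x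
    by (rule continuous_on_compose2[OF smooth_on_imp_continuous_on[OF F]])
      (use W(2) that in \<open>auto intro!: continuous_intros\<close>)
  have "(h has_derivative (\<lambda>v. \<Sum>b\<in>Basis. (v \<bullet> b) *\<^sub>R integral {c..d} (\<lambda>s. ?D x s b))) (at x)"
    if x: "x \<in> U" for x
  proof -
    let ?B = "integral (cbox c d) (\<lambda>s. Blinfun (?D x s))"
    have "((\<lambda>x. integral (cbox c d) (\<lambda>s. F (x, s))) has_derivative blinfun_apply ?B) (at x within U)"
    proof (rule leibniz_rule[OF _ _ cont x U(2)])
      fix y t assume y: "y \<in> U" and t: "t \<in> cbox c d"
      show "((\<lambda>x. F (x, t)) has_derivative blinfun_apply (Blinfun (?D y t))) (at y within U)"
        using has_derivative_at_withinI[OF der'[of y t]] bl[of y t] y t by simp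
    next
      fix y assume "y \<in> U"
      then show "(\<lambda>s. F (y, s)) integrable_on cbox c d"
        using integrable_continuous_real[OF contF] by simp
    qed
    then have 1: "(h has_derivative blinfun_apply ?B) (at x)"
      using at_within_open[OF x U(1)] h by simp
    have int: "(\<lambda>s. Blinfun (?D x s)) integrable_on cbox c d"
    proof (rule integrable_continuous)
      have "continuous_on (cbox c d) (\<lambda>s. (x, s))" by (intro continuous_intros)
      from continuous_on_compose2[OF cont this]
      show "continuous_on (cbox c d) (\<lambda>s. Blinfun (?D x s))" using x by auto
    qed
    have 2: "blinfun_apply ?B b = integral {c..d} (\<lambda>s. ?D x s b)" for b
      unfolding blinfun_apply_integral[OF int] unfolding box_real
      by (rule integral_cong) (simp add: bl x)
    have "blinfun_apply ?B = (\<lambda>v. \<Sum>b\<in>Basis. (v \<bullet> b) *\<^sub>R integral {c..d} (\<lambda>s. ?D x s b))"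
      unfolding 2[symmetric]
      by (rule ext, rule linear_sum_Basis[symmetric])
        (rule bounded_linear.linear[OF blinfun.bounded_linear_right])
    with 1 show ?thesis by (rule back_subst[of "\<lambda>D. (h has_derivative D) (at x)"])
  qed
  moreover have "\<exists>G. smooth_on G W \<and>
      (\<lambda>x. integral {c..d} (\<lambda>s. ?D x s b)) = (\<lambda>x. integral {c..d} (\<lambda>s. G (x, s)))" for b
    by (rule exI[of _ "\<lambda>p. FD F p (b, 0)"])
      (simp add: smooth_on_FD[OF F])
  ultimately show "\<exists>g. (\<forall>b\<in>Basis. \<exists>F. smooth_on F W \<and> g b = (\<lambda>x. integral {c..d} (\<lambda>s. F (x, s)))) \<and>
      (\<forall>x\<in>U. (h has_derivative (\<lambda>v. \<Sum>b\<in>Basis. (v \<bullet> b) *\<^sub>R g b x)) (at x))"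
    by (intro exI[of _ "\<lambda>b x. integral {c..d} (\<lambda>s. ?D x s b)"] conjI ballI) blast+
qed (rule U)


text \<open>
  By compactness of the interval (the tube lemma) the germs of \<open>F\<close> along \<open>{a} \<times> {c..d}\<close> share a
  neighbourhood that is a product.
\<close>

lemma smooth_germ_integral:
  fixes F :: "'a::euclidean_space \<times> real \<Rightarrow> 'b::euclidean_space"
  assumes "\<And>s. s \<in> {c..d} \<Longrightarrow> smooth_germ F (a, s)"
  shows "smooth_germ (\<lambda>x. integral {c..d} (\<lambda>s. F (x, s))) a"
proof -
  let ?W = "{p. smooth_germ F p}"
  have W: "open ?W"
  proof (subst open_subopen, intro ballI)
    fix p assume "p \<in> ?W"
    then have "\<forall>\<^sub>F q in nhds p. smooth_germ F q" by (intro smooth_germ_eventually) simp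
    then show "\<exists>T. open T \<and> p \<in> T \<and> T \<subseteq> ?W" unfolding eventually_nhds by auto
  qed
  have K: "{a} \<times> {c..d} \<subseteq> ?W" using assms by auto
  obtain X0 where X: "a \<in> X0" "open X0" "X0 \<times> {c..d} \<subseteq> ?W"
    using Elementary_Topology.tube_lemma[OF compact_Icc W K] by (elim exE conjE)
  then obtain e where "e > 0" "ball a e \<subseteq> X0" using open_contains_ball by blast
  then have "smooth_on (\<lambda>x. integral {c..d} (\<lambda>s. F (x, s))) (ball a e)"
    by (intro smooth_on_integral[where W = ?W] W) (use X W in \<open>auto simp: smooth_on_iff_germs\<close>)
  then show ?thesis unfolding smooth_germ_iff using \<open>e > 0\<close> by (intro exI[of _ "ball a e"]) auto
qed

section \<open>The plane and Hadamard's lemma\<close>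

definition pt :: "real \<Rightarrow> real \<Rightarrow> real ^ 2" where
  "pt x y = x *\<^sub>R axis 1 1 + y *\<^sub>R axis 2 1"

lemma pt_nth [simp]: "pt x y $ 1 = x" "pt x y $ 2 = y"
  by (simp_all add: pt_def axis_def)

lemma pt_eta [simp]: "pt (z $ 1) (z $ 2) = z"
  by (simp add: vec_eq_iff forall_2)

lemma pt_0 [simp]: "pt 0 0 = 0"
  by (simp add: vec_eq_iff forall_2)

lemma smooth_germ_pt [smooth_intros]:
  "smooth_germ f a \<Longrightarrow> smooth_germ g a \<Longrightarrow> smooth_germ (\<lambda>x. pt (f x) (g x)) a"
  unfolding pt_def by (intro smooth_intros)

lemma smooth_germ_fst [smooth_intros]: "smooth_germ f a \<Longrightarrow> smooth_germ (\<lambda>x. fst (f x)) a"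
  by (rule smooth_germ_bounded_linear[OF bounded_linear_fst])

lemma smooth_germ_snd [smooth_intros]: "smooth_germ f a \<Longrightarrow> smooth_germ (\<lambda>x. snd (f x)) a"
  by (rule smooth_germ_bounded_linear[OF bounded_linear_snd])

lemma norm_pt_le: "norm (pt x y) \<le> \<bar>x\<bar> + \<bar>y\<bar>"
  using norm_le_l1_cart[of "pt x y"] by (simp add: sum_2)

text \<open>
  The fundamental theorem of calculus on the segment from \<open>(z\<^sub>1, 0)\<close> to \<open>z\<close> gives
  \<open>C z = \<integral> \<partial>\<^sub>2h(z\<^sub>1, s z\<^sub>2) ds\<close> over \<open>0 \<le> s \<le> 1\<close>.
\<close>

lemma hadamard:
  fixes h :: "real ^ 2 \<Rightarrow> 'b::euclidean_space"
  assumes h: "smooth_germ h 0" and 0: "\<forall>\<^sub>F x in nhds 0. h (pt x 0) = 0"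
  obtains C where "smooth_germ C 0" "\<forall>\<^sub>F z in nhds 0. h z = (z $ 2) *\<^sub>R C z"
proof
  let ?F = "\<lambda>(z, s). FD h (pt (z $ 1) (s * z $ 2)) (axis 2 1)"
  let ?C = "\<lambda>z. integral {0..1} (\<lambda>s. ?F (z, s))"
  have "smooth_germ ?F (0, s)" for s
    unfolding case_prod_beta
    by (rule smooth_germ_compose[of "\<lambda>y. FD h y (axis 2 1)"]; intro smooth_intros)
      (simp add: h)
  then show "smooth_germ ?C 0" by (intro smooth_germ_integral)
  obtain U where U: "open U" "0 \<in> U" "smooth_on h U" using h smooth_germ_iff by blast
  obtain e where e: "e > 0" "ball 0 e \<subseteq> U" using U open_contains_ball by blast
  obtain d where d: "d > 0" "\<And>x. \<bar>x\<bar> < d \<Longrightarrow> h (pt x 0) = 0"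
    using 0 unfolding eventually_nhds_metric by (auto simp: dist_norm)
  have "h z = (z $ 2) *\<^sub>R ?C z" if z: "norm z < min d (e / 2)" for z
  proof -
    have c: "\<bar>z $ i\<bar> < e / 2" "\<bar>z $ i\<bar> < d" for i
      using component_le_norm_cart[of z i] z by auto
    have der: "((\<lambda>s. h (pt (z $ 1) (s * z $ 2))) has_vector_derivative (z $ 2) *\<^sub>R ?F (z, s)) (at s within {0..1})"
      if s: "s \<in> {0..1}" for s
    proof -
      have "\<bar>s * z $ 2\<bar> \<le> \<bar>z $ 2\<bar>" using s by (simp add: abs_mult mult_left_le_one_le)
      then have "norm (pt (z $ 1) (s * z $ 2)) < e"
        using norm_pt_le[of "z $ 1" "s * z $ 2"] c(1)[of 1] c(1)[of 2] by linarith
      then have "pt (z $ 1) (s * z $ 2) \<in> U" using e by auto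
      note D = smooth_on_has_derivative[OF U(3) this]
      have "((\<lambda>s. pt (z $ 1) (s * z $ 2)) has_derivative (\<lambda>t. (t * z $ 2) *\<^sub>R axis 2 1)) (at s within {0..1})"
        unfolding pt_def by (auto intro!: derivative_eq_intros)
      from has_derivative_compose[OF this D]
      show ?thesis unfolding has_vector_derivative_def
        using linear_cmul[OF has_derivative_linear[OF D]] by (simp add: mult_ac)
    qed
    have "((\<lambda>s. (z $ 2) *\<^sub>R ?F (z, s)) has_integral h (pt (z $ 1) (1 * z $ 2)) - h (pt (z $ 1) (0 * z $ 2))) {0..1}"
      by (rule fundamental_theorem_of_calculus[OF _ der]) auto
    then have "((\<lambda>s. (z $ 2) *\<^sub>R ?F (z, s)) has_integral h z) {0..1}"
      using d(2) c(2)[of 1] by simp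
    then have "integral {0..1} (\<lambda>s. (z $ 2) *\<^sub>R ?F (z, s)) = h z" by (rule integral_unique)
    then show ?thesis by simp
  qed
  then show "\<forall>\<^sub>F z in nhds 0. h z = (z $ 2) *\<^sub>R ?C z"
    unfolding eventually_nhds_metric using d(1) e(1)
    by (intro exI[of _ "min d (e / 2)"]) (auto simp: dist_norm)
qed

section \<open>Symmetry of second derivatives\<close>

text \<open>
  The difference \<open>h(a + s v + t w) - h(a + s v)\<close> is the integral of the derivative of \<open>h\<close> in
  direction \<open>w\<close> over a segment. Differentiating under the integral sign in \<open>s\<close> at \<open>0\<close>, and then
  differentiating the integral in its upper limit \<open>t\<close> at \<open>0\<close>, gives the two mixed derivatives.
\<close>

lemma second_derivative_commute:
  fixes h :: "'a::euclidean_space \<Rightarrow> 'b::euclidean_space"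
  assumes "smooth_germ h a"
  shows "FD (\<lambda>x. FD h x w) a v
       = FD (\<lambda>x. FD h x v) a w"
proof -
  let ?D = "\<lambda>h v x. FD h x v"
  obtain U where U: "open U" "a \<in> U" "smooth_on h U" using assms smooth_germ_iff by blast
  obtain e where e: "e > 0" "ball a e \<subseteq> U" using U open_contains_ball by blast
  \<comment> \<open>the parallelogram with \<open>\<bar>s\<bar>, \<bar>t\<bar> \<le> d\<close> stays inside the ball of radius \<open>e\<close>\<close>
  define d where "d = e / (norm v + norm w + 1)"
  have nn: "norm v + norm w + 1 > 0" by (simp add: add_nonneg_pos)
  have d: "d > 0" using e nn by (simp add: d_def)
  have inU: "a + s *\<^sub>R v + t *\<^sub>R w \<in> U" if "\<bar>s\<bar> \<le> d" "\<bar>t\<bar> \<le> d" for s t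
  proof -
    have "norm (s *\<^sub>R v + t *\<^sub>R w) \<le> d * norm v + d * norm w"
      using that by (intro norm_triangle_mono) (auto intro!: mult_right_mono)
    also have "\<dots> < d * (norm v + norm w + 1)" using d by (simp add: algebra_simps)
    also have "\<dots> = e" using nn by (simp add: d_def)
    finally show ?thesis using e by (intro subsetD[OF e(2)]) (simp add: dist_norm norm_minus_commute add.assoc, simp add: add.commute)
  qed
  have der: "((\<lambda>s. g (a + s *\<^sub>R v + t *\<^sub>R w)) has_vector_derivative ?D g v (a + s *\<^sub>R v + t *\<^sub>R w)) (at s within S)"
    "((\<lambda>t. g (a + s *\<^sub>R v + t *\<^sub>R w)) has_vector_derivative ?D g w (a + s *\<^sub>R v + t *\<^sub>R w)) (at t within S)"
    if g: "smooth_on g U" and st: "\<bar>s\<bar> \<le> d" "\<bar>t\<bar> \<le> d" for g :: "'a \<Rightarrow> 'b" and s t S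
  proof -
    note D = smooth_on_has_derivative[OF g inU[OF st]]
    have 1: "((\<lambda>s. a + s *\<^sub>R v + t *\<^sub>R w) has_derivative (\<lambda>x. x *\<^sub>R v)) (at s within S)"
      "((\<lambda>t. a + s *\<^sub>R v + t *\<^sub>R w) has_derivative (\<lambda>x. x *\<^sub>R w)) (at t within S)"
      by (auto intro!: derivative_eq_intros)
    show "((\<lambda>s. g (a + s *\<^sub>R v + t *\<^sub>R w)) has_vector_derivative ?D g v (a + s *\<^sub>R v + t *\<^sub>R w)) (at s within S)"
      "((\<lambda>t. g (a + s *\<^sub>R v + t *\<^sub>R w)) has_vector_derivative ?D g w (a + s *\<^sub>R v + t *\<^sub>R w)) (at t within S)"
      using has_derivative_compose[OF 1(1) D] has_derivative_compose[OF 1(2) D]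
      unfolding has_vector_derivative_def by (simp_all add: linear_cmul[OF has_derivative_linear[OF D]])
  qed
  note sv = smooth_on_FD[OF U(3), of v] and sw = smooth_on_FD[OF U(3), of w]
  have cont: "continuous_on S (\<lambda>p. ?D (?D h w) v (a + f p *\<^sub>R v + g p *\<^sub>R w))"
    if "continuous_on S f" "continuous_on S g" "\<And>p. p \<in> S \<Longrightarrow> \<bar>f p\<bar> \<le> d \<and> \<bar>g p\<bar> \<le> d"
    for f g :: "'c::topological_space \<Rightarrow> real" and S
    by (rule continuous_on_compose2[OF smooth_on_imp_continuous_on[OF smooth_on_FD[OF sw, of v]]])
      (use that inU in \<open>auto intro!: continuous_intros\<close>)
  have eq: "?D h v (a + 0 *\<^sub>R v + t *\<^sub>R w) - ?D h v a = integral {0..t} (\<lambda>\<tau>. ?D (?D h w) v (a + 0 *\<^sub>R v + \<tau> *\<^sub>R w))"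
    if t: "t \<in> {0..d}" for t
  proof -
    have int: "((\<lambda>\<tau>. ?D h w (a + s *\<^sub>R v + \<tau> *\<^sub>R w)) has_integral
        h (a + s *\<^sub>R v + t *\<^sub>R w) - h (a + s *\<^sub>R v + 0 *\<^sub>R w)) {0..t}" if "s \<in> {-d..d}" for s
      by (rule fundamental_theorem_of_calculus) (use t that in \<open>auto intro!: der(2)[OF U(3)]\<close>)
    have "((\<lambda>s. integral (cbox 0 t) (\<lambda>\<tau>. ?D h w (a + s *\<^sub>R v + \<tau> *\<^sub>R w))) has_vector_derivative
        integral (cbox 0 t) (\<lambda>\<tau>. ?D (?D h w) v (a + 0 *\<^sub>R v + \<tau> *\<^sub>R w))) (at 0 within {-d..d})"
    proof (rule leibniz_rule_vector_derivative)
      show "continuous_on ({-d..d} \<times> cbox 0 t) (\<lambda>(s, \<tau>). ?D (?D h w) v (a + s *\<^sub>R v + \<tau> *\<^sub>R w))"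
        unfolding case_prod_beta by (rule cont) (use t in \<open>auto intro!: continuous_intros\<close>)
    qed (use t d int in \<open>auto intro!: der(1)[OF sw] has_integral_integrable\<close>)
    moreover have "((\<lambda>s. integral (cbox 0 t) (\<lambda>\<tau>. ?D h w (a + s *\<^sub>R v + \<tau> *\<^sub>R w))) has_vector_derivative
        ?D h v (a + 0 *\<^sub>R v + t *\<^sub>R w) - ?D h v (a + 0 *\<^sub>R v + 0 *\<^sub>R w)) (at 0 within {-d..d})"
    proof (rule has_vector_derivative_transform)
      show "((\<lambda>s. h (a + s *\<^sub>R v + t *\<^sub>R w) - h (a + s *\<^sub>R v + 0 *\<^sub>R w)) has_vector_derivative
        ?D h v (a + 0 *\<^sub>R v + t *\<^sub>R w) - ?D h v (a + 0 *\<^sub>R v + 0 *\<^sub>R w)) (at 0 within {-d..d})"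
        by (rule has_vector_derivative_diff; rule der(1)[OF U(3)]) (use t d in auto)
    qed (use d int in \<open>auto simp: integral_unique\<close>)
    moreover have "at 0 within {-d..d} \<noteq> bot"
      using d by (simp add: trivial_limit_within islimpt_Icc)
    ultimately show ?thesis
      using vector_derivative_unique_within by fastforce
  qed
  have "((\<lambda>t. ?D h v (a + 0 *\<^sub>R v + t *\<^sub>R w) - ?D h v a) has_vector_derivative ?D (?D h v) w (a + 0 *\<^sub>R v + 0 *\<^sub>R w) - 0)
     (at 0 within {0..d})"
    by (intro has_vector_derivative_diff der(2)[OF sv] has_vector_derivative_const) (use d in auto)
  moreover have "((\<lambda>t. ?D h v (a + 0 *\<^sub>R v + t *\<^sub>R w) - ?D h v a) has_vector_derivative ?D (?D h w) v (a + 0 *\<^sub>R v + 0 *\<^sub>R w))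
     (at 0 within {0..d})"
  proof (rule has_vector_derivative_transform)
    show "((\<lambda>t. integral {0..t} (\<lambda>\<tau>. ?D (?D h w) v (a + 0 *\<^sub>R v + \<tau> *\<^sub>R w))) has_vector_derivative
       ?D (?D h w) v (a + 0 *\<^sub>R v + 0 *\<^sub>R w)) (at 0 within {0..d})"
      by (rule integral_has_vector_derivative[OF cont]) (use d in \<open>auto intro!: continuous_intros\<close>)
  qed (use d eq in auto)
  moreover have "at 0 within {0..d} \<noteq> bot"
    using d by (simp add: trivial_limit_within islimpt_Icc)
  ultimately show ?thesis using vector_derivative_unique_within by fastforce
qed


section \<open>The cosine as a function of the square of its argument\<close>

lemma smooth_on_deriv:
  fixes f :: "real \<Rightarrow> real"
  assumes "open S" "smooth_on f S"
  shows "x \<in> S \<Longrightarrow> (f has_real_derivative deriv f x) (at x)" and "smooth_on (deriv f) S"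
proof -
  have *: "(f has_real_derivative FD f x 1) (at x)" if "x \<in> S" for x
  proof -
    note D = smooth_on_has_derivative[OF assms(2) that]
    have "FD f x = (*) (FD f x 1)"
    proof
      fix h :: real
      show "FD f x h = FD f x 1 * h"
        using linear_cmul[OF has_derivative_linear[OF D], of h 1] by simp
    qed
    with D show ?thesis unfolding has_field_derivative_def
      by (rule back_subst[of "\<lambda>D. (f has_derivative D) (at x)"])
  qed
  have eq: "FD f x 1 = deriv f x" if "x \<in> S" for x
    using DERIV_imp_deriv[OF *[OF that]] by simp
  show "x \<in> S \<Longrightarrow> (f has_real_derivative deriv f x) (at x)" using *[of x] eq[of x] by simp
  show "smooth_on (deriv f) S"
    by (rule smooth_on_cong[OF assms(1) eq smooth_on_FD[OF assms(2)]])
qed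

lemma smooth_on_coinduct_deriv:
  fixes P :: "(real \<Rightarrow> real) \<Rightarrow> bool"
  assumes "open S" "P f"
    and "\<And>f. P f \<Longrightarrow> \<exists>g. P g \<and> (\<forall>x\<in>S. (f has_real_derivative g x) (at x))"
  shows "smooth_on f S"
  by (rule smooth_on_coinduct_real[where P = P, OF assms(1,2)])
    (use assms(3) in \<open>simp add: has_real_derivative_iff_has_vector_derivative\<close>)

lemma poly_over_exp_tendsto_0: "((\<lambda>u. poly p u / exp u) \<longlongrightarrow> 0) at_top" for p :: "real poly"
proof -
  have "((\<lambda>u. \<Sum>i\<le>degree p. coeff p i * (u ^ i / exp u)) \<longlongrightarrow> (\<Sum>i\<le>degree p. coeff p i * 0)) at_top"
    by (intro tendsto_sum tendsto_mult tendsto_const tendsto_power_div_exp_0)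
  then show ?thesis by (simp add: poly_altdef sum_divide_distrib)
qed

definition flat :: "real \<Rightarrow> real" where
  "flat x = (if x > 0 then exp (- (1 / x)) else 0)"

text \<open>
  Functions that are \<open>p(1/x) exp(-1/x)\<close> for \<open>x > 0\<close>, with a polynomial \<open>p\<close>, and \<open>0\<close> elsewhere are closed
  under differentiation; at \<open>0\<close> this rests on the decay of \<open>p(u) exp(-u)\<close> at infinity.
\<close>

lemma smooth_on_flat: "smooth_on flat UNIV"
proof (rule smooth_on_coinduct_deriv)
  let ?f = "\<lambda>p x::real. if x > 0 then poly p (1 / x) * exp (- (1 / x)) else 0"
  show "\<exists>p. flat = ?f p" by (rule exI[of _ 1]) (auto simp: flat_def)
  fix f assume "\<exists>p. f = ?f p"
  then obtain p where f: "f = ?f p" by blast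
  let ?q = "[:0, 0, 1:] * (p - pderiv p)"
  have "(?f p has_real_derivative ?f ?q x) (at x)" for x
  proof -
    consider "x > 0" | "x < 0" | "x = 0" by linarith
    then show ?thesis
    proof cases
      case 1
      have inv: "((\<lambda>x. 1 / x) has_real_derivative - (1 / x\<^sup>2)) (at x)"
        using 1 by (auto intro!: derivative_eq_intros simp: power2_eq_square)
      have "((\<lambda>x. poly p (1 / x)) has_real_derivative poly (pderiv p) (1 / x) * - (1 / x\<^sup>2)) (at x)"
        by (rule DERIV_chain2[OF poly_DERIV inv])
      moreover have "((\<lambda>x. exp (- (1 / x))) has_real_derivative exp (- (1 / x)) * (1 / x\<^sup>2)) (at x)"
        using DERIV_chain2[OF DERIV_exp DERIV_minus[OF inv]] by simp
      ultimately have "((\<lambda>x. poly p (1 / x) * exp (- (1 / x))) has_real_derivative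
          poly ?q (1 / x) * exp (- (1 / x))) (at x)"
        by (rule DERIV_cong[OF DERIV_mult]) (simp add: field_simps power2_eq_square, simp add: diff_divide_distrib)
      moreover have "\<forall>\<^sub>F y in nhds x. poly p (1 / y) * exp (- (1 / y)) = ?f p y"
        using eventually_nhds_in_open[of "{0<..}" x] 1 by (auto elim: eventually_mono)
      ultimately show ?thesis using 1 by (simp add: DERIV_cong_ev[OF refl _ refl])
    next
      case 2
      have "\<forall>\<^sub>F y in nhds x. 0 = ?f p y"
        using eventually_nhds_in_open[of "{..<0}" x] 2 by (auto elim: eventually_mono)
      from DERIV_cong_ev[OF refl this refl, of 0] show ?thesis using 2 by simp
    next
      case 3
      have "((\<lambda>y. ?f p y / y) \<longlongrightarrow> 0) (at_right 0)"
      proof (rule Lim_transform_eventually)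
        show "((\<lambda>y::real. poly ([:0, 1:] * p) (inverse y) / exp (inverse y)) \<longlongrightarrow> 0) (at_right 0)"
          by (rule filterlim_compose[OF poly_over_exp_tendsto_0 filterlim_inverse_at_top_right])
        show "\<forall>\<^sub>F y in at_right 0. poly ([:0, 1:] * p) (inverse y) / exp (inverse y) = ?f p y / y"
          by (rule eventually_at_right_less[THEN eventually_mono]) (simp add: field_simps exp_minus)
      qed
      moreover have "((\<lambda>y. ?f p y / y) \<longlongrightarrow> 0) (at_left 0)"
        by (rule tendsto_eventually)
          (auto simp: eventually_at_filter intro!: always_eventually)
      ultimately have "((\<lambda>y. ?f p y / y) \<longlongrightarrow> 0) (at 0)"
        by (simp add: filterlim_at_split)
      then show ?thesis using 3 by (simp add: has_field_derivative_iff)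
    qed
  qed
  then show "\<exists>g. (\<exists>p. g = ?f p) \<and> (\<forall>x\<in>UNIV. (f has_real_derivative g x) (at x))"
    using f by blast
qed simp

text \<open>
  The entire function that is \<open>cos(sqrt z)\<close> for \<open>z \<ge> 0\<close> and \<open>cosh(sqrt(-z))\<close> for \<open>z \<le> 0\<close>.
\<close>

definition cos_sqrt :: "real \<Rightarrow> real" where
  "cos_sqrt z = (\<Sum>n. (-1) ^ n / fact (2 * n) * z ^ n)"

lemma cos_sqrt_summable: "summable (\<lambda>n. (-1) ^ n / fact (2 * n) * z ^ n :: real)"
proof (rule summable_comparison_test')
  show "summable (\<lambda>n. \<bar>z\<bar> ^ n / fact n)" using summable_exp[of "\<bar>z\<bar>"] by (simp add: field_simps)
  show "norm ((-1) ^ n / fact (2 * n) * z ^ n) \<le> \<bar>z\<bar> ^ n / fact n" if "n \<ge> 0" for n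
  proof -
    have "(fact n :: real) \<le> fact (2 * n)" by (rule fact_mono) simp
    then have "\<bar>z\<bar> ^ n / fact (2 * n) \<le> \<bar>z\<bar> ^ n / fact n" by (intro divide_left_mono) auto
    then show ?thesis by (simp add: abs_mult power_abs)
  qed
qed

lemma cos_sqrt_square: "cos_sqrt (t\<^sup>2) = cos t"
  unfolding cos_sqrt_def using sums_unique[OF cos_paired[of t]] by (simp add: power_mult)

lemma cos_sqrt_deriv_0: "(cos_sqrt has_real_derivative - 1 / 2) (at 0)"
proof -
  let ?c = "\<lambda>n. (-1) ^ n / fact (2 * n) :: real"
  have "((\<lambda>x. \<Sum>n. ?c n * x ^ n) has_real_derivative (\<Sum>n. diffs ?c n * 0 ^ n)) (at 0)"
    by (rule termdiffs_strong_converges_everywhere) (rule cos_sqrt_summable)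
  moreover have "(\<Sum>n. diffs ?c n * 0 ^ n) = - 1 / 2"
    by (subst powser_zero) (simp add: diffs_def)
  ultimately show ?thesis unfolding cos_sqrt_def[abs_def] by simp
qed

lemma smooth_on_cos_sqrt: "smooth_on cos_sqrt UNIV"
proof (rule smooth_on_coinduct_deriv)
  let ?P = "\<lambda>f. \<exists>c::nat \<Rightarrow> real. (\<forall>x. summable (\<lambda>n. c n * x ^ n)) \<and> f = (\<lambda>x. \<Sum>n. c n * x ^ n)"
  show "?P cos_sqrt"
    using cos_sqrt_summable by (intro exI[of _ "\<lambda>n. (-1) ^ n / fact (2 * n)"]) (auto simp: cos_sqrt_def)
  fix f assume "?P f"
  then obtain c :: "nat \<Rightarrow> real" where c: "\<And>x. summable (\<lambda>n. c n * x ^ n)" "f = (\<lambda>x. \<Sum>n. c n * x ^ n)"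
    by blast
  have "?P (\<lambda>x. \<Sum>n. diffs c n * x ^ n)"
    using termdiff_converges_all[of c] c(1) by blast
  moreover have "\<forall>x\<in>UNIV. (f has_real_derivative (\<Sum>n. diffs c n * x ^ n)) (at x)"
    using termdiffs_strong_converges_everywhere[of c] c by simp
  ultimately show "\<exists>g. ?P g \<and> (\<forall>x\<in>UNIV. (f has_real_derivative g x) (at x))" by blast
qed simp

definition all_derivs_bounded :: "(real \<Rightarrow> real) \<Rightarrow> bool" where
  "all_derivs_bounded \<kappa> \<longleftrightarrow> smooth_on \<kappa> UNIV \<and> (\<forall>i. bounded (range ((deriv ^^ i) \<kappa>)))"

lemma all_derivs_boundedD:
  assumes "all_derivs_bounded \<kappa>"
  shows "(\<kappa> has_real_derivative deriv \<kappa> z) (at z)" "all_derivs_bounded (deriv \<kappa>)" "bounded (range \<kappa>)"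
proof -
  show "(\<kappa> has_real_derivative deriv \<kappa> z) (at z)"
    using assms smooth_on_deriv(1)[of UNIV \<kappa> z] by (simp add: all_derivs_bounded_def)
  show "bounded (range \<kappa>)" using assms unfolding all_derivs_bounded_def by (metis funpow_0)
  have "bounded (range ((deriv ^^ i) (deriv \<kappa>)))" for i
  proof -
    have "bounded (range ((deriv ^^ Suc i) \<kappa>))"
      using assms unfolding all_derivs_bounded_def by blast
    then show ?thesis by (simp only: funpow_Suc_right o_apply)
  qed
  then show "all_derivs_bounded (deriv \<kappa>)"
    using assms smooth_on_deriv(2)[of UNIV \<kappa>] by (simp add: all_derivs_bounded_def)
qed

lemma higher_deriv_cong_open:
  assumes "open S" "\<And>x. x \<in> S \<Longrightarrow> f x = g x" "x \<in> S"
  shows "(deriv ^^ i) f x = (deriv ^^ i) g x"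
  using assms(3)
proof (induction i arbitrary: x)
  case 0
  then show ?case using assms(2) by simp
next
  case (Suc i)
  have "\<forall>\<^sub>F y in nhds x. (deriv ^^ i) f y = (deriv ^^ i) g y"
    using assms(1) Suc unfolding eventually_nhds by blast
  then show ?case by (simp add: deriv_cong_ev)
qed

text \<open>
  The derivatives have the form \<open>p(u) cos(sqrt z) + q(u) sin(sqrt z)\<close> with polynomials \<open>p\<close> and \<open>q\<close> in
  \<open>u = 1/sqrt z\<close>, and \<open>u\<close> stays in \<open>[0, 1]\<close>.
\<close>

lemma higher_deriv_cos_sqrt_bounded: "bounded ((deriv ^^ i) (\<lambda>z. cos (sqrt z)) ` {1<..})"
proof -
  let ?f = "\<lambda>p q z. poly p (1 / sqrt z) * cos (sqrt z) + poly q (1 / sqrt z) * sin (sqrt z)"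
  have der: "(?f p q has_real_derivative
      ?f (- [:0, 0, 0, 1 / 2:] * pderiv p + [:0, 1 / 2:] * q) (- [:0, 0, 0, 1 / 2:] * pderiv q - [:0, 1 / 2:] * p) z) (at z)"
    if z: "z > 1" for p q z
  proof -
    have s: "(sqrt has_real_derivative 1 / 2 * (1 / sqrt z)) (at z)"
      using DERIV_real_sqrt[of z] z by (simp add: inverse_eq_divide mult.commute)
    have u: "((\<lambda>z. 1 / sqrt z) has_real_derivative - (1 / 2 * (1 / sqrt z) ^ 3)) (at z)"
      using z by (intro DERIV_cong[OF DERIV_divide[OF DERIV_const s]]) (auto simp: power3_eq_cube)
    define w where "w = 1 / sqrt z"
    show ?thesis
      by (rule DERIV_cong[OF DERIV_add[OF
            DERIV_mult[OF DERIV_chain2[OF poly_DERIV u] DERIV_chain2[OF DERIV_cos s]]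
            DERIV_mult[OF DERIV_chain2[OF poly_DERIV u] DERIV_chain2[OF DERIV_sin s]]]])
        (unfold w_def[symmetric], simp add: algebra_simps power3_eq_cube)
  qed
  have "\<exists>p q. \<forall>z\<in>{1<..}. (deriv ^^ i) (\<lambda>z. cos (sqrt z)) z = ?f p q z"
  proof (induction i)
    case 0
    show ?case by (rule exI[of _ 1], rule exI[of _ 0]) simp
  next
    case (Suc i)
    then obtain p q where pq: "\<And>z. z \<in> {1<..} \<Longrightarrow> (deriv ^^ i) (\<lambda>z. cos (sqrt z)) z = ?f p q z" by blast
    have "(deriv ^^ Suc i) (\<lambda>z. cos (sqrt z)) z = deriv (?f p q) z" if "z \<in> {1<..}" for z
      using higher_deriv_cong_open[where i = 1, OF open_greaterThan pq that] by simp
    moreover have "deriv (?f p q) z = ?f (- [:0, 0, 0, 1 / 2:] * pderiv p + [:0, 1 / 2:] * q)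
        (- [:0, 0, 0, 1 / 2:] * pderiv q - [:0, 1 / 2:] * p) z" if "z \<in> {1<..}" for z
      by (rule DERIV_imp_deriv[OF der]) (use that in simp)
    ultimately show ?case by (intro exI ballI) (rule trans)
  qed
  then obtain p q where pq: "\<And>z. z \<in> {1<..} \<Longrightarrow> (deriv ^^ i) (\<lambda>z. cos (sqrt z)) z = ?f p q z" by blast
  have bd: "\<exists>B. \<forall>u\<in>{0..1}. \<bar>poly r u\<bar> \<le> B" for r :: "real poly"
  proof -
    have "compact (poly r ` {0..1})" by (intro compact_continuous_image continuous_intros) auto
    then have "bounded (poly r ` {0..1})" by (rule compact_imp_bounded)
    then show ?thesis unfolding bounded_iff by simp
  qed
  obtain P Q where PQ: "\<And>u. u \<in> {0..1} \<Longrightarrow> \<bar>poly p u\<bar> \<le> P" "\<And>u. u \<in> {0..1} \<Longrightarrow> \<bar>poly q u\<bar> \<le> Q"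
    using bd[of p] bd[of q] by blast
  have "\<bar>?f p q z\<bar> \<le> P + Q" if "z > 1" for z
  proof -
    have u: "1 / sqrt z \<in> {0..1}" using that by simp
    have "\<bar>poly p (1 / sqrt z) * cos (sqrt z)\<bar> \<le> P * 1"
      unfolding abs_mult by (intro mult_mono PQ u abs_cos_le_one) (use PQ(1)[OF u] in auto)
    moreover have "\<bar>poly q (1 / sqrt z) * sin (sqrt z)\<bar> \<le> Q * 1"
      unfolding abs_mult by (intro mult_mono PQ u abs_sin_le_one) (use PQ(2)[OF u] in auto)
    ultimately show ?thesis by linarith
  qed
  then show ?thesis unfolding bounded_iff using pq by (intro exI[of _ "P + Q"]) auto
qed

text \<open>
  The quotient is a smooth step that is \<open>1\<close> for \<open>z \<ge> 0\<close> and \<open>0\<close> for \<open>z \<le> -1\<close>. It removes the exponential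
  growth of \<open>cos_sqrt\<close> on the negative axis and keeps the values at squares.
\<close>

definition cut_cos :: "real \<Rightarrow> real" where
  "cut_cos z = cos_sqrt z * (flat (1 + z) / (flat (1 + z) + flat (- z)))"

lemma cut_cos_square: "cut_cos (t\<^sup>2) = cos t"
proof -
  have "flat (1 + t\<^sup>2) > 0" "flat (- t\<^sup>2) = 0"
    by (auto simp: flat_def add_pos_nonneg)
  then show ?thesis by (simp add: cut_cos_def cos_sqrt_square)
qed

lemma smooth_on_cut_cos: "smooth_on cut_cos UNIV"
  unfolding smooth_on_iff_germs[OF open_UNIV]
proof
  fix z :: real
  have flat: "smooth_germ flat x" and cos: "smooth_germ cos_sqrt x" for x
    using smooth_on_flat smooth_on_cos_sqrt by (auto simp: smooth_on_iff_germs)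
  have "flat (1 + z) + flat (- z) > 0"
    by (cases "z < 0") (auto simp: flat_def add_pos_nonneg add_nonneg_pos)
  moreover have "smooth_germ (\<lambda>z. flat (1 + z)) z" "smooth_germ (\<lambda>z. flat (- z)) z"
    by (rule smooth_germ_compose[OF flat]; intro smooth_intros)+
  ultimately show "smooth_germ cut_cos z"
    unfolding cut_cos_def[abs_def]
    by (intro smooth_germ_mult cos smooth_germ_divide smooth_germ_add) auto
qed

lemma all_derivs_bounded_cut_cos: "all_derivs_bounded cut_cos"
proof -
  have sm: "smooth_on ((deriv ^^ i) cut_cos) UNIV" for i
    by (induction i) (auto simp: smooth_on_cut_cos intro: smooth_on_deriv(2))
  have "bounded (range ((deriv ^^ i) cut_cos))" for i
  proof -
    let ?d = "(deriv ^^ i) cut_cos"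
    have 1: "bounded (?d ` {-1..1})"
      by (intro compact_imp_bounded compact_continuous_image
          continuous_on_subset[OF smooth_on_imp_continuous_on[OF sm]]) auto
    have "cut_cos z = cos (sqrt z)" if "z \<in> {1<..}" for z
      using cut_cos_square[of "sqrt z"] that by simp
    then have "?d z = (deriv ^^ i) (\<lambda>z. cos (sqrt z)) z" if "z \<in> {1<..}" for z
      using that by (rule higher_deriv_cong_open[OF open_greaterThan])
    then have 2: "bounded (?d ` {1<..})"
      using higher_deriv_cos_sqrt_bounded[of i] by (simp cong: image_cong_simp)
    have "?d z = (deriv ^^ i) (\<lambda>z. 0) z" if "z \<in> {..<-1}" for z
      using that by (rule higher_deriv_cong_open[OF open_lessThan, rotated])
        (simp add: cut_cos_def flat_def)
    moreover have "(deriv ^^ i) (\<lambda>z. 0::real) = (\<lambda>z. 0)" by (induction i) auto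
    ultimately have "?d ` {..<-1} \<subseteq> {0}" by auto
    then have 3: "bounded (?d ` {..<-1})" by (rule bounded_subset[rotated]) simp
    have "range ?d = ?d ` {-1..1} \<union> ?d ` {1<..} \<union> ?d ` {..<-1}"
      unfolding image_Un[symmetric] by (rule arg_cong[of _ _ "image ?d"]) auto
    then show ?thesis using 1 2 3 by simp
  qed
  then show ?thesis by (simp add: all_derivs_bounded_def smooth_on_cut_cos)
qed


section \<open>Cosine series of continuous functions\<close>

lemma has_integral_cos_int:
  "((\<lambda>\<theta>. cos (of_int k * \<theta>)) has_integral (if k = 0 then pi else 0)) {0..pi}"
proof (cases "k = 0")
  case True
  then show ?thesis using has_integral_const_real[of "1::real" 0 pi] by simp
next
  case False
  have "((\<lambda>\<theta>. sin (of_int k * \<theta>) / of_int k) has_vector_derivative cos (of_int k * \<theta>)) (at \<theta> within {0..pi})" for \<theta>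
    unfolding has_real_derivative_iff_has_vector_derivative[symmetric]
    using False by (auto intro!: derivative_eq_intros)
  then have "((\<lambda>\<theta>. cos (of_int k * \<theta>)) has_integral
      sin (of_int k * pi) / of_int k - sin (of_int k * 0) / of_int k) {0..pi}"
    by (intro fundamental_theorem_of_calculus) auto
  then show ?thesis
    using False sin_npi_int[of k] by (simp add: mult.commute)
qed

lemma has_integral_cos_cos:
  fixes n m :: nat
  shows "((\<lambda>\<theta>. cos (real n * \<theta>) * cos (real m * \<theta>)) has_integral
    (if n = m then (if n = 0 then pi else pi / 2) else 0)) {0..pi}"
proof -
  have "((\<lambda>\<theta>. 1 / 2 * cos (of_int (int n - int m) * \<theta>) + 1 / 2 * cos (of_int (int n + int m) * \<theta>)) has_integral
     1 / 2 * (if int n - int m = 0 then pi else 0) + 1 / 2 * (if int n + int m = 0 then pi else 0)) {0..pi}"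
    by (intro has_integral_add has_integral_mult_right has_integral_cos_int)
  moreover have "1 / 2 * cos (of_int (int n - int m) * \<theta>) + 1 / 2 * cos (of_int (int n + int m) * \<theta>)
      = cos (real n * \<theta>) * cos (real m * \<theta>)" for \<theta>
    by (simp add: cos_times_cos distrib_right left_diff_distrib)
  moreover have "1 / 2 * (if int n - int m = 0 then pi else 0) + 1 / 2 * (if int n + int m = 0 then pi else 0)
      = (if n = m then (if n = 0 then pi else pi / 2) else 0)"
    by auto
  ultimately show ?thesis by (simp only:)
qed

text \<open>
  The product of two cosines is a sum of cosines, so \<open>D\<close> is orthogonal to all polynomials in \<open>cos \<theta>\<close>.
  As \<open>cos\<close> is injective on \<open>[0, \<pi>]\<close>, these are uniformly dense by the Stone-Weierstrass theorem,
  whence \<open>D\<close> is orthogonal to itself.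
\<close>

lemma orthogonal_to_cosines_imp_zero:
  assumes cont: "continuous_on {0..pi} D"
    and orth: "\<And>m::nat. ((\<lambda>\<theta>. D \<theta> * cos (real m * \<theta>)) has_integral 0) {0..pi}"
    and "\<theta> \<in> {0..pi}"
  shows "D \<theta> = (0::real)"
proof -
  have 1: "((\<lambda>\<theta>. D \<theta> * cos \<theta> ^ k * cos (of_int m * \<theta>)) has_integral 0) {0..pi}" for k and m :: int
  proof (induction k arbitrary: m)
    case 0
    have "cos (of_int m * \<theta>) = cos (real (nat \<bar>m\<bar>) * \<theta>)" for \<theta> :: real
      by (cases "m \<ge> 0") (simp_all add: minus_mult_left[symmetric])
    then show ?case using orth[of "nat \<bar>m\<bar>"] by simp
  next
    case (Suc k)
    have "((\<lambda>\<theta>. 1 / 2 * (D \<theta> * cos \<theta> ^ k * cos (of_int (m + 1) * \<theta>)) +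
       1 / 2 * (D \<theta> * cos \<theta> ^ k * cos (of_int (m - 1) * \<theta>))) has_integral 1 / 2 * 0 + 1 / 2 * 0) {0..pi}"
      by (intro has_integral_add has_integral_mult_right Suc.IH)
    moreover have "1 / 2 * (D \<theta> * cos \<theta> ^ k * cos (of_int (m + 1) * \<theta>)) +
       1 / 2 * (D \<theta> * cos \<theta> ^ k * cos (of_int (m - 1) * \<theta>)) = D \<theta> * cos \<theta> ^ Suc k * cos (of_int m * \<theta>)" for \<theta>
      by (simp add: distrib_right left_diff_distrib cos_add cos_diff algebra_simps)
    ultimately show ?case by simp
  qed
  have 2: "((\<lambda>\<theta>. D \<theta> * poly p (cos \<theta>)) has_integral 0) {0..pi}" for p
  proof -
    have "((\<lambda>\<theta>. \<Sum>i\<le>degree p. coeff p i * (D \<theta> * cos \<theta> ^ i * cos (of_int 0 * \<theta>))) has_integral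
        (\<Sum>i\<le>degree p. coeff p i * 0)) {0..pi}"
      by (intro has_integral_sum has_integral_mult_right 1) simp
    then show ?thesis by (simp add: poly_altdef sum_distrib_left mult_ac)
  qed
  interpret function_ring_on "{\<lambda>\<theta>. poly p (cos \<theta>) | p::real poly. True}" "{0..pi}"
  proof
    show "\<exists>f\<in>{\<lambda>\<theta>. poly p (cos \<theta>) | p::real poly. True}. f x \<noteq> f y"
      if "x \<in> {0..pi}" "y \<in> {0..pi}" "x \<noteq> y" for x y
    proof (rule bexI[of _ "\<lambda>\<theta>. poly [:0, 1:] (cos \<theta>)"])
      show "poly [:0, 1:] (cos x) \<noteq> poly [:0, 1:] (cos y)"
        using cos_inj_pi[of x y] that by auto
    qed blast
    show "(\<lambda>x. f x + g x) \<in> {\<lambda>\<theta>. poly p (cos \<theta>) | p::real poly. True}"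
      if fg: "f \<in> {\<lambda>\<theta>. poly p (cos \<theta>) | p::real poly. True}" "g \<in> {\<lambda>\<theta>. poly p (cos \<theta>) | p::real poly. True}" for f g
    proof -
      obtain p q where "f = (\<lambda>\<theta>. poly p (cos \<theta>))" "g = (\<lambda>\<theta>. poly q (cos \<theta>))" using fg by auto
      then have "(\<lambda>x. f x + g x) = (\<lambda>\<theta>. poly (p + q) (cos \<theta>))" by simp
      then show ?thesis by blast
    qed
    show "(\<lambda>x. f x * g x) \<in> {\<lambda>\<theta>. poly p (cos \<theta>) | p::real poly. True}"
      if fg: "f \<in> {\<lambda>\<theta>. poly p (cos \<theta>) | p::real poly. True}" "g \<in> {\<lambda>\<theta>. poly p (cos \<theta>) | p::real poly. True}" for f g
    proof -
      obtain p q where "f = (\<lambda>\<theta>. poly p (cos \<theta>))" "g = (\<lambda>\<theta>. poly q (cos \<theta>))" using fg by auto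
      then have "(\<lambda>x. f x * g x) = (\<lambda>\<theta>. poly (p * q) (cos \<theta>))" by simp
      then show ?thesis by blast
    qed
    show "(\<lambda>_. c) \<in> {\<lambda>\<theta>. poly p (cos \<theta>) | p::real poly. True}" for c
    proof -
      have "(\<lambda>_. c) = (\<lambda>\<theta>. poly [:c:] (cos \<theta>))" by simp
      then show ?thesis by blast
    qed
  qed (auto intro!: continuous_intros)
  obtain B where B: "B > 0" "\<And>\<theta>. \<theta> \<in> {0..pi} \<Longrightarrow> \<bar>D \<theta>\<bar> \<le> B"
  proof -
    have "bounded (D ` {0..pi})"
      by (intro compact_imp_bounded compact_continuous_image cont) simp
    then show ?thesis using that unfolding bounded_pos by auto
  qed
  let ?i = "integral {0..pi} (\<lambda>\<theta>. D \<theta> * D \<theta>)"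
  have i: "((\<lambda>\<theta>. D \<theta> * D \<theta>) has_integral ?i) {0..pi}"
    by (intro integrable_integral integrable_continuous_real continuous_intros cont)
  have "\<bar>?i\<bar> \<le> e" if "e > 0" for e
  proof -
    have "e / (B * pi) > 0" using that B by simp
    from Stone_Weierstrass_basic[OF cont this] obtain p where
      p: "\<forall>\<theta>\<in>{0..pi}. \<bar>D \<theta> - poly p (cos \<theta>)\<bar> < e / (B * pi)" by auto
    have "((\<lambda>\<theta>. D \<theta> * D \<theta> - D \<theta> * poly p (cos \<theta>)) has_integral ?i - 0) {0..pi}"
      by (rule has_integral_diff[OF i 2])
    then have "norm (?i - 0) \<le> (B * (e / (B * pi))) * measure lborel {0..pi}"
    proof (rule has_integral_bound_real[where S = "{}", rotated 2])
      show "norm (D \<theta> * D \<theta> - D \<theta> * poly p (cos \<theta>)) \<le> B * (e / (B * pi))" if "\<theta> \<in> {0..pi} - {}" for \<theta>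
        unfolding right_diff_distrib[symmetric] real_norm_def abs_mult
        using B p that by (intro mult_mono) (auto intro: less_imp_le)
    qed (use B that in auto)
    then show ?thesis using B by simp
  qed
  then have "\<bar>?i\<bar> \<le> 0" by (rule field_le_epsilon[where y = 0, simplified])
  moreover have "continuous_on {0..pi} (\<lambda>\<theta>. D \<theta> * D \<theta>)" by (intro continuous_intros cont)
  ultimately have "\<forall>\<theta>\<in>{0..pi}. D \<theta> * D \<theta> = 0"
    using integral_eq_0_iff[of 0 pi "\<lambda>\<theta>. D \<theta> * D \<theta>"] by simp
  then show ?thesis using assms(3) by simp
qed

definition cosine_coefficient :: "(real \<Rightarrow> real) \<Rightarrow> nat \<Rightarrow> real" where
  "cosine_coefficient h n = (if n = 0 then 1 / pi else 2 / pi) * integral {0..pi} (\<lambda>\<theta>. h \<theta> * cos (real n * \<theta>))"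

text \<open>
  Both \<open>h\<close> and the uniformly convergent series are continuous and have the same cosine coefficients.
\<close>

lemma cosine_series:
  assumes cont: "continuous_on {0..pi} h" and summ: "summable (\<lambda>n. \<bar>cosine_coefficient h n\<bar>)" and \<theta>: "\<theta> \<in> {0..pi}"
  shows "(\<Sum>n. cosine_coefficient h n * cos (real n * \<theta>)) = h \<theta>"
proof -
  let ?a = "cosine_coefficient h"
  let ?S = "\<lambda>\<theta>. \<Sum>n. ?a n * cos (real n * \<theta>)"
  have le: "norm (?a n * cos (real n * \<theta>)) \<le> \<bar>?a n\<bar>" for n \<theta>
    by (simp add: abs_mult mult_left_le)
  have sumS: "summable (\<lambda>n. ?a n * cos (real n * \<theta>))" for \<theta>
    by (rule summable_comparison_test'[OF summ le])
  have contS: "continuous_on {0..pi} ?S"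
    by (rule uniform_limit_theorem[OF _ Weierstrass_m_test[OF le summ]])
      (auto intro!: always_eventually continuous_intros)
  have "((\<lambda>\<theta>. (h \<theta> - ?S \<theta>) * cos (real m * \<theta>)) has_integral 0) {0..pi}" for m :: nat
  proof -
    let ?f = "\<lambda>n \<theta>. ?a n * cos (real n * \<theta>) * cos (real m * \<theta>)"
    have "norm (?f n \<theta>) \<le> \<bar>?a n\<bar>" for n \<theta>
    proof -
      have "\<bar>?a n\<bar> * \<bar>cos (real n * \<theta>)\<bar> * \<bar>cos (real m * \<theta>)\<bar> \<le> \<bar>?a n\<bar> * 1 * 1"
        by (intro mult_mono) auto
      then show ?thesis by (simp add: abs_mult)
    qed
    from Weierstrass_m_test[OF this summ]
    have u: "uniform_limit {0..pi} (\<lambda>N \<theta>. \<Sum>n<N. ?f n \<theta>) (\<lambda>\<theta>. \<Sum>n. ?f n \<theta>) sequentially" .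
    obtain I J where I: "\<And>N. ((\<lambda>\<theta>. \<Sum>n<N. ?f n \<theta>) has_integral I N) {0..pi}"
      and J: "((\<lambda>\<theta>. \<Sum>n. ?f n \<theta>) has_integral J) {0..pi}" and lim: "I \<longlonglongrightarrow> J"
      by (rule uniform_limit_integral[OF u]) (auto intro!: continuous_intros)
    let ?w = "\<lambda>n. if n = m then (if n = 0 then pi else pi / 2) else 0"
    have "((\<lambda>\<theta>. \<Sum>n<N. ?a n * (cos (real n * \<theta>) * cos (real m * \<theta>))) has_integral (\<Sum>n<N. ?a n * ?w n)) {0..pi}" for N
      by (intro has_integral_sum has_integral_mult_right has_integral_cos_cos) simp
    then have IN: "I N = (\<Sum>n<N. ?a n * ?w n)" for N
      using has_integral_unique[OF I] by (simp add: mult.assoc)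
    have "\<forall>\<^sub>F N in sequentially. I N = ?a m * ?w m"
      using eventually_gt_at_top[of m]
    proof eventually_elim
      case (elim N)
      have "(\<Sum>n<N. ?a n * ?w n) = (\<Sum>n<N. if n = m then ?a m * ?w m else 0)"
        by (intro sum.cong) auto
      also have "\<dots> = ?a m * ?w m" using elim by (subst sum.delta) auto
      finally show ?case by (simp only: IN)
    qed
    then have "I \<longlonglongrightarrow> ?a m * ?w m" by (rule tendsto_eventually)
    with lim have "J = ?a m * ?w m" by (rule LIMSEQ_unique)
    also have "\<dots> = integral {0..pi} (\<lambda>\<theta>. h \<theta> * cos (real m * \<theta>))"
      by (simp add: cosine_coefficient_def)
    finally have "((\<lambda>\<theta>. h \<theta> * cos (real m * \<theta>)) has_integral J) {0..pi}"
      using cont by (auto intro!: integrable_integral integrable_continuous_real continuous_intros)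
    from has_integral_diff[OF this J] show ?thesis
      by (simp add: suminf_mult2[OF sumS] left_diff_distrib)
  qed
  from orthogonal_to_cosines_imp_zero[OF continuous_on_diff[OF cont contS] this \<theta>] show ?thesis by simp
qed


section \<open>Smooth families of even periodic functions\<close>

text \<open>
  The parameter in \<open>I\<close> is the first coordinate. In the second one these symmetries make a smooth
  function the sum of its cosine series.
\<close>

definition even_periodic :: "real set \<Rightarrow> (real ^ 2 \<Rightarrow> real) \<Rightarrow> bool" where
  "even_periodic I H \<longleftrightarrow> smooth_on H {z. z $ 1 \<in> I} \<and>
     (\<forall>x\<in>I. \<forall>\<theta>. H (pt x (- \<theta>)) = H (pt x \<theta>) \<and> H (pt x (\<theta> + 2 * pi)) = H (pt x \<theta>))"

abbreviation (input) pd :: "2 \<Rightarrow> (real ^ 2 \<Rightarrow> 'b::real_normed_vector) \<Rightarrow> real ^ 2 \<Rightarrow> 'b" where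
  "pd i H \<equiv> \<lambda>z. FD H z (axis i 1)"

lemma continuous_on_pt [continuous_intros]:
  "continuous_on A f \<Longrightarrow> continuous_on A g \<Longrightarrow> continuous_on A (\<lambda>x. pt (f x) (g x))"
  unfolding pt_def by (intro continuous_intros)

lemma open_strip: "open I \<Longrightarrow> open {z :: real ^ 2. z $ 1 \<in> I}"
  using open_vimage[of I "\<lambda>z :: real ^ 2. z $ 1"] by (simp add: vimage_def continuous_on_component)

lemma FD_symmetry:
  fixes H :: "'a::euclidean_space \<Rightarrow> real"
  assumes S: "open S" "smooth_on H S" and A: "\<And>z. (A has_derivative L) (at z)" "\<And>z. z \<in> S \<Longrightarrow> A z \<in> S"
    and H: "\<And>z. z \<in> S \<Longrightarrow> H (A z) = c * H z" and z: "z \<in> S"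
  shows "FD H (A z) (L v) = c * FD H z v"
proof -
  have "((\<lambda>z. H (A z)) has_derivative (\<lambda>v. FD H (A z) (L v))) (at z)"
    by (rule has_derivative_compose[OF A(1) smooth_on_has_derivative[OF S(2) A(2)[OF z]]])
  moreover have "((\<lambda>z. H (A z)) has_derivative (\<lambda>v. c * FD H z v)) (at z)"
  proof (rule has_derivative_transform_within_open[OF _ S(1) z])
    show "((\<lambda>z. c * H z) has_derivative (\<lambda>v. c * FD H z v)) (at z)"
      by (intro has_derivative_mult_right smooth_on_has_derivative[OF S(2) z])
  qed (simp add: H)
  ultimately show ?thesis using has_derivative_unique by metis
qed

text \<open>
  Differentiating a symmetry by the chain rule: the derivative in the second direction turns even
  functions into odd ones and conversely, which is why only its square preserves evenness.
\<close>

lemma even_periodic_symmetries: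
  fixes H :: "real ^ 2 \<Rightarrow> real"
  assumes I: "open I" and H: "smooth_on H {z. z $ 1 \<in> I}"
    and sym: "\<And>x \<theta>. x \<in> I \<Longrightarrow> H (pt x (- \<theta>)) = c * H (pt x \<theta>)"
      "\<And>x \<theta>. x \<in> I \<Longrightarrow> H (pt x (\<theta> + 2 * pi)) = H (pt x \<theta>)"
    and x: "x \<in> I"
  shows "pd 1 H (pt x (- \<theta>)) = c * pd 1 H (pt x \<theta>)" "pd 2 H (pt x (- \<theta>)) = - c * pd 2 H (pt x \<theta>)"
    "pd i H (pt x (\<theta> + 2 * pi)) = pd i H (pt x \<theta>)"
proof -
  let ?S = "{z :: real ^ 2. z $ 1 \<in> I}"
  let ?R = "\<lambda>z :: real ^ 2. pt (z $ 1) (- z $ 2)" and ?T = "\<lambda>z. z + pt 0 (2 * pi)"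
  have bl: "bounded_linear ?R"
    unfolding linear_conv_bounded_linear[symmetric]
    by (rule linearI) (simp_all add: vec_eq_iff forall_2)
  then have R: "(?R has_derivative ?R) (at z)" for z
    by (rule bounded_linear_imp_has_derivative)
  have T: "(?T has_derivative (\<lambda>v. v)) (at z)" for z
    by (auto intro!: derivative_eq_intros)
  have HR: "H (?R z) = c * H z" if "z \<in> ?S" for z
    using sym(1)[of "z $ 1" "z $ 2"] that by simp
  have Teq: "?T z = pt (z $ 1) (z $ 2 + 2 * pi)" for z by (simp add: vec_eq_iff forall_2)
  have HT: "H (?T z) = 1 * H z" if "z \<in> ?S" for z
    unfolding Teq using sym(2)[of "z $ 1" "z $ 2"] that by simp
  have z: "pt x \<theta> \<in> ?S" using x by simp
  have 1: "FD H (?R (pt x \<theta>)) (?R v) = c * FD H (pt x \<theta>) v" for v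
    by (rule FD_symmetry[OF open_strip[OF I] H R _ _ z]) (use HR in auto)
  have 2: "FD H (?T (pt x \<theta>)) v = 1 * FD H (pt x \<theta>) v" for v
    by (rule FD_symmetry[OF open_strip[OF I] H T _ _ z]) (use HT in auto)
  have e1: "?R (axis 1 1) = axis 1 1" and e2: "?R (axis 2 1) = - axis 2 1"
    by (simp_all add: vec_eq_iff forall_2 axis_def)
  show "pd 1 H (pt x (- \<theta>)) = c * pd 1 H (pt x \<theta>)"
    using 1[of "axis 1 1"] e1 by simp
  have "(H has_derivative FD H (pt x (- \<theta>))) (at (pt x (- \<theta>)))"
    using smooth_on_has_derivative[OF H] x by simp
  then have "FD H (pt x (- \<theta>)) (- axis 2 1) = - pd 2 H (pt x (- \<theta>))"
    by (rule linear_neg[OF has_derivative_linear])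
  then show "pd 2 H (pt x (- \<theta>)) = - c * pd 2 H (pt x \<theta>)"
    using 1[of "axis 2 1"] e2 by simp
  show "pd i H (pt x (\<theta> + 2 * pi)) = pd i H (pt x \<theta>)"
    using 2[of "axis i 1"] Teq[of "pt x \<theta>"] by simp
qed

lemma even_periodic_pd1:
  assumes "open I" "even_periodic I H" shows "even_periodic I (pd 1 H)"
  using assms(2) even_periodic_symmetries[where c = 1, OF assms(1), of H]
    smooth_on_FD[of H "{z. z $ 1 \<in> I}"]
  unfolding even_periodic_def by simp

text \<open>
  With this sign the operator multiplies the \<open>n\<close>-th cosine coefficient by \<open>n\<^sup>2\<close>.
\<close>

definition neg_pd22 :: "(real ^ 2 \<Rightarrow> real) \<Rightarrow> real ^ 2 \<Rightarrow> real" where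
  "neg_pd22 H z = - pd 2 (pd 2 H) z"

lemma pd2_symmetries:
  assumes I: "open I" and H: "even_periodic I H"
  shows "smooth_on (pd 2 H) {z. z $ 1 \<in> I}" "x \<in> I \<Longrightarrow> pd 2 H (pt x (- \<theta>)) = - pd 2 H (pt x \<theta>)"
    "x \<in> I \<Longrightarrow> pd 2 H (pt x (\<theta> + 2 * pi)) = pd 2 H (pt x \<theta>)"
  using H even_periodic_symmetries[where c = 1, OF I, of H]
    smooth_on_FD[of H "{z. z $ 1 \<in> I}"]
  unfolding even_periodic_def by simp_all

lemma even_periodic_neg_pd22:
  assumes I: "open I" and H: "even_periodic I H" shows "even_periodic I (neg_pd22 H)"
proof -
  note 2 = pd2_symmetries[OF I H]
  note 22 = even_periodic_symmetries(2,3)[where c = "-1", OF I 2(1)]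
  show ?thesis
    unfolding even_periodic_def neg_pd22_def[abs_def]
    using smooth_on_bounded_linear[OF bounded_linear_minus[OF bounded_linear_ident] open_strip[OF I]
        smooth_on_FD[OF 2(1)]] 22 2(2,3)
    by simp
qed

definition fourier_cos :: "(real ^ 2 \<Rightarrow> real) \<Rightarrow> nat \<Rightarrow> real \<Rightarrow> real" where
  "fourier_cos H n x = cosine_coefficient (\<lambda>\<theta>. H (pt x \<theta>)) n"

lemma even_periodic_continuous:
  assumes "even_periodic I H" "x \<in> I"
  shows "continuous_on A (\<lambda>\<theta>. H (pt x \<theta>))"
proof (rule continuous_on_compose2[OF smooth_on_imp_continuous_on[of H "{z. z $ 1 \<in> I}"]])
  show "smooth_on H {z. z $ 1 \<in> I}" using assms(1) by (simp add: even_periodic_def)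
  show "continuous_on A (pt x)" by (intro continuous_intros)
qed (use assms(2) in auto)

text \<open>
  Two integrations by parts, carried out at once by means of the antiderivative
  \<open>\<partial>\<^sub>2H cos(n \<theta>) + n H sin(n \<theta>)\<close>. It vanishes at \<open>0\<close> and \<open>\<pi>\<close>, since \<open>\<partial>\<^sub>2H\<close> is odd and periodic.
\<close>

lemma fourier_cos_neg_pd22:
  assumes I: "open I" and H: "even_periodic I H" and x: "x \<in> I"
  shows "fourier_cos (neg_pd22 H) n x = (real n)\<^sup>2 * fourier_cos H n x"
proof -
  note 2 = pd2_symmetries[OF I H]
  have pt: "((\<lambda>\<theta>. pt x \<theta>) has_derivative (\<lambda>t. t *\<^sub>R axis 2 1)) (at \<theta> within A)" for \<theta> A
    unfolding pt_def by (auto intro!: derivative_eq_intros)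
  have der: "((\<lambda>\<theta>. G (pt x \<theta>)) has_real_derivative pd 2 G (pt x \<theta>)) (at \<theta> within A)"
    if G: "smooth_on G {z. z $ 1 \<in> I}" for G :: "real ^ 2 \<Rightarrow> real" and \<theta> A
  proof -
    have D: "(G has_derivative FD G (pt x \<theta>)) (at (pt x \<theta>))"
      using smooth_on_has_derivative[OF G] x by simp
    have "FD G (pt x \<theta>) (t *\<^sub>R axis 2 1) = pd 2 G (pt x \<theta>) * t" for t
      using linear_cmul[OF has_derivative_linear[OF D], of t "axis 2 1"] by simp
    with has_derivative_compose[OF pt D] show ?thesis unfolding has_field_derivative_def by simp
  qed
  let ?P = "\<lambda>\<theta>. pd 2 H (pt x \<theta>) * cos (real n * \<theta>) + real n * (H (pt x \<theta>) * sin (real n * \<theta>))"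
  have "(?P has_real_derivative (real n)\<^sup>2 * (H (pt x \<theta>) * cos (real n * \<theta>)) -
      neg_pd22 H (pt x \<theta>) * cos (real n * \<theta>)) (at \<theta> within A)" for \<theta> A
    using H
    by (auto simp: even_periodic_def neg_pd22_def power2_eq_square algebra_simps
        intro!: derivative_eq_intros der[OF 2(1)] der)
  then have "((\<lambda>\<theta>. (real n)\<^sup>2 * (H (pt x \<theta>) * cos (real n * \<theta>)) -
      neg_pd22 H (pt x \<theta>) * cos (real n * \<theta>)) has_integral ?P pi - ?P 0) {0..pi}"
    by (intro fundamental_theorem_of_calculus) (auto simp: has_real_derivative_iff_has_vector_derivative)
  moreover have "?P pi - ?P 0 = 0"
  proof -
    have "pd 2 H (pt x 0) = 0" using 2(2)[OF x, of 0] by simp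
    moreover have "pd 2 H (pt x pi) = 0" using 2(2)[OF x, of pi] 2(3)[OF x, of "- pi"] by simp
    ultimately show ?thesis by simp
  qed
  ultimately have 1: "((\<lambda>\<theta>. (real n)\<^sup>2 * (H (pt x \<theta>) * cos (real n * \<theta>)) -
      neg_pd22 H (pt x \<theta>) * cos (real n * \<theta>)) has_integral 0) {0..pi}" by simp
  have i: "(\<lambda>\<theta>. G (pt x \<theta>) * cos (real n * \<theta>)) integrable_on {0..pi}" if "even_periodic I G" for G
    by (intro integrable_continuous_real continuous_intros even_periodic_continuous[OF that x])
  have "(real n)\<^sup>2 * integral {0..pi} (\<lambda>\<theta>. H (pt x \<theta>) * cos (real n * \<theta>))
      = integral {0..pi} (\<lambda>\<theta>. neg_pd22 H (pt x \<theta>) * cos (real n * \<theta>))"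
    using has_integral_unique[OF 1 has_integral_diff[OF has_integral_mult_right[OF integrable_integral[OF i[OF H]]]
        integrable_integral[OF i[OF even_periodic_neg_pd22[OF I H]]]]] by simp
  then show ?thesis by (simp add: fourier_cos_def cosine_coefficient_def)
qed

lemma fourier_cos_deriv:
  assumes I: "open I" "convex I" and H: "even_periodic I H" and x: "x \<in> I"
  shows "(fourier_cos H n has_real_derivative fourier_cos (pd 1 H) n x) (at x)"
proof -
  have sm: "smooth_on H {z. z $ 1 \<in> I}" using H by (simp add: even_periodic_def)
  have pt: "((\<lambda>y. pt y \<theta>) has_derivative (\<lambda>t. t *\<^sub>R axis 1 1)) (at y within A)" for \<theta> y A
    unfolding pt_def by (auto intro!: derivative_eq_intros)
  have der: "((\<lambda>y. H (pt y \<theta>)) has_real_derivative pd 1 H (pt y \<theta>)) (at y within A)"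
    if "y \<in> I" for y \<theta> A
  proof -
    have D: "(H has_derivative FD H (pt y \<theta>)) (at (pt y \<theta>))"
      using smooth_on_has_derivative[OF sm] that by simp
    have "FD H (pt y \<theta>) (t *\<^sub>R axis 1 1) = pd 1 H (pt y \<theta>) * t" for t
      using linear_cmul[OF has_derivative_linear[OF D], of t "axis 1 1"] by simp
    with has_derivative_compose[OF pt D] show ?thesis unfolding has_field_derivative_def by simp
  qed
  have "((\<lambda>y. integral (cbox 0 pi) (\<lambda>\<theta>. H (pt y \<theta>) * cos (real n * \<theta>))) has_real_derivative
      integral (cbox 0 pi) (\<lambda>\<theta>. pd 1 H (pt x \<theta>) * cos (real n * \<theta>))) (at x within I)"
  proof (rule leibniz_rule_field_derivative[OF _ _ _ x I(2)])
    show "((\<lambda>y. H (pt y \<theta>) * cos (real n * \<theta>)) has_real_derivative pd 1 H (pt y \<theta>) * cos (real n * \<theta>)) (at y within I)"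
      if "y \<in> I" for y \<theta> by (rule DERIV_cmult_right[OF der[OF that]])
    show "(\<lambda>\<theta>. H (pt y \<theta>) * cos (real n * \<theta>)) integrable_on cbox 0 pi" if "y \<in> I" for y
      using even_periodic_continuous[OF H that]
      by (auto intro!: integrable_continuous_real continuous_intros)
    have "continuous_on (I \<times> cbox 0 pi) (\<lambda>p. pd 1 H (pt (fst p) (snd p)))"
      by (rule continuous_on_compose2[OF smooth_on_imp_continuous_on[OF smooth_on_FD[OF sm]]])
        (auto intro!: continuous_intros)
    then show "continuous_on (I \<times> cbox 0 pi) (\<lambda>(y, \<theta>). pd 1 H (pt y \<theta>) * cos (real n * \<theta>))"
      unfolding case_prod_beta by (intro continuous_intros)
  qed
  then show ?thesis
    unfolding fourier_cos_def cosine_coefficient_def at_within_open[OF x I(1)] box_real by (rule DERIV_cmult)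
qed

lemma fourier_cos_bounded:
  assumes H: "even_periodic I H" and J: "compact J" "J \<subseteq> I"
  obtains B where "\<And>x n. x \<in> J \<Longrightarrow> \<bar>fourier_cos H n x\<bar> \<le> B"
proof -
  have "continuous_on (J \<times> {0..pi}) (\<lambda>p. H (pt (fst p) (snd p)))"
    by (rule continuous_on_compose2[OF smooth_on_imp_continuous_on[of H "{z. z $ 1 \<in> I}"]])
      (use H J(2) in \<open>auto simp: even_periodic_def intro!: continuous_intros\<close>)
  then have "bounded ((\<lambda>p. H (pt (fst p) (snd p))) ` (J \<times> {0..pi}))"
    by (intro compact_imp_bounded compact_continuous_image compact_Times J) auto
  then obtain B where B: "B > 0" "\<And>x \<theta>. x \<in> J \<Longrightarrow> \<theta> \<in> {0..pi} \<Longrightarrow> \<bar>H (pt x \<theta>)\<bar> \<le> B"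
    unfolding bounded_pos by force
  have "\<bar>fourier_cos H n x\<bar> \<le> 2 * B" if x: "x \<in> J" for x n
  proof -
    let ?i = "integral {0..pi} (\<lambda>\<theta>. H (pt x \<theta>) * cos (real n * \<theta>))"
    have "((\<lambda>\<theta>. H (pt x \<theta>) * cos (real n * \<theta>)) has_integral ?i) {0..pi}"
      using x J(2) by (intro integrable_integral integrable_continuous_real continuous_intros
          even_periodic_continuous[OF H]) auto
    then have "norm ?i \<le> B * measure lborel {0..pi}"
    proof (rule has_integral_bound_real[where S = "{}", rotated 2])
      show "norm (H (pt x \<theta>) * cos (real n * \<theta>)) \<le> B" if "\<theta> \<in> {0..pi} - {}" for \<theta>
        using mult_mono[OF B(2)[OF x, of \<theta>], of "\<bar>cos (real n * \<theta>)\<bar>" 1] B(1) that by (simp add: abs_mult)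
    qed (use B in auto)
    then have i: "\<bar>?i\<bar> \<le> B * pi" by simp
    have "\<bar>fourier_cos H n x\<bar> \<le> 2 / pi * \<bar>?i\<bar>"
      by (auto simp: fourier_cos_def cosine_coefficient_def abs_mult intro!: mult_right_mono divide_right_mono)
    also have "\<dots> \<le> 2 / pi * (B * pi)" using i by (intro mult_left_mono) auto
    finally show ?thesis by simp
  qed
  then show ?thesis by (rule that)
qed

text \<open>
  The coefficients of \<open>H\<close> and their multiples by \<open>n\<^sup>2\<close>, the coefficients of \<open>neg_pd22 H\<close>, are bounded.
\<close>

lemma fourier_cos_decay:
  assumes I: "open I" and H: "even_periodic I H" and J: "compact J" "J \<subseteq> I"
  obtains B where "\<And>x n. x \<in> J \<Longrightarrow> \<bar>fourier_cos H n x\<bar> \<le> B * inverse (real (Suc n) ^ 2)"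
proof -
  obtain B1 where B1: "\<And>x n. x \<in> J \<Longrightarrow> \<bar>fourier_cos H n x\<bar> \<le> B1"
    using fourier_cos_bounded[OF H J] by blast
  obtain B2 where B2: "\<And>x n. x \<in> J \<Longrightarrow> \<bar>fourier_cos (neg_pd22 H) n x\<bar> \<le> B2"
    using fourier_cos_bounded[OF even_periodic_neg_pd22[OF I H] J] by blast
  show ?thesis
  proof (rule that[of "2 * B1 + 2 * B2"])
    fix x n assume x: "x \<in> J"
    have "(real n)\<^sup>2 * \<bar>fourier_cos H n x\<bar> \<le> B2"
      using B2[OF x, of n] fourier_cos_neg_pd22[OF I H, of x n] x J(2) by (auto simp: abs_mult)
    \<comment> \<open>equivalent to \<open>(n - 1)\<^sup>2 \<ge> 0\<close>\<close>
    moreover have "(real (Suc n))\<^sup>2 \<le> 2 + 2 * (real n)\<^sup>2"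
      using zero_le_power2[of "real n - 1"] by (simp add: power2_eq_square algebra_simps)
    then have "(real (Suc n))\<^sup>2 * \<bar>fourier_cos H n x\<bar> \<le> (2 + 2 * (real n)\<^sup>2) * \<bar>fourier_cos H n x\<bar>"
      by (rule mult_right_mono) simp
    ultimately have "(real (Suc n))\<^sup>2 * \<bar>fourier_cos H n x\<bar> \<le> 2 * B1 + 2 * B2"
      using B1[OF x, of n] by (simp add: distrib_right)
    then show "\<bar>fourier_cos H n x\<bar> \<le> (2 * B1 + 2 * B2) * inverse (real (Suc n) ^ 2)"
      by (simp add: field_simps del: of_nat_Suc)
  qed
qed


text \<open>
  Termwise differentiation under a summable majorant common to the series and its two series of
  partial derivatives.
\<close>

lemma has_derivative_planar_series:
  fixes \<phi> \<phi>1 \<phi>2 :: "nat \<Rightarrow> real ^ 2 \<Rightarrow> real"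
  assumes S: "open S" "convex S"
    and der: "\<And>n z. z \<in> S \<Longrightarrow> (\<phi> n has_derivative (\<lambda>h. h $ 1 * \<phi>1 n z + h $ 2 * \<phi>2 n z)) (at z)"
    and M: "\<And>n z. z \<in> S \<Longrightarrow> \<bar>\<phi> n z\<bar> \<le> M n" "\<And>n z. z \<in> S \<Longrightarrow> \<bar>\<phi>1 n z\<bar> \<le> M n"
      "\<And>n z. z \<in> S \<Longrightarrow> \<bar>\<phi>2 n z\<bar> \<le> M n" "summable M"
    and z: "z \<in> S"
  shows "((\<lambda>z. \<Sum>n. \<phi> n z) has_derivative (\<lambda>h. h $ 1 * (\<Sum>n. \<phi>1 n z) + h $ 2 * (\<Sum>n. \<phi>2 n z))) (at z)"
proof -
  let ?g' = "\<lambda>z (h :: real ^ 2). h $ 1 * (\<Sum>n. \<phi>1 n z) + h $ 2 * (\<Sum>n. \<phi>2 n z)"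
  have u1: "uniform_limit S (\<lambda>N z. \<Sum>n<N. \<phi>1 n z) (\<lambda>z. \<Sum>n. \<phi>1 n z) sequentially"
    and u2: "uniform_limit S (\<lambda>N z. \<Sum>n<N. \<phi>2 n z) (\<lambda>z. \<Sum>n. \<phi>2 n z) sequentially"
    by (rule Weierstrass_m_test[OF _ M(4)]; simp add: M)+
  have "\<exists>g. \<forall>x\<in>S. (\<lambda>n. \<phi> n x) sums (g x) \<and> (g has_derivative ?g' x) (at x within S)"
  proof (rule has_derivative_series[OF S(2) _ _ z])
    show "(\<phi> n has_derivative (\<lambda>h. h $ 1 * \<phi>1 n x + h $ 2 * \<phi>2 n x)) (at x within S)"
      if "x \<in> S" for n x
      by (rule has_derivative_at_withinI[OF der[OF that]])
    have "summable (\<lambda>n. \<phi> n z)"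
      by (rule summable_comparison_test'[OF M(4)]) (simp add: M(1) z)
    then show "(\<lambda>n. \<phi> n z) sums (\<Sum>n. \<phi> n z)" by (rule summable_sums)
    fix e :: real assume "e > 0"
    then have "e / 2 > 0" by simp
    show "\<forall>\<^sub>F N in sequentially. \<forall>x\<in>S. \<forall>h.
        norm ((\<Sum>n<N. h $ 1 * \<phi>1 n x + h $ 2 * \<phi>2 n x) - ?g' x h) \<le> e * norm h"
      using uniform_limitD[OF u1 \<open>e / 2 > 0\<close>] uniform_limitD[OF u2 \<open>e / 2 > 0\<close>]
    proof eventually_elim
      case (elim N)
      show ?case
      proof (intro ballI allI)
        fix x h :: "real ^ 2" assume x: "x \<in> S"
        let ?d1 = "(\<Sum>n<N. \<phi>1 n x) - (\<Sum>n. \<phi>1 n x)" and ?d2 = "(\<Sum>n<N. \<phi>2 n x) - (\<Sum>n. \<phi>2 n x)"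
        have d: "\<bar>?d1\<bar> \<le> e / 2" "\<bar>?d2\<bar> \<le> e / 2"
          using elim x by (auto simp: dist_real_def intro!: less_imp_le)
        have eq: "(\<Sum>n<N. h $ 1 * \<phi>1 n x + h $ 2 * \<phi>2 n x) - ?g' x h = h $ 1 * ?d1 + h $ 2 * ?d2"
          by (simp add: sum.distrib sum_distrib_left algebra_simps)
        have "\<bar>h $ 1 * ?d1\<bar> \<le> norm h * (e / 2)" "\<bar>h $ 2 * ?d2\<bar> \<le> norm h * (e / 2)"
          unfolding abs_mult by (intro mult_mono component_le_norm_cart d; simp)+
        moreover have "e * norm h = norm h * (e / 2) + norm h * (e / 2)" by (simp add: field_simps)
        ultimately have "\<bar>h $ 1 * ?d1 + h $ 2 * ?d2\<bar> \<le> e * norm h"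
          using abs_triangle_ineq[of "h $ 1 * ?d1" "h $ 2 * ?d2"] by linarith
        then show "norm ((\<Sum>n<N. h $ 1 * \<phi>1 n x + h $ 2 * \<phi>2 n x) - ?g' x h) \<le> e * norm h"
          by (simp only: real_norm_def eq)
      qed
    qed
  qed
  then obtain g where g: "\<And>x. x \<in> S \<Longrightarrow> (\<lambda>n. \<phi> n x) sums (g x)"
    "\<And>x. x \<in> S \<Longrightarrow> (g has_derivative ?g' x) (at x within S)" by blast
  have "(g has_derivative ?g' z) (at z)" using g(2)[OF z] at_within_open[OF z S(1)] by simp
  then show ?thesis
    by (rule has_derivative_transform_within_open[OF _ S(1) z]) (use sums_unique[OF g(1)] in simp)
qed

text \<open>
  For \<open>\<kappa>(t\<^sup>2) = cos t\<close> this is the cosine series of \<open>H\<close> with \<open>\<theta>\<^sup>2\<close> replaced by a real variable of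
  arbitrary sign.
\<close>

definition cos_series :: "(real ^ 2 \<Rightarrow> real) \<Rightarrow> (real \<Rightarrow> real) \<Rightarrow> real ^ 2 \<Rightarrow> real" where
  "cos_series H \<kappa> z = (\<Sum>n. fourier_cos H n (z $ 1) * \<kappa> ((real n)\<^sup>2 * z $ 2))"

lemma Basis_real2: "(\<Sum>b\<in>(Basis :: (real ^ 2) set). F b) = F (axis 1 1) + F (axis 2 1)"
proof -
  have B: "(Basis :: (real ^ 2) set) = {axis 1 1, axis 2 1}"
    by (auto simp: Basis_vec_def UNIV_2)
  have "axis 1 1 \<noteq> (axis 2 1 :: real ^ 2)" by (simp add: axis_eq_axis)
  then show ?thesis unfolding B by simp
qed

lemma cos_series_terms_bounded:
  assumes I: "open I" and H: "even_periodic I H" and J: "compact J" "J \<subseteq> I" and \<kappa>: "all_derivs_bounded \<kappa>"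
  obtains C where "C \<ge> 0" "\<And>n x y. x \<in> J \<Longrightarrow> \<bar>fourier_cos H n x * \<kappa> y\<bar> \<le> C * inverse (real (Suc n) ^ 2)"
proof -
  obtain B where B: "\<And>x n. x \<in> J \<Longrightarrow> \<bar>fourier_cos H n x\<bar> \<le> B * inverse (real (Suc n) ^ 2)"
    using fourier_cos_decay[OF I H J] by blast
  obtain K where K: "K > 0" "\<And>y. \<bar>\<kappa> y\<bar> \<le> K"
    using all_derivs_boundedD(3)[OF \<kappa>] unfolding bounded_pos by auto
  show ?thesis
  proof (rule that[of "\<bar>B\<bar> * K"])
    fix n x y assume x: "x \<in> J"
    have "\<bar>fourier_cos H n x\<bar> \<le> \<bar>B\<bar> * inverse (real (Suc n) ^ 2)"
      by (rule order_trans[OF B[OF x]]) (intro mult_right_mono, auto)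
    then have "\<bar>fourier_cos H n x * \<kappa> y\<bar> \<le> (\<bar>B\<bar> * inverse (real (Suc n) ^ 2)) * K"
      unfolding abs_mult by (intro mult_mono K(2)) auto
    then show "\<bar>fourier_cos H n x * \<kappa> y\<bar> \<le> \<bar>B\<bar> * K * inverse (real (Suc n) ^ 2)"
      by (simp add: mult_ac)
  qed (use K in auto)
qed

lemma summable_inverse_Suc_squares: "summable (\<lambda>n. inverse (real (Suc n) ^ 2))"
  by (rule summable_Suc_iff[THEN iffD2, OF inverse_power_summable]) simp

text \<open>
  The partial derivative in the second direction produces the factors \<open>n\<^sup>2\<close>, which \<open>neg_pd22\<close> absorbs
  into the coefficients. So these series are closed under partial derivatives, and all of them
  converge by the decay of the coefficients and the boundedness of \<open>\<kappa>\<close>.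
\<close>

lemma smooth_on_cos_series:
  assumes I: "open I" "convex I" and H: "even_periodic I H" and \<kappa>: "all_derivs_bounded \<kappa>"
    and J: "open J" "convex J" "J \<subseteq> K" "compact K" "K \<subseteq> I"
  shows "smooth_on (cos_series H \<kappa>) {z. z $ 1 \<in> J}"
proof (rule smooth_on_coinduct)
  let ?P = "\<lambda>f. \<exists>H \<kappa>. even_periodic I H \<and> all_derivs_bounded \<kappa> \<and> f = cos_series H \<kappa>"
  show "open {z :: real ^ 2. z $ 1 \<in> J}" by (rule open_strip[OF J(1)])
  show "?P (cos_series H \<kappa>)" using H \<kappa> by blast
  fix f assume "?P f"
  then obtain H \<kappa> where H: "even_periodic I H" and \<kappa>: "all_derivs_bounded \<kappa>" and f: "f = cos_series H \<kappa>"
    by blast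
  let ?S = "{z :: real ^ 2. z $ 1 \<in> J}"
  let ?\<phi> = "\<lambda>H \<kappa> n z. fourier_cos H n (z $ 1) * \<kappa> ((real n)\<^sup>2 * z $ 2)"
  have H1: "even_periodic I (pd 1 H)" and H2: "even_periodic I (neg_pd22 H)"
    using even_periodic_pd1[OF I(1) H] even_periodic_neg_pd22[OF I(1) H] .
  have \<kappa>': "all_derivs_bounded (deriv \<kappa>)" by (rule all_derivs_boundedD[OF \<kappa>])
  obtain C0 where C0: "C0 \<ge> 0" "\<And>n x y. x \<in> K \<Longrightarrow> \<bar>fourier_cos H n x * \<kappa> y\<bar> \<le> C0 * inverse (real (Suc n) ^ 2)"
    using cos_series_terms_bounded[OF I(1) H J(4,5) \<kappa>] by blast
  obtain C1 where C1: "C1 \<ge> 0" "\<And>n x y. x \<in> K \<Longrightarrow> \<bar>fourier_cos (pd 1 H) n x * \<kappa> y\<bar> \<le> C1 * inverse (real (Suc n) ^ 2)"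
    using cos_series_terms_bounded[OF I(1) H1 J(4,5) \<kappa>] by blast
  obtain C2 where C2: "C2 \<ge> 0" "\<And>n x y. x \<in> K \<Longrightarrow> \<bar>fourier_cos (neg_pd22 H) n x * deriv \<kappa> y\<bar> \<le> C2 * inverse (real (Suc n) ^ 2)"
    using cos_series_terms_bounded[OF I(1) H2 J(4,5) \<kappa>'] by blast
  let ?M = "\<lambda>n. (C0 + C1 + C2) * inverse (real (Suc n) ^ 2)"
  have summ: "summable ?M"
    by (intro summable_mult summable_inverse_Suc_squares)
  have le: "C * inverse (real (Suc n) ^ 2) \<le> ?M n" if "C \<le> C0 + C1 + C2" for C n
    using that by (rule mult_right_mono) simp
  have conv: "convex ?S"
    using convex_linear_vimage[OF bounded_linear.linear[OF bounded_linear_vec_nth[of 1]] J(2)] by (simp add: vimage_def)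
  have "(f has_derivative (\<lambda>h. h $ 1 * cos_series (pd 1 H) \<kappa> z + h $ 2 * cos_series (neg_pd22 H) (deriv \<kappa>) z)) (at z)"
    if z: "z \<in> ?S" for z
    unfolding f cos_series_def[abs_def]
  proof (rule has_derivative_planar_series[OF open_strip[OF J(1)] conv _ _ _ _ summ z])
    fix n and z :: "real ^ 2" assume z: "z \<in> ?S"
    then have zI: "z $ 1 \<in> I" and zK: "z $ 1 \<in> K" using J by auto
    have c: "((\<lambda>z. z $ i) has_derivative (\<lambda>h. h $ i)) (at z)" for i
      by (rule bounded_linear_imp_has_derivative[OF bounded_linear_vec_nth])
    have 1: "((\<lambda>z. fourier_cos H n (z $ 1)) has_derivative (\<lambda>h. h $ 1 * fourier_cos (pd 1 H) n (z $ 1))) (at z)"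
      by (rule DERIV_compose_FDERIV[OF fourier_cos_deriv[OF I H zI] c])
    have 2: "((\<lambda>z. \<kappa> ((real n)\<^sup>2 * z $ 2)) has_derivative (\<lambda>h. (real n)\<^sup>2 * h $ 2 * deriv \<kappa> ((real n)\<^sup>2 * z $ 2))) (at z)"
      by (rule DERIV_compose_FDERIV[OF all_derivs_boundedD(1)[OF \<kappa>] has_derivative_mult_right[OF c]])
    show "(?\<phi> H \<kappa> n has_derivative (\<lambda>h. h $ 1 * ?\<phi> (pd 1 H) \<kappa> n z + h $ 2 * ?\<phi> (neg_pd22 H) (deriv \<kappa>) n z)) (at z)"
      by (rule has_derivative_eq_rhs[OF has_derivative_mult[OF 1 2]])
        (simp add: fun_eq_iff fourier_cos_neg_pd22[OF I(1) H zI] algebra_simps)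
    show "\<bar>?\<phi> H \<kappa> n z\<bar> \<le> ?M n"
      by (rule order_trans[OF C0(2)[OF zK] le]) (use C1 C2 in simp)
    show "\<bar>?\<phi> (pd 1 H) \<kappa> n z\<bar> \<le> ?M n"
      by (rule order_trans[OF C1(2)[OF zK] le]) (use C0 C2 in simp)
    show "\<bar>?\<phi> (neg_pd22 H) (deriv \<kappa>) n z\<bar> \<le> ?M n"
      by (rule order_trans[OF C2(2)[OF zK] le]) (use C0 C1 in simp)
  qed
  moreover have "?P (cos_series (pd 1 H) \<kappa>)" "?P (cos_series (neg_pd22 H) (deriv \<kappa>))"
    using H1 H2 \<kappa> \<kappa>' by blast+
  ultimately show "\<exists>g. (\<forall>b\<in>Basis. ?P (g b)) \<and>
      (\<forall>z\<in>?S. (f has_derivative (\<lambda>h. \<Sum>b\<in>Basis. (h \<bullet> b) *\<^sub>R g b z)) (at z))"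
    by (intro exI[of _ "\<lambda>b. if b = axis 1 1 then cos_series (pd 1 H) \<kappa> else cos_series (neg_pd22 H) (deriv \<kappa>)"])
      (simp add: Basis_real2 inner_axis axis_eq_axis)
qed

lemma cos_series_square:
  assumes I: "open I" and H: "even_periodic I H" and x: "x \<in> I" and \<theta>: "\<theta> \<in> {0..pi}"
  shows "cos_series H cut_cos (pt x (\<theta>\<^sup>2)) = H (pt x \<theta>)"
proof -
  obtain B where B: "\<And>y n. y \<in> {x} \<Longrightarrow> \<bar>fourier_cos H n y\<bar> \<le> B * inverse (real (Suc n) ^ 2)"
    using fourier_cos_decay[OF I H compact_sing, of x] x by blast
  have "summable (\<lambda>n. B * inverse (real (Suc n) ^ 2))"
    by (intro summable_mult summable_inverse_Suc_squares)
  then have "summable (\<lambda>n. \<bar>fourier_cos H n x\<bar>)"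
    by (rule summable_comparison_test') (use B[of x] in simp)
  then have "(\<Sum>n. fourier_cos H n x * cos (real n * \<theta>)) = H (pt x \<theta>)"
    unfolding fourier_cos_def by (intro cosine_series[OF even_periodic_continuous[OF H x] _ \<theta>])
  then show ?thesis
    unfolding cos_series_def by (simp flip: cut_cos_square add: power_mult_distrib)
qed

section \<open>Whitney's theorem on even functions\<close>

lemma FD_eqI: "(f has_derivative D) (at x) \<Longrightarrow> FD f x = D"
  by (rule frechet_derivative_at[symmetric])

text \<open>
  The family \<open>H(x, \<theta>) = E(x, \<rho> sin \<theta>)\<close> is even and periodic in \<open>\<theta>\<close>. Its cosine series in the variable
  \<open>\<theta>\<^sup>2\<close> is a smooth function \<open>G\<close> with \<open>G(x, \<theta>\<^sup>2) = E(x, \<rho> sin \<theta>)\<close>, defined for negative second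
  arguments too. It remains to express \<open>\<theta>\<^sup>2\<close> smoothly by \<open>(\<rho> sin \<theta>)\<^sup>2\<close>, which is possible near \<open>0\<close> by the
  inverse function theorem.
\<close>

lemma whitney_even_real:
  fixes E :: "real ^ 2 \<Rightarrow> real"
  assumes E: "smooth_germ E 0" and even: "\<forall>\<^sub>F z in nhds 0. E (pt (z $ 1) (- z $ 2)) = E z"
  obtains A where "smooth_germ A 0" "\<forall>\<^sub>F z in nhds 0. E z = A (pt (z $ 1) ((z $ 2)\<^sup>2))"
proof -
  obtain U where U: "open U" "0 \<in> U" "smooth_on E U" using E smooth_germ_iff by blast
  obtain V where V: "open V" "0 \<in> V" "\<And>z. z \<in> V \<Longrightarrow> E (pt (z $ 1) (- z $ 2)) = E z"
    using even unfolding eventually_nhds by blast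
  have "open (U \<inter> V)" "0 \<in> U \<inter> V" using U V by auto
  then obtain r where r: "r > 0" "ball 0 r \<subseteq> U \<inter> V"
    using open_contains_ball by blast
  \<comment> \<open>for \<open>\<bar>x\<bar> < \<rho>\<close> the points \<open>(x, \<rho> sin \<theta>)\<close> stay in the ball of radius \<open>r\<close>\<close>
  define \<rho> where "\<rho> = r / 2"
  have \<rho>: "\<rho> > 0" using r by (simp add: \<rho>_def)
  have r\<rho>: "r = 2 * \<rho>" by (simp add: \<rho>_def)
  define H where "H z = E (pt (z $ 1) (\<rho> * sin (z $ 2)))" for z :: "real ^ 2"
  let ?I = "{-\<rho><..<\<rho>}" and ?K = "{- (\<rho> / 2)..\<rho> / 2}" and ?J = "{- (\<rho> / 2)<..<\<rho> / 2}"
  have inUV: "pt x (\<rho> * sin \<theta>) \<in> U \<inter> V" if "x \<in> ?I" for x \<theta>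
  proof -
    have "\<bar>\<rho> * sin \<theta>\<bar> \<le> \<rho> * 1" unfolding abs_mult using \<rho> by (intro mult_mono) auto
    then have "norm (pt x (\<rho> * sin \<theta>)) < r"
      using norm_pt_le[of x "\<rho> * sin \<theta>"] that r\<rho> by auto
    then show ?thesis using r(2) by auto
  qed
  have sin: "smooth_germ (sin :: real \<Rightarrow> real) x" for x
  proof -
    let ?P = "\<lambda>f. \<exists>a b. f = (\<lambda>x::real. a * sin x + b * cos x)"
    have "smooth_on (sin :: real \<Rightarrow> real) UNIV"
    proof (rule smooth_on_coinduct_deriv[where P = ?P])
      show "?P sin" by (rule exI[of _ 1], rule exI[of _ 0]) simp
      fix f assume "?P f"
      then obtain a b where f: "f = (\<lambda>x. a * sin x + b * cos x)" by blast
      have "\<forall>x\<in>UNIV. (f has_real_derivative (- b * sin x + a * cos x)) (at x)"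
        unfolding f by (auto intro!: derivative_eq_intros)
      then show "\<exists>g. ?P g \<and> (\<forall>x\<in>UNIV. (f has_real_derivative g x) (at x))" by blast
    qed simp
    then show ?thesis by (simp add: smooth_on_iff_germs)
  qed
  have "smooth_on H {z. z $ 1 \<in> ?I}"
  proof (rule smooth_on_iff_germs[THEN iffD2], rule open_strip, simp, rule ballI)
    fix z :: "real ^ 2" assume "z \<in> {z. z $ 1 \<in> ?I}"
    then have e: "smooth_germ E (pt (z $ 1) (\<rho> * sin (z $ 2)))"
      using inUV U(1,3) smooth_germ_iff by blast
    have s: "smooth_germ (\<lambda>z. sin (z $ 2)) z"
      by (rule smooth_germ_compose[OF sin]) (intro smooth_intros)
    show "smooth_germ H z"
      unfolding H_def[abs_def] by (rule smooth_germ_compose[where f = "\<lambda>z. pt (z $ 1) (\<rho> * sin (z $ 2))", OF e]) (intro smooth_intros s)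
  qed
  moreover have "E (pt x (- (\<rho> * sin \<theta>))) = E (pt x (\<rho> * sin \<theta>))" if "x \<in> ?I" for x \<theta>
    using V(3)[of "pt x (\<rho> * sin \<theta>)"] inUV[OF that, of \<theta>] by simp
  ultimately have H: "even_periodic ?I H"
    unfolding even_periodic_def by (simp add: H_def)
  let ?G = "cos_series H cut_cos"
  have G: "smooth_on ?G {z. z $ 1 \<in> ?J}"
    by (rule smooth_on_cos_series[OF _ _ H all_derivs_bounded_cut_cos, where K = ?K]) (use \<rho> in auto)
  \<comment> \<open>\<open>m\<close> expresses \<open>(\<rho> sin \<theta>)\<^sup>2\<close> by \<open>\<theta>\<^sup>2\<close>, and \<open>\<Phi>\<close> is to be inverted\<close>
  define m where "m w = \<rho>\<^sup>2 * (1 - cos_sqrt (4 * w)) / 2" for w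
  define \<Phi> where "\<Phi> z = pt (z $ 1) (m (z $ 2))" for z :: "real ^ 2"
  have m: "m (\<theta>\<^sup>2) = (\<rho> * sin \<theta>)\<^sup>2" for \<theta>
  proof -
    have "cos_sqrt (4 * \<theta>\<^sup>2) = cos (2 * \<theta>)"
      using cos_sqrt_square[of "2 * \<theta>"] by (simp add: power_mult_distrib)
    then show ?thesis by (simp add: m_def cos_double_sin power_mult_distrib)
  qed
  have cs: "smooth_germ cos_sqrt w" for w using smooth_on_cos_sqrt by (simp add: smooth_on_iff_germs)
  have "smooth_germ (\<lambda>z. cos_sqrt (4 * z $ 2)) (0 :: real ^ 2)"
    by (rule smooth_germ_compose[OF cs]) (intro smooth_intros)
  then have \<Phi>s: "smooth_germ \<Phi> 0"
    unfolding \<Phi>_def[abs_def] m_def[abs_def] by (intro smooth_intros) auto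
  have "(m has_real_derivative \<rho>\<^sup>2 * (0 - (- 1 / 2) * 4) / 2) (at 0)"
    unfolding m_def
    by (rule DERIV_cdivide DERIV_cmult DERIV_diff DERIV_const DERIV_chain2[of cos_sqrt] derivative_eq_intros
        | simp add: cos_sqrt_deriv_0[simplified])+
  then have "(m has_real_derivative \<rho>\<^sup>2) (at (0 $ 2))" by simp
  from DERIV_compose_FDERIV[OF this bounded_linear_imp_has_derivative[OF bounded_linear_vec_nth]]
  have "((\<lambda>z :: real ^ 2. m (z $ 2)) has_derivative (\<lambda>h. h $ 2 * \<rho>\<^sup>2)) (at 0)" .
  then have \<Phi>': "(\<Phi> has_derivative (\<lambda>h. pt (h $ 1) (h $ 2 * \<rho>\<^sup>2))) (at 0)"
    unfolding \<Phi>_def[abs_def] pt_def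
    by (intro has_derivative_add has_derivative_scaleR_left
        bounded_linear_imp_has_derivative[OF bounded_linear_vec_nth])
  have "inj (\<lambda>h :: real ^ 2. pt (h $ 1) (h $ 2 * \<rho>\<^sup>2))"
  proof (rule injI)
    fix h h' :: "real ^ 2" assume "pt (h $ 1) (h $ 2 * \<rho>\<^sup>2) = pt (h' $ 1) (h' $ 2 * \<rho>\<^sup>2)"
    then have "h $ 1 = h' $ 1" "h $ 2 * \<rho>\<^sup>2 = h' $ 2 * \<rho>\<^sup>2" by (metis pt_nth)+
    then show "h = h'" using \<rho> by (simp add: vec_eq_iff forall_2)
  qed
  then have "diffeo_germ \<Phi> 0 (\<Phi> 0)"
    by (intro diffeo_germ_inj_derivative \<Phi>s) (simp add: FD_eqI[OF \<Phi>'])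
  moreover have "\<Phi> 0 = 0" using m[of 0] by (simp add: \<Phi>_def)
  ultimately have "diffeo_germ \<Phi> 0 0" by simp
  then obtain \<Psi> where \<Psi>: "diffeo_germ \<Psi> 0 0" "\<forall>\<^sub>F z in nhds 0. \<Psi> (\<Phi> z) = z"
      "\<forall>\<^sub>F z in nhds 0. \<Phi> (\<Psi> z) = z"
    by (rule diffeo_germE)
  have \<Psi>s: "smooth_germ \<Psi> 0" "\<Psi> 0 = 0" using \<Psi>(1) by (auto simp: diffeo_germ_def)
  have "smooth_germ ?G 0"
    unfolding smooth_germ_iff using G open_strip[of ?J] \<rho> by (intro exI[of _ "{z. z $ 1 \<in> ?J}"]) auto
  then have "smooth_germ (\<lambda>y. ?G (\<Psi> y)) 0" using \<Psi>s by (intro smooth_germ_compose[where g = ?G and f = \<Psi>]) auto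
  moreover have "\<forall>\<^sub>F z in nhds 0. E z = ?G (\<Psi> (pt (z $ 1) ((z $ 2)\<^sup>2)))"
  proof -
    let ?\<theta> = "\<lambda>z :: real ^ 2. arcsin (\<bar>z $ 2\<bar> / \<rho>)"
    have "isCont (\<lambda>z :: real ^ 2. \<bar>z $ 2\<bar> / \<rho>) 0"
      using \<rho> by (intro continuous_intros) auto
    then have "isCont ?\<theta> 0" by (rule isCont_o2) (simp add: isCont_arcsin)
    then have "isCont (\<lambda>z. pt (z $ 1) ((?\<theta> z)\<^sup>2)) 0"
      unfolding pt_def by (intro continuous_intros)
    then have "filterlim (\<lambda>z. pt (z $ 1) ((?\<theta> z)\<^sup>2)) (nhds 0) (nhds 0)"
      by (simp add: isCont_def tendsto_nhds_iff)
    then have 1: "\<forall>\<^sub>F z in nhds 0. \<Psi> (\<Phi> (pt (z $ 1) ((?\<theta> z)\<^sup>2))) = pt (z $ 1) ((?\<theta> z)\<^sup>2)"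
      using \<Psi>(2) by (auto simp: filterlim_iff)
    have 2: "\<forall>\<^sub>F z in nhds 0. norm (z :: real ^ 2) < \<rho>"
      using eventually_nhds_in_open[of "ball 0 \<rho>" "0 :: real ^ 2"] \<rho> by simp
    show ?thesis
      using 1 2
    proof eventually_elim
      case (elim z)
      have c: "\<bar>z $ i\<bar> < \<rho>" for i using component_le_norm_cart[of z i] elim(2) by linarith
      have b: "0 \<le> \<bar>z $ 2\<bar> / \<rho>" "\<bar>z $ 2\<bar> / \<rho> \<le> 1" using c[of 2] \<rho> by auto
      have b': "- 1 \<le> \<bar>z $ 2\<bar> / \<rho>" using b(1) by linarith
      have s: "\<rho> * sin (?\<theta> z) = \<bar>z $ 2\<bar>" unfolding sin_arcsin[OF b' b(2)] using \<rho> by simp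
      have \<theta>: "?\<theta> z \<in> {0..pi}"
        using arcsin_ubound[OF b' b(2)] arcsin_le_arcsin[OF _ b] pi_ge_zero by simp
      have "\<Phi> (pt (z $ 1) ((?\<theta> z)\<^sup>2)) = pt (z $ 1) ((z $ 2)\<^sup>2)"
        by (simp add: \<Phi>_def m s)
      then have "?G (\<Psi> (pt (z $ 1) ((z $ 2)\<^sup>2))) = ?G (pt (z $ 1) ((?\<theta> z)\<^sup>2))"
        using elim(1) by simp
      also have "\<dots> = H (pt (z $ 1) (?\<theta> z))"
        by (rule cos_series_square[OF _ H _ \<theta>]) (use c[of 1] in auto)
      also have "\<dots> = E (pt (z $ 1) \<bar>z $ 2\<bar>)" by (simp add: H_def s)
      also have "\<dots> = E z"
      proof (cases "z $ 2 \<ge> 0")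
        case False
        have "norm z < r" using elim(2) r by (simp add: \<rho>_def)
        then have "z \<in> V" using r(2) by auto
        then show ?thesis using V(3)[of z] False by simp
      qed simp
      finally show ?case by simp
    qed
  qed
  ultimately show ?thesis by (rule that)
qed

lemma whitney_even:
  fixes E :: "real ^ 2 \<Rightarrow> 'b::euclidean_space"
  assumes E: "smooth_germ E 0" and even: "\<forall>\<^sub>F z in nhds 0. E (pt (z $ 1) (- z $ 2)) = E z"
  obtains A where "smooth_germ A 0" "\<forall>\<^sub>F z in nhds 0. E z = A (pt (z $ 1) ((z $ 2)\<^sup>2))"
proof -
  have "\<exists>A. smooth_germ A 0 \<and> (\<forall>\<^sub>F z in nhds 0. E z \<bullet> b = A (pt (z $ 1) ((z $ 2)\<^sup>2)))" for b
  proof -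
    have "smooth_germ (\<lambda>z. E z \<bullet> b) 0" by (intro smooth_intros E)
    moreover have "\<forall>\<^sub>F z in nhds 0. E (pt (z $ 1) (- z $ 2)) \<bullet> b = E z \<bullet> b"
      using even by (rule eventually_mono) simp
    ultimately show ?thesis using whitney_even_real[of "\<lambda>z. E z \<bullet> b"] by blast
  qed
  then have "\<exists>A. \<forall>b. smooth_germ (A b) 0 \<and> (\<forall>\<^sub>F z in nhds 0. E z \<bullet> b = A b (pt (z $ 1) ((z $ 2)\<^sup>2)))"
    by (intro choice allI)
  then obtain A where A: "\<And>b. smooth_germ (A b) 0"
    "\<And>b. \<forall>\<^sub>F z in nhds 0. E z \<bullet> b = A b (pt (z $ 1) ((z $ 2)\<^sup>2))" by blast
  show ?thesis
  proof (rule that[of "\<lambda>y. \<Sum>b\<in>Basis. A b y *\<^sub>R b"])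
    show "smooth_germ (\<lambda>y. \<Sum>b\<in>Basis. A b y *\<^sub>R b) 0"
      by (intro smooth_intros A)
    have "\<forall>\<^sub>F z in nhds 0. \<forall>b\<in>Basis. E z \<bullet> b = A b (pt (z $ 1) ((z $ 2)\<^sup>2))"
      by (intro eventually_ball_finite finite_Basis ballI A)
    then show "\<forall>\<^sub>F z in nhds 0. E z = (\<Sum>b\<in>Basis. A b (pt (z $ 1) ((z $ 2)\<^sup>2)) *\<^sub>R b)"
    proof eventually_elim
      case (elim z)
      then show ?case by (subst euclidean_representation[symmetric]) (rule sum.cong, auto)
    qed
  qed
qed

lemma eventually_reflect:
  fixes P :: "real ^ 2 \<Rightarrow> bool"
  assumes "\<forall>\<^sub>F z in nhds 0. P z"
  shows "\<forall>\<^sub>F z :: real ^ 2 in nhds 0. P (pt (z $ 1) (- z $ 2))"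
proof -
  have "smooth_germ (\<lambda>z :: real ^ 2. pt (z $ 1) (- z $ 2)) 0" by (intro smooth_intros)
  from smooth_germ_eventually_compose[OF this] show ?thesis using assms by simp
qed

text \<open>
  By Hadamard's lemma the odd part is \<open>z\<^sub>2\<close> times an even germ, so Whitney's theorem applies to the even
  part and to this quotient.
\<close>

lemma even_odd_decomposition:
  fixes F :: "real ^ 2 \<Rightarrow> 'b::euclidean_space"
  assumes F: "smooth_germ F 0"
  obtains A B where "smooth_germ A 0" "smooth_germ B 0"
    "\<forall>\<^sub>F z in nhds 0. F z = A (pt (z $ 1) ((z $ 2)\<^sup>2)) + (z $ 2) *\<^sub>R B (pt (z $ 1) ((z $ 2)\<^sup>2))"
proof -
  let ?R = "\<lambda>z :: real ^ 2. pt (z $ 1) (- z $ 2)"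
  have FR: "smooth_germ (\<lambda>z. F (?R z)) 0"
    by (rule smooth_germ_compose) (simp_all add: F smooth_intros)
  obtain A where A: "smooth_germ A 0"
    "\<forall>\<^sub>F z in nhds 0. (1 / 2) *\<^sub>R (F z + F (?R z)) = A (pt (z $ 1) ((z $ 2)\<^sup>2))"
    by (rule whitney_even[of "\<lambda>z. (1 / 2) *\<^sub>R (F z + F (?R z))"])
      (auto intro!: smooth_intros F FR simp: add.commute)
  have O: "smooth_germ (\<lambda>z. (1 / 2) *\<^sub>R (F z - F (?R z))) 0"
    by (intro smooth_intros F FR)
  obtain Q where Q: "smooth_germ Q 0" "\<forall>\<^sub>F z in nhds 0. (1 / 2) *\<^sub>R (F z - F (?R z)) = (z $ 2) *\<^sub>R Q z"
    by (rule hadamard[OF O]) auto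
  have "\<forall>\<^sub>F z in nhds 0. Q (?R z) = Q z"
    using Q(2) eventually_reflect[OF Q(2)]
  proof eventually_elim
    case (elim z)
    show ?case
    proof (cases "z $ 2 = 0")
      case True
      then have "?R z = z" by (simp add: vec_eq_iff forall_2)
      then show ?thesis by simp
    next
      case False
      have "(z $ 2) *\<^sub>R Q (?R z) = - ((?R z $ 2) *\<^sub>R Q (?R z))" by simp
      also have "\<dots> = (z $ 2) *\<^sub>R Q z"
        unfolding elim(1)[symmetric] elim(2)[symmetric] by (simp add: scaleR_diff_right)
      finally show ?thesis using False by simp
    qed
  qed
  then obtain B where B: "smooth_germ B 0" "\<forall>\<^sub>F z in nhds 0. Q z = B (pt (z $ 1) ((z $ 2)\<^sup>2))"
    by (rule whitney_even[OF Q(1)])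
  have "\<forall>\<^sub>F z in nhds 0. F z = A (pt (z $ 1) ((z $ 2)\<^sup>2)) + (z $ 2) *\<^sub>R B (pt (z $ 1) ((z $ 2)\<^sup>2))"
    using A(2) B(2) Q(2)
  proof eventually_elim
    case (elim z)
    have "F z = (1 / 2) *\<^sub>R (F z + F (?R z)) + (1 / 2) *\<^sub>R (F z - F (?R z))"
      by (simp add: scaleR_add_right scaleR_diff_right flip: scaleR_add_left)
    then show ?case by (simp only: elim)
  qed
  then show ?thesis using that A(1) B(1) by blast
qed


section \<open>Rules for derivatives of smooth germs\<close>

lemma FD_compose:
  assumes "smooth_germ g (f a)" "smooth_germ f a"
  shows "FD (\<lambda>x. g (f x)) a v = FD g (f a) (FD f a v)"
  using FD_eqI[OF has_derivative_compose[OF smooth_germ_has_derivative[OF assms(2)]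
    smooth_germ_has_derivative[OF assms(1)]]] by simp

lemma FD_scaleR:
  assumes "smooth_germ c a" "smooth_germ f a"
  shows "FD (\<lambda>x. c x *\<^sub>R f x) a v =
    c a *\<^sub>R FD f a v + FD c a v *\<^sub>R f a"
  using FD_eqI[OF has_derivative_scaleR[OF smooth_germ_has_derivative[OF assms(1)]
    smooth_germ_has_derivative[OF assms(2)]]] by simp

lemma FD_mult:
  fixes f g :: "'a::euclidean_space \<Rightarrow> real"
  assumes "smooth_germ f a" "smooth_germ g a"
  shows "FD (\<lambda>x. f x * g x) a v =
    f a * FD g a v + FD f a v * g a"
  using FD_scaleR[OF assms] by simp

lemma FD_add:
  assumes "smooth_germ f a" "smooth_germ g a"
  shows "FD (\<lambda>x. f x + g x) a v = FD f a v + FD g a v"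
  using FD_eqI[OF has_derivative_add[OF smooth_germ_has_derivative[OF assms(1)]
    smooth_germ_has_derivative[OF assms(2)]]] by simp

lemma FD_diff:
  assumes "smooth_germ f a" "smooth_germ g a"
  shows "FD (\<lambda>x. f x - g x) a v = FD f a v - FD g a v"
  using FD_eqI[OF has_derivative_diff[OF smooth_germ_has_derivative[OF assms(1)]
    smooth_germ_has_derivative[OF assms(2)]]] by simp

lemma FD_bounded_linear:
  assumes "bounded_linear L" "smooth_germ f a"
  shows "FD (\<lambda>x. L (f x)) a v = L (FD f a v)"
  using FD_eqI[OF bounded_linear.has_derivative[OF assms(1) smooth_germ_has_derivative[OF assms(2)]]]
  by simp

lemmas FD_vec_nth = FD_bounded_linear[OF bounded_linear_vec_nth]

lemma FD_bounded_linear': "bounded_linear L \<Longrightarrow> FD L a v = L v"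
  using FD_eqI[OF bounded_linear_imp_has_derivative] by metis

lemma FD_nth [simp]: "FD (\<lambda>x. x $ i) a v = v $ i"
  by (rule FD_bounded_linear'[OF bounded_linear_vec_nth])

lemma FD_pt:
  assumes "smooth_germ f a" "smooth_germ g a"
  shows "FD (\<lambda>x. pt (f x) (g x)) a v = pt (FD f a v) (FD g a v)"
  unfolding pt_def
  by (simp add: FD_add FD_scaleR smooth_intros assms frechet_derivative_const)

lemma eventually_FD_cong:
  assumes "\<forall>\<^sub>F x in nhds a. f x = g x"
  shows "\<forall>\<^sub>F x in nhds a. FD f x = FD g x"
proof -
  have "\<forall>\<^sub>F x in nhds a. \<forall>\<^sub>F y in nhds x. f y = g y" using assms by (simp add: eventually_eventually)
  then show ?thesis by (rule eventually_mono) (rule FD_cong_nhds)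
qed

lemma axis2_nth:
  "axis 1 (1::real) $ (1::2) = 1" "axis 1 (1::real) $ (2::2) = 0"
  "axis 2 (1::real) $ (1::2) = 0" "axis 2 (1::real) $ (2::2) = 1"
  by (simp_all add: axis_def)

section \<open>Independent triples and coordinate positions\<close>

definition indep3 :: "'a::real_vector \<Rightarrow> 'a \<Rightarrow> 'a \<Rightarrow> bool" where
  "indep3 u v w \<longleftrightarrow> (\<forall>a b c. a *\<^sub>R u + b *\<^sub>R v + c *\<^sub>R w = 0 \<longrightarrow> a = 0 \<and> b = 0 \<and> c = 0)"

lemma indep3_scale:
  assumes "indep3 u v w" "a \<noteq> 0" "b \<noteq> 0" "c \<noteq> 0"
  shows "indep3 (a *\<^sub>R u) (b *\<^sub>R v) (c *\<^sub>R w + d *\<^sub>R v)"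
  unfolding indep3_def
proof (intro allI impI)
  fix x y z assume "x *\<^sub>R a *\<^sub>R u + y *\<^sub>R b *\<^sub>R v + z *\<^sub>R (c *\<^sub>R w + d *\<^sub>R v) = 0"
  then have "(x * a) *\<^sub>R u + (y * b + z * d) *\<^sub>R v + (z * c) *\<^sub>R w = 0"
    by (simp add: algebra_simps)
  then have "x * a = 0 \<and> y * b + z * d = 0 \<and> z * c = 0"
    using assms(1) unfolding indep3_def by blast
  then show "x = 0 \<and> y = 0 \<and> z = 0" using assms by auto
qed

text \<open>
  Extend the unit vectors and the given vectors to bases and match the remaining elements.
\<close>

lemma indep3_linear_bij:
  fixes v1 v2 v3 :: "real ^ 'm"
  assumes "indep3 v1 v2 v3" and ne: "i1 \<noteq> i2" "i1 \<noteq> i3" "i2 \<noteq> i3"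
  obtains \<Phi> :: "real ^ 'm \<Rightarrow> real ^ 'm" where "linear \<Phi>" "bij \<Phi>"
    "\<Phi> (axis i1 1) = v1" "\<Phi> (axis i2 1) = v2" "\<Phi> (axis i3 1) = v3"
proof -
  have ind: "a *\<^sub>R v1 + b *\<^sub>R v2 + c *\<^sub>R v3 = 0 \<Longrightarrow> a = 0 \<and> b = 0 \<and> c = 0" for a b c
    using assms(1) unfolding indep3_def by blast
  have d: "v1 \<noteq> v2" "v1 \<noteq> v3" "v2 \<noteq> v3"
    using ind[of 1 "-1" 0] ind[of 1 0 "-1"] ind[of 0 1 "-1"] by auto
  let ?e = "\<lambda>i. axis i (1::real) :: real ^ 'm"
  let ?E = "{?e i1, ?e i2, ?e i3}" and ?V = "{v1, v2, v3}"
  have de: "?e i1 \<noteq> ?e i2" "?e i1 \<noteq> ?e i3" "?e i2 \<noteq> ?e i3"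
    using ne by (simp_all add: axis_eq_axis)
  have "independent ?V"
    unfolding independent_explicit
  proof (intro conjI allI impI)
    fix c assume "(\<Sum>v\<in>?V. c v *\<^sub>R v) = 0"
    then have "c v1 *\<^sub>R v1 + c v2 *\<^sub>R v2 + c v3 *\<^sub>R v3 = 0" using d by (simp add: add.assoc)
    then show "\<forall>v\<in>?V. c v = 0" using ind by simp
  qed simp
  then obtain B where B: "?V \<subseteq> B" "independent B" "UNIV \<subseteq> span B"
    using maximal_independent_subset_extend[of ?V UNIV] by auto
  have fB: "finite B" using B(2) independent_bound by blast
  have cB: "card B = DIM(real ^ 'm)"
    using basis_card_eq_dim[of B UNIV] B by simp
  have EB: "?E \<subseteq> Basis" by (simp add: axis_in_Basis_iff)
  have "card (Basis - ?E) = card (B - ?V)"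
    using card_Diff_subset[of ?E Basis] card_Diff_subset[of ?V B] EB B(1) cB d de by simp
  then obtain h where h: "bij_betw h (Basis - ?E) (B - ?V)"
    using finite_same_card_bij[of "Basis - ?E" "B - ?V"] fB by auto
  let ?h = "\<lambda>x. if x = ?e i1 then v1 else if x = ?e i2 then v2 else if x = ?e i3 then v3 else h x"
  obtain \<Phi> where \<Phi>: "linear \<Phi>" "\<And>x. x \<in> Basis \<Longrightarrow> \<Phi> x = ?h x"
    using linear_independent_extend[OF independent_Basis, of ?h] by blast
  have e: "\<Phi> (?e i1) = v1" "\<Phi> (?e i2) = v2" "\<Phi> (?e i3) = v3"
    using \<Phi>(2) EB de by auto
  have "B \<subseteq> range \<Phi>"
  proof
    fix b assume b: "b \<in> B"
    show "b \<in> range \<Phi>"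
    proof (cases "b \<in> ?V")
      case True
      then show ?thesis using e by (metis insertE rangeI singletonD)
    next
      case False
      then obtain x where x: "x \<in> Basis - ?E" "b = h x" using h b unfolding bij_betw_def by blast
      then have "\<Phi> x = b" using \<Phi>(2)[of x] by auto
      then show ?thesis by blast
    qed
  qed
  then have "span B \<subseteq> range \<Phi>"
    using span_minimal[OF _ linear_subspace_image[OF \<Phi>(1) subspace_UNIV]] by simp
  then have "surj \<Phi>" using B(3) by auto
  then have "bij \<Phi>" using linear_surjective_imp_injective[OF \<Phi>(1)] by (simp add: bij_def)
  then show ?thesis using that \<Phi>(1) e by blast
qed

lemma pos_less: "i < j \<Longrightarrow> pos i < pos (j :: 'm::{finite,linorder})"
proof -
  assume ij: "i < j"
  then have "j \<notin> {k. k \<le> i}" "j \<in> {k. k \<le> j}" "{k. k \<le> i} \<subseteq> {k. k \<le> j}" by auto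
  then show ?thesis unfolding pos_def by (intro psubset_card_mono) auto
qed

lemma inj_pos: "inj (pos :: 'm::{finite,linorder} \<Rightarrow> nat)"
  by (metis injI linorder_neq_iff pos_less less_irrefl)

lemma pos_surj:
  assumes "1 \<le> k" "k \<le> CARD('m::{finite,linorder})"
  obtains i :: "'m::{finite,linorder}" where "pos i = k"
proof -
  have "range (pos :: 'm \<Rightarrow> nat) \<subseteq> {1..CARD('m)}"
  proof
    fix n assume "n \<in> range (pos :: 'm \<Rightarrow> nat)"
    then obtain i :: 'm where "n = pos i" by blast
    moreover have "card {j. j \<le> i} > 0" by (subst card_gt_0_iff) auto
    ultimately show "n \<in> {1..CARD('m)}" unfolding pos_def by (simp add: card_mono Suc_leI)
  qed
  then have "range (pos :: 'm \<Rightarrow> nat) = {1..CARD('m)}"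
    by (intro card_subset_eq) (simp_all add: card_image inj_pos)
  then show ?thesis using assms that by (metis atLeastAtMost_iff imageE)
qed

lemma first_three_indices:
  assumes "CARD('m::{finite,linorder}) \<ge> 3"
  obtains i1 i2 i3 :: "'m::{finite,linorder}" where "pos i1 = 1" "pos i2 = 2" "pos i3 = 3"
proof -
  obtain i1 :: "'m::{finite,linorder}" where "pos i1 = 1" by (rule pos_surj[of 1]) (use assms in auto)
  moreover obtain i2 :: "'m::{finite,linorder}" where "pos i2 = 2" by (rule pos_surj[of 2]) (use assms in auto)
  moreover obtain i3 :: "'m::{finite,linorder}" where "pos i3 = 3" by (rule pos_surj[of 3]) (use assms in auto)
  ultimately show ?thesis by (rule that)
qed

section \<open>Recognition of the cuspidal edge\<close>

text \<open>
  On the axis \<open>z\<^sub>2 = 0\<close> the equation for \<open>g\<close> is void. Differentiating it recovers from \<open>F\<close> the data of \<open>g\<close>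
  at \<open>0\<close> that enter the independence condition, so that two such germs \<open>g\<close> can be compared.
\<close>

lemma second_and_third_derivative:
  fixes F g :: "real ^ 2 \<Rightarrow> 'b::euclidean_space"
  assumes g: "smooth_germ g 0" and eq: "\<forall>\<^sub>F z in nhds 0. pd 2 F z = (z $ 2) *\<^sub>R g z"
  shows "pd 2 (pd 2 F) 0 = g 0" "pd 2 (pd 2 (pd 2 F)) 0 = 2 *\<^sub>R pd 2 g 0"
proof -
  have "\<forall>\<^sub>F z in nhds 0. pd 2 (\<lambda>z. (z $ 2) *\<^sub>R g z) z = (z $ 2) *\<^sub>R pd 2 g z + g z"
    using smooth_germ_eventually[OF g]
  proof eventually_elim
    case (elim z)
    show ?case
      by (subst FD_scaleR) (use elim in \<open>simp_all add: smooth_intros axis2_nth\<close>)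
  qed
  with eventually_FD_cong[OF eq]
  have 2: "\<forall>\<^sub>F z in nhds 0. pd 2 (pd 2 F) z = (z $ 2) *\<^sub>R pd 2 g z + g z"
    by eventually_elim simp
  show "pd 2 (pd 2 F) 0 = g 0" using eventually_nhds_x_imp_x[OF 2] by simp
  have "pd 2 (pd 2 (pd 2 F)) 0 = pd 2 (\<lambda>z. (z $ 2) *\<^sub>R pd 2 g z + g z) 0"
    using FD_cong_nhds[OF 2] by simp
  also have "\<dots> = 2 *\<^sub>R pd 2 g 0"
    by (simp add: FD_add FD_scaleR smooth_intros g axis2_nth scaleR_2)
  finally show "pd 2 (pd 2 (pd 2 F)) 0 = 2 *\<^sub>R pd 2 g 0" .
qed

text \<open>
  Writing \<open>F = A(z\<^sub>1, z\<^sub>2\<^sup>2) + z\<^sub>2\<^sup>3 C(z\<^sub>1, z\<^sub>2\<^sup>2)\<close> one finds \<open>\<partial>\<^sub>1F = \<partial>\<^sub>1A\<close>, \<open>g = 2 \<partial>\<^sub>2A\<close> and \<open>\<partial>\<^sub>2g = 3 C\<close> at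
  \<open>0\<close>. A linear bijection \<open>\<Phi>\<close> sends the first three unit vectors to the independent vectors \<open>\<partial>\<^sub>1A(0)\<close>,
  \<open>\<partial>\<^sub>2A(0)\<close>, \<open>C(0)\<close>. Then \<open>T x = A(x\<^sub>1, x\<^sub>2) + x\<^sub>3 C(x\<^sub>1, x\<^sub>2) + L x\<close>, with \<open>L\<close> equal to \<open>\<Phi>\<close> on the other axes
  and zero on the first three, has the derivative \<open>\<Phi>\<close> at \<open>0\<close>.
\<close>

lemma cuspidal_edge_normal_form_core:
  fixes F :: "real ^ 2 \<Rightarrow> real ^ 'm::{finite,linorder}"
  assumes m: "CARD('m) \<ge> 3" and F: "smooth_germ F 0" and g: "smooth_germ g 0"
    and eq: "\<forall>\<^sub>F z in nhds 0. pd 2 F z = (z $ 2) *\<^sub>R g z"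
    and ind: "indep3 (pd 1 F 0) (g 0) (pd 2 g 0)"
  obtains T :: "real ^ 'm::{finite,linorder} \<Rightarrow> real ^ 'm::{finite,linorder}"
    where "diffeo_germ T 0 (F 0)" "\<forall>\<^sub>F z in nhds 0. F z = T (cuspidal_edge_normal_form z)"
proof -
  obtain A B where A: "smooth_germ A 0" and B: "smooth_germ B 0" and
    AB: "\<forall>\<^sub>F z in nhds 0. F z = A (pt (z $ 1) ((z $ 2)\<^sup>2)) + (z $ 2) *\<^sub>R B (pt (z $ 1) ((z $ 2)\<^sup>2))"
    by (rule even_odd_decomposition[OF F])
  let ?S = "\<lambda>z :: real ^ 2. pt (z $ 1) ((z $ 2)\<^sup>2)"
  have S: "smooth_germ ?S z" for z by (intro smooth_intros)
  have dS: "FD ?S z v = pt (v $ 1) (2 * z $ 2 * v $ 2)" for z v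
    by (simp add: FD_pt power2_eq_square FD_mult smooth_intros mult_ac)
  have dS2: "FD ?S z (axis 2 1) = (2 * z $ 2) *\<^sub>R axis 2 1" for z
    unfolding dS by (simp add: vec_eq_iff forall_2 axis2_nth)
  have evS: "\<forall>\<^sub>F z in nhds 0. P (?S z)" if "\<forall>\<^sub>F z in nhds 0. P z" for P
    using smooth_germ_eventually_compose[OF S[of 0]] that by simp
  have SK: "smooth_germ (\<lambda>z. K (?S z)) z" and dK: "pd 2 (\<lambda>z. K (?S z)) z = (2 * z $ 2) *\<^sub>R pd 2 K (?S z)"
    if "smooth_germ K (?S z)" for K :: "real ^ 2 \<Rightarrow> real ^ 'm::{finite,linorder}" and z
  proof -
    show "smooth_germ (\<lambda>z. K (?S z)) z" by (rule smooth_germ_compose[OF that S])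
    have "pd 2 (\<lambda>z. K (?S z)) z = FD K (?S z) ((2 * z $ 2) *\<^sub>R axis 2 1)"
      unfolding dS2[symmetric] by (rule FD_compose[where g = K and f = ?S, OF that S])
    then show "pd 2 (\<lambda>z. K (?S z)) z = (2 * z $ 2) *\<^sub>R pd 2 K (?S z)"
      by (simp add: linear_cmul[OF smooth_germ_linear_derivative[OF that]])
  qed
  have "\<forall>\<^sub>F z in nhds 0. z $ 2 = 0 \<longrightarrow> B z = 0"
    using eventually_FD_cong[OF AB] eq evS[OF smooth_germ_eventually[OF A]]
      evS[OF smooth_germ_eventually[OF B]]
  proof eventually_elim
    case (elim z)
    show ?case
    proof
      assume z: "z $ 2 = 0"
      then have Sz: "pt (z $ 1) 0 = z" by (simp add: vec_eq_iff forall_2)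
      have "0 = pd 2 (\<lambda>z. A (?S z) + (z $ 2) *\<^sub>R B (?S z)) z"
        using elim(1,2) z by simp
      also have "\<dots> = B z"
        using SK[OF elim(3)] SK[OF elim(4)] dK[OF elim(3)] dK[OF elim(4)]
        by (simp add: FD_add FD_scaleR smooth_intros z Sz axis2_nth)
      finally show "B z = 0" by simp
    qed
  qed
  moreover have "filterlim (\<lambda>x. pt x 0) (nhds 0) (nhds (0::real))"
    using smooth_germ_tendsto[of "\<lambda>x. pt x 0" 0] by (simp add: smooth_intros)
  ultimately have "\<forall>\<^sub>F x in nhds 0. B (pt x 0) = 0"
    by (auto simp: filterlim_iff dest!: spec elim!: eventually_mono)
  then obtain C where C: "smooth_germ C 0" and BC: "\<forall>\<^sub>F z in nhds 0. B z = (z $ 2) *\<^sub>R C z"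
    by (rule hadamard[OF B])
  have AC: "\<forall>\<^sub>F z in nhds 0. F z = A (?S z) + ((z $ 2) ^ 3) *\<^sub>R C (?S z)"
    using AB evS[OF BC] by eventually_elim (simp add: power2_eq_square power3_eq_cube mult.assoc)
  \<comment> \<open>a second quotient of \<open>\<partial>\<^sub>2F\<close> by \<open>z\<^sub>2\<close>, to be compared with \<open>g\<close>\<close>
  let ?h = "\<lambda>z. 2 *\<^sub>R pd 2 A (?S z) + (z $ 2) *\<^sub>R (3 *\<^sub>R C (?S z) + (2 * (z $ 2)\<^sup>2) *\<^sub>R pd 2 C (?S z))"
  have d3: "FD (\<lambda>z. (z $ 2) ^ 3) z v = 3 * (z $ 2)\<^sup>2 * v $ 2" for z v :: "real ^ 2"
    by (simp add: power3_eq_cube power2_eq_square FD_mult smooth_intros algebra_simps)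
  have pdF: "\<forall>\<^sub>F z in nhds 0. pd 2 F z = (z $ 2) *\<^sub>R ?h z"
    using eventually_FD_cong[OF AC] evS[OF smooth_germ_eventually[OF A]]
      evS[OF smooth_germ_eventually[OF C]]
  proof eventually_elim
    case (elim z)
    show ?case unfolding elim(1)
      using SK[OF elim(2)] SK[OF elim(3)] dK[OF elim(2)] dK[OF elim(3)]
      by (simp add: FD_add FD_scaleR smooth_intros d3 axis2_nth)
        (simp add: algebra_simps power2_eq_square power3_eq_cube)
  qed
  note pA = smooth_germ_FD[OF A] and pC = smooth_germ_FD[OF C]
  have h: "smooth_germ ?h 0"
    using SK[of "pd 2 A" 0] SK[of "pd 2 C" 0] SK[of C 0] by (intro smooth_intros) (simp_all add: pA pC C)
  have g0: "g 0 = 2 *\<^sub>R pd 2 A 0"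
    using second_and_third_derivative(1)[OF g eq] second_and_third_derivative(1)[OF h pdF] by simp
  have h0: "pd 2 ?h 0 = 3 *\<^sub>R C 0"
    using SK[of "pd 2 A" 0] SK[of "pd 2 C" 0] SK[of C 0] dK[of "pd 2 A" 0]
    by (simp add: FD_add FD_scaleR smooth_intros pA pC C axis2_nth
        frechet_derivative_const)
  have "2 *\<^sub>R pd 2 g 0 = 2 *\<^sub>R pd 2 ?h 0"
    by (rule trans[OF second_and_third_derivative(2)[OF g eq, symmetric] second_and_third_derivative(2)[OF h pdF]])
  then have g1: "pd 2 g 0 = 3 *\<^sub>R C 0"
    unfolding h0 by (simp only: scaleR_cancel_left) simp
  have F1: "pd 1 F 0 = pd 1 A 0"
  proof -
    have "pd 1 F 0 = pd 1 (\<lambda>z. A (?S z) + ((z $ 2) ^ 3) *\<^sub>R C (?S z)) 0"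
      using FD_cong_nhds[OF AC] by simp
    also have "\<dots> = FD A 0 (pt 1 0)"
      using SK[of A 0] SK[of C 0]
      by (simp add: FD_add FD_scaleR smooth_intros A C d3
          FD_compose[where g = A and f = ?S] S dS axis2_nth)
    also have "pt 1 0 = axis 1 1" by (simp add: pt_def)
    finally show ?thesis .
  qed
  have "indep3 (1 *\<^sub>R pd 1 F 0) ((1 / 2) *\<^sub>R g 0) ((1 / 3) *\<^sub>R pd 2 g 0 + 0 *\<^sub>R g 0)"
    by (rule indep3_scale[OF ind]) auto
  then have ind': "indep3 (pd 1 A 0) (pd 2 A 0) (C 0)" by (simp add: F1 g0 g1)
  obtain i1 i2 i3 :: "'m::{finite,linorder}" where i1: "pos i1 = 1" and i2: "pos i2 = 2" and i3: "pos i3 = 3"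
    by (rule first_three_indices[OF m])
  note i = i1 i2 i3
  have ne: "i1 \<noteq> i2" "i1 \<noteq> i3" "i2 \<noteq> i3" using i by auto
  obtain \<Phi> :: "real ^ 'm::{finite,linorder} \<Rightarrow> real ^ 'm::{finite,linorder}"
    where \<Phi>: "linear \<Phi>" "bij \<Phi>" "\<Phi> (axis i1 1) = pd 1 A 0" "\<Phi> (axis i2 1) = pd 2 A 0"
      "\<Phi> (axis i3 1) = C 0"
    by (rule indep3_linear_bij[OF ind' ne])
  let ?L = "\<lambda>x. \<Phi> (x - x $ i1 *\<^sub>R axis i1 1 - x $ i2 *\<^sub>R axis i2 1 - x $ i3 *\<^sub>R axis i3 1)"
  have L: "linear ?L"
    by (rule linearI) (simp_all add: linear_add[OF \<Phi>(1), symmetric] linear_cmul[OF \<Phi>(1), symmetric] algebra_simps)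
  then have bL: "bounded_linear ?L" by (simp add: linear_conv_bounded_linear)
  define T where "T x = A (pt (x $ i1) (x $ i2)) + x $ i3 *\<^sub>R C (pt (x $ i1) (x $ i2)) + ?L x" for x :: "real ^ 'm::{finite,linorder}"
  let ?Q = "\<lambda>x :: real ^ 'm::{finite,linorder}. pt (x $ i1) (x $ i2)"
  have Q: "smooth_germ ?Q 0" by (intro smooth_intros)
  have QK: "smooth_germ (\<lambda>x. K (?Q x)) 0" if "smooth_germ K 0" for K :: "real ^ 2 \<Rightarrow> real ^ 'm::{finite,linorder}"
    using smooth_germ_compose[where g = K and f = ?Q and a = 0] that Q by simp
  have Ls: "smooth_germ ?L 0" by (rule smooth_germ_bounded_linear[OF bL smooth_germ_id])
  have Ts: "smooth_germ T 0"
    unfolding T_def[abs_def] by (intro smooth_germ_add QK A C Ls smooth_germ_scaleR smooth_germ_vec_nth smooth_germ_id)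
  have dT: "FD T 0 v = \<Phi> v" for v
  proof -
    have "FD T 0 v = FD A 0 (pt (v $ i1) (v $ i2)) + v $ i3 *\<^sub>R C 0 + ?L v"
      unfolding T_def[abs_def]
      by (simp add: FD_add FD_scaleR smooth_germ_add smooth_germ_scaleR
          smooth_germ_vec_nth smooth_germ_id QK A C Ls FD_bounded_linear'[OF bL]
          FD_compose[where g = A and f = ?Q] Q FD_pt)
    also have "FD A 0 (pt (v $ i1) (v $ i2)) = v $ i1 *\<^sub>R pd 1 A 0 + v $ i2 *\<^sub>R pd 2 A 0"
      using smooth_germ_linear_derivative[OF A] by (simp add: pt_def linear_add linear_cmul)
    also have "v $ i1 *\<^sub>R pd 1 A 0 + v $ i2 *\<^sub>R pd 2 A 0 + v $ i3 *\<^sub>R C 0 + ?L v = \<Phi> v"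
      unfolding \<Phi>(3-5)[symmetric] by (simp add: linear_diff[OF \<Phi>(1)] linear_cmul[OF \<Phi>(1)])
    finally show ?thesis .
  qed
  have "FD T 0 = \<Phi>" using dT by blast
  then have "diffeo_germ T 0 (T 0)"
    by (intro diffeo_germ_inj_derivative Ts) (use \<Phi>(2) in \<open>simp add: bij_def\<close>)
  moreover have "T 0 = F 0"
    using eventually_nhds_x_imp_x[OF AC] linear_0[OF L] by (simp add: T_def linear_0[OF \<Phi>(1)])
  moreover have "\<forall>\<^sub>F z in nhds 0. F z = T (cuspidal_edge_normal_form z)"
    using AC
  proof eventually_elim
    case (elim z)
    let ?N = "cuspidal_edge_normal_form z :: real ^ 'm::{finite,linorder}"
    have N: "?N $ i1 = z $ 1" "?N $ i2 = (z $ 2)\<^sup>2" "?N $ i3 = (z $ 2) ^ 3"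
      using i by (simp_all add: cuspidal_edge_normal_form_def)
    have "?N - ?N $ i1 *\<^sub>R axis i1 1 - ?N $ i2 *\<^sub>R axis i2 1 - ?N $ i3 *\<^sub>R axis i3 1 = 0"
    proof (subst vec_eq_iff, intro allI)
      fix j
      have "pos j \<noteq> 1" "pos j \<noteq> 2" "pos j \<noteq> 3" if "j \<noteq> i1" "j \<noteq> i2" "j \<noteq> i3"
        using that i injD[OF inj_pos] by metis+
      then show "(?N - ?N $ i1 *\<^sub>R axis i1 1 - ?N $ i2 *\<^sub>R axis i2 1 - ?N $ i3 *\<^sub>R axis i3 1) $ j = 0 $ j"
        using ne N by (cases "j = i1"; cases "j = i2"; cases "j = i3")
          (auto simp: axis_def cuspidal_edge_normal_form_def)
    qed
    then show ?case by (simp only: T_def N linear_0[OF \<Phi>(1)] elim add_0_right)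
  qed
  ultimately show ?thesis using that[of T] by simp
qed

lemma cuspidal_edge_normal_form_0: "cuspidal_edge_normal_form 0 = 0"
  by (simp add: cuspidal_edge_normal_form_def vec_eq_iff)

lemma smooth_germ_cuspidal_edge_normal_form: "smooth_germ cuspidal_edge_normal_form z"
proof -
  have "smooth_germ (\<lambda>t :: real ^ 2. if pos i = 1 then t $ 1 else if pos i = 2 then (t $ 2) ^ 2
      else if pos i = 3 then (t $ 2) ^ 3 else 0) z" for i :: "'m::{finite,linorder}"
    by (cases "pos i = 1"; cases "pos i = 2"; cases "pos i = 3") (simp_all add: smooth_intros)
  then show ?thesis
    unfolding cuspidal_edge_normal_form_def[abs_def] by (intro smooth_germ_vec_lambda)
qed

text \<open>
  In the coordinates \<open>\<sigma> = (p - p(a), \<Lambda>)\<close>, with inverse \<open>\<psi>\<close>, the field \<open>X\<close> is \<open>X\<Lambda>\<close> times the second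
  coordinate field. Hence \<open>F = f \<circ> \<psi>\<close> satisfies \<open>\<partial>\<^sub>2F = z\<^sub>2 g\<close> with \<open>g = (G / X\<Lambda>) \<circ> \<psi>\<close>. Up to nonzero factors
  and a multiple of \<open>G(a)\<close>, the vectors \<open>\<partial>\<^sub>1F\<close>, \<open>g\<close>, \<open>\<partial>\<^sub>2g\<close> at \<open>0\<close> are \<open>df(w)\<close>, \<open>G\<close>, \<open>XG\<close> at \<open>a\<close>.
\<close>

theorem cuspidal_edge_recognition:
  fixes f :: "real ^ 2 \<Rightarrow> real ^ 'm::{finite,linorder}" and X :: "real ^ 2 \<Rightarrow> real ^ 2"
  assumes m: "CARD('m) \<ge> 3" and f: "smooth_germ f a" and X: "smooth_germ X a"
    and p: "smooth_germ p a" and \<Lambda>: "smooth_germ \<Lambda> a" and G: "smooth_germ G a"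
    and Xp: "\<forall>\<^sub>F t in nhds a. FD p t (X t) = (0::real)"
    and Xf: "\<forall>\<^sub>F t in nhds a. FD f t (X t) = \<Lambda> t *\<^sub>R G t"
    and \<Lambda>0: "\<Lambda> a = 0" and X\<Lambda>: "FD \<Lambda> a (X a) \<noteq> 0"
    and w: "FD p a w \<noteq> 0"
    and ind: "indep3 (FD f a w) (G a) (FD G a (X a))"
  shows "A_equivalent f a cuspidal_edge_normal_form 0"
proof -
  let ?c = "\<lambda>t. FD \<Lambda> t (X t)"
  define \<sigma> where "\<sigma> t = pt (p t - p a) (\<Lambda> t)" for t
  have \<sigma>s: "smooth_germ \<sigma> a" unfolding \<sigma>_def[abs_def] by (intro smooth_intros p \<Lambda>)
  have \<sigma>a: "\<sigma> a = 0" by (simp add: \<sigma>_def \<Lambda>0)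
  have d\<sigma>: "FD \<sigma> t v = pt (FD p t v) (FD \<Lambda> t v)"
    if "smooth_germ p t" "smooth_germ \<Lambda> t" for t v
    unfolding \<sigma>_def[abs_def]
    by (simp add: FD_pt FD_diff smooth_intros that frechet_derivative_const)
  let ?S = "FD \<sigma> a"
  have linS: "linear ?S" by (rule smooth_germ_linear_derivative[OF \<sigma>s])
  have SX: "?S (X a) = ?c a *\<^sub>R axis 2 1"
    using d\<sigma>[OF p \<Lambda>] eventually_nhds_x_imp_x[OF Xp] by (simp add: vec_eq_iff forall_2 axis2_nth)
  define d where "d = FD p a w"
  define e where "e = FD \<Lambda> a w"
  have Sw: "?S w = d *\<^sub>R axis 1 1 + e *\<^sub>R axis 2 1"
    using d\<sigma>[OF p \<Lambda>] by (simp add: pt_def d_def e_def)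
  have "inj ?S"
  proof (rule linear_surjective_imp_injective[OF linS])
    show "surj ?S"
    proof (rule surjI)
      fix y :: "real ^ 2"
      show "?S ((y $ 1 / d) *\<^sub>R w + ((y $ 2 - y $ 1 / d * e) / ?c a) *\<^sub>R X a) = y"
        unfolding linear_add[OF linS] linear_cmul[OF linS] SX Sw
        using X\<Lambda> w by (simp add: vec_eq_iff forall_2 axis2_nth d_def)
    qed
  qed simp
  then have "diffeo_germ \<sigma> a (\<sigma> a)" by (rule diffeo_germ_inj_derivative[OF \<sigma>s])
  then have \<sigma>d: "diffeo_germ \<sigma> a 0" by (simp add: \<sigma>a)
  then obtain \<psi> where \<psi>: "diffeo_germ \<psi> 0 a" "\<forall>\<^sub>F t in nhds a. \<psi> (\<sigma> t) = t" "\<forall>\<^sub>F z in nhds 0. \<sigma> (\<psi> z) = z"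
    by (rule diffeo_germE)
  have \<psi>s: "smooth_germ \<psi> 0" "\<psi> 0 = a" using \<psi>(1) by (auto simp: diffeo_germ_def)
  have ev\<psi>: "\<forall>\<^sub>F z in nhds 0. P (\<psi> z)" if "\<forall>\<^sub>F t in nhds a. P t" for P
    using smooth_germ_eventually_compose[OF \<psi>s(1)] \<psi>s(2) that by simp
  have comp: "smooth_germ (\<lambda>z. K (\<psi> z)) 0" if "smooth_germ K a" for K :: "real ^ 2 \<Rightarrow> 'b::euclidean_space"
    using smooth_germ_compose[where g = K and f = \<psi> and a = 0] that \<psi>s by simp
  have cs: "smooth_germ ?c a" by (rule smooth_germ_FD_field[OF \<Lambda> X])
  have inv: "\<forall>\<^sub>F t in nhds a. FD \<psi> (\<sigma> t) (FD \<sigma> t v) = v" for v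
    using eventually_FD_cong[OF \<psi>(2)] smooth_germ_eventually[OF \<sigma>s]
      smooth_germ_eventually_compose[OF \<sigma>s, unfolded \<sigma>a, OF smooth_germ_eventually[OF \<psi>s(1)]]
  proof eventually_elim
    case (elim t)
    have "FD (\<lambda>t. \<psi> (\<sigma> t)) t v = v" using elim(1) by (simp add: frechet_derivative_ident)
    then show ?case
      using FD_compose[where g = \<psi> and f = \<sigma>, OF elim(3,2)] by simp
  qed
  have inva: "FD \<psi> 0 (?S v) = v" for v
    using eventually_nhds_x_imp_x[OF inv[of v]] by (simp add: \<sigma>a)
  define F where "F z = f (\<psi> z)" for z
  have Fs: "smooth_germ F 0" unfolding F_def[abs_def] by (rule comp[OF f])
  define g where "g z = inverse (?c (\<psi> z)) *\<^sub>R G (\<psi> z)" for z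
  let ?g = "\<lambda>t. inverse (?c t) *\<^sub>R G t"
  have gs': "smooth_germ ?g a" by (intro smooth_intros cs X\<Lambda> G)
  have gs: "smooth_germ g 0" unfolding g_def[abs_def] by (rule comp[OF gs'])
  have invX: "\<forall>\<^sub>F t in nhds a. FD \<psi> (\<sigma> t) (FD \<sigma> t (X t)) = X t"
    using inv[of "axis 1 1"] inv[of "axis 2 1"] smooth_germ_eventually[OF \<sigma>s]
      smooth_germ_eventually_compose[OF \<sigma>s, unfolded \<sigma>a, OF smooth_germ_eventually[OF \<psi>s(1)]]
  proof eventually_elim
    case (elim t)
    note l = smooth_germ_linear_derivative[OF elim(3)] smooth_germ_linear_derivative[OF elim(4)]
    have "FD \<psi> (\<sigma> t) (FD \<sigma> t (x *\<^sub>R axis 1 1 + y *\<^sub>R axis 2 1))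
        = x *\<^sub>R axis 1 1 + y *\<^sub>R axis 2 1" for x y
      by (simp add: linear_add[OF l(1)] linear_cmul[OF l(1)] linear_add[OF l(2)] linear_cmul[OF l(2)] elim(1,2))
    from this[of "X t $ 1" "X t $ 2"] show ?case
      by (simp only: pt_def[symmetric] pt_eta)
  qed
  have cne: "\<forall>\<^sub>F t in nhds a. ?c t \<noteq> 0"
    using smooth_germ_tendsto[OF cs] X\<Lambda> by (rule tendsto_imp_eventually_ne)
  have key: "\<forall>\<^sub>F t in nhds a. ?c t \<noteq> 0 \<and> FD \<psi> (\<sigma> t) (axis 2 1) = inverse (?c t) *\<^sub>R X t"
    using cne invX Xp smooth_germ_eventually[OF p] smooth_germ_eventually[OF \<Lambda>]
      smooth_germ_eventually_compose[OF \<sigma>s, unfolded \<sigma>a, OF smooth_germ_eventually[OF \<psi>s(1)]]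
  proof eventually_elim
    case (elim t)
    have "FD \<sigma> t (X t) = ?c t *\<^sub>R axis 2 1"
      using d\<sigma>[OF elim(4,5)] elim(3) by (simp add: vec_eq_iff forall_2 axis2_nth)
    then have "?c t *\<^sub>R FD \<psi> (\<sigma> t) (axis 2 1) = X t"
      using elim(2) linear_cmul[OF smooth_germ_linear_derivative[OF elim(6)]] by simp
    then have "inverse (?c t) *\<^sub>R X t = inverse (?c t) *\<^sub>R ?c t *\<^sub>R FD \<psi> (\<sigma> t) (axis 2 1)"
      by (simp only:)
    then show ?case using elim(1) by simp
  qed
  have "\<forall>\<^sub>F z in nhds 0. pd 2 F z = (z $ 2) *\<^sub>R g z"
    using ev\<psi>[OF key] ev\<psi>[OF Xf] \<psi>(3) smooth_germ_eventually[OF \<psi>s(1)] ev\<psi>[OF smooth_germ_eventually[OF f]]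
  proof eventually_elim
    case (elim z)
    have \<Lambda>z: "\<Lambda> (\<psi> z) = z $ 2" using arg_cong[OF elim(3), of "\<lambda>y. y $ 2"] by (simp add: \<sigma>_def)
    have "pd 2 F z = FD f (\<psi> z) (inverse (?c (\<psi> z)) *\<^sub>R X (\<psi> z))"
      unfolding F_def[abs_def] FD_compose[where g = f and f = \<psi>, OF elim(5,4)]
      using elim(1,3) by simp
    also have "\<dots> = (z $ 2) *\<^sub>R g z"
      using linear_cmul[OF smooth_germ_linear_derivative[OF elim(5)]] elim(2) \<Lambda>z by (simp add: g_def mult.commute)
    finally show ?case .
  qed
  moreover have "indep3 (pd 1 F 0) (g 0) (pd 2 g 0)"
  proof -
    let ?f = "FD f a"
    have linf: "linear ?f" by (rule smooth_germ_linear_derivative[OF f])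
    have fX: "?f (X a) = 0" using eventually_nhds_x_imp_x[OF Xf] \<Lambda>0 by simp
    have lin\<psi>: "linear (FD \<psi> 0)" by (rule smooth_germ_linear_derivative[OF \<psi>s(1)])
    have dF: "FD F 0 v = ?f (FD \<psi> 0 v)" for v
      unfolding F_def[abs_def] using FD_compose[where g = f and f = \<psi> and a = 0] f \<psi>s by simp
    have dg: "FD g 0 v = FD ?g a (FD \<psi> 0 v)" for v
      unfolding g_def[abs_def] using FD_compose[where g = ?g and f = \<psi> and a = 0] gs' \<psi>s by simp
    have \<psi>2: "FD \<psi> 0 (axis 2 1) = inverse (?c a) *\<^sub>R X a"
      using eventually_nhds_x_imp_x[OF key] by (simp add: \<sigma>a)
    have weq: "w = d *\<^sub>R FD \<psi> 0 (axis 1 1) + e *\<^sub>R FD \<psi> 0 (axis 2 1)"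
      using inva[of w] unfolding Sw by (simp add: linear_add[OF lin\<psi>] linear_cmul[OF lin\<psi>])
    have "?f w = d *\<^sub>R pd 1 F 0"
      unfolding dF by (subst weq) (simp add: linear_add[OF linf] linear_cmul[OF linf] \<psi>2 fX)
    then have 1: "pd 1 F 0 = inverse d *\<^sub>R ?f w" using w by (simp add: d_def)
    have 2: "g 0 = inverse (?c a) *\<^sub>R G a" by (simp add: g_def \<psi>s)
    have ci: "smooth_germ (\<lambda>t. inverse (?c t)) a" by (intro smooth_intros cs X\<Lambda>)
    have ling: "linear (FD ?g a)" by (rule smooth_germ_linear_derivative[OF gs'])
    have "pd 2 g 0 = inverse (?c a) *\<^sub>R FD ?g a (X a)"
      unfolding dg \<psi>2 by (rule linear_cmul[OF ling])
    also have "\<dots> = (inverse (?c a) * inverse (?c a)) *\<^sub>R FD G a (X a) +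
        (inverse (?c a) * FD (\<lambda>t. inverse (?c t)) a (X a)) *\<^sub>R G a"
      unfolding FD_scaleR[OF ci G] by (simp add: scaleR_add_right)
    finally have 3: "pd 2 g 0 = \<dots>" .
    show ?thesis unfolding 1 2 3 by (rule indep3_scale[OF ind]) (use X\<Lambda> w in \<open>auto simp: d_def\<close>)
  qed
  ultimately obtain T :: "real ^ 'm::{finite,linorder} \<Rightarrow> real ^ 'm::{finite,linorder}"
    where T: "diffeo_germ T 0 (F 0)" "\<forall>\<^sub>F z in nhds 0. F z = T (cuspidal_edge_normal_form z)"
    by (rule cuspidal_edge_normal_form_core[OF m Fs gs])
  have "\<forall>\<^sub>F t in nhds a. f t = T (cuspidal_edge_normal_form (\<sigma> t))"
    using \<psi>(2) smooth_germ_eventually_compose[OF \<sigma>s, unfolded \<sigma>a, OF T(2)]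
    by eventually_elim (simp add: F_def)
  moreover have "diffeo_germ T (cuspidal_edge_normal_form 0) (f a)"
    using T(1) by (simp add: F_def \<psi>s cuspidal_edge_normal_form_0)
  ultimately show ?thesis
    by (intro A_equivalentI[OF \<sigma>d] smooth_germ_cuspidal_edge_normal_form)
qed


section \<open>Tangent surfaces\<close>

abbreviation (input) velocity :: "(real \<Rightarrow> 'b::real_normed_vector) \<Rightarrow> real \<Rightarrow> 'b" where
  "velocity h \<equiv> \<lambda>t. FD h t 1"

lemma power_factor_deriv:
  fixes h w :: "real \<Rightarrow> real"
  assumes "smooth_germ w 0" "\<forall>\<^sub>F t in nhds 0. h t = t ^ Suc k * w t"
  obtains w' where "smooth_germ w' 0" "w' 0 = real (Suc k) * w 0"
    "\<forall>\<^sub>F t in nhds 0. FD h t 1 = t ^ k * w' t"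
proof
  let ?w' = "\<lambda>t. real (Suc k) * w t + t * FD w t 1"
  show "smooth_germ ?w' 0" by (intro smooth_intros assms(1))
  have pw: "FD (\<lambda>t. t ^ Suc k) t 1 = real (Suc k) * t ^ k" for t :: real
    using FD_eqI[OF has_field_derivative_imp_has_derivative[OF DERIV_pow[of "Suc k" t]]] by simp
  show "\<forall>\<^sub>F t in nhds 0. FD h t 1 = t ^ k * ?w' t"
    using eventually_FD_cong[OF assms(2)] smooth_germ_eventually[OF assms(1)]
  proof eventually_elim
    case (elim t)
    have "FD h t 1 = FD (\<lambda>t. t ^ Suc k * w t) t 1"
      by (simp only: elim)
    also have "\<dots> = t ^ Suc k * FD w t 1 + real (Suc k) * t ^ k * w t"
      by (subst FD_mult) (use elim in \<open>auto intro!: smooth_intros simp only: pw\<close>)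
    finally show ?case by (simp add: algebra_simps)
  qed
qed simp

text \<open>
  In the affine coordinates of the definition, the first three components of the first three
  derivatives form a triangular matrix with the diagonal entries \<open>1\<close>, \<open>2\<close>, \<open>6\<close>.
\<close>

lemma curve_type_123_derivatives:
  fixes \<gamma> :: "real \<Rightarrow> real ^ 'm::{finite,linorder}"
  assumes m: "CARD('m) \<ge> 3" and \<gamma>: "curve_of_type \<gamma> l" "type_123 l"
  shows "indep3 (velocity \<gamma> 0) (velocity (velocity \<gamma>) 0) (velocity (velocity (velocity \<gamma>)) 0)"
proof -
  have \<gamma>s: "smooth_germ \<gamma> 0" using \<gamma>(1) by (simp add: curve_of_type_def)
  obtain L where L: "linear L" and Lr: "\<And>i. \<exists>r. smooth_germ r 0 \<and>
      (\<forall>\<^sub>F t in nhds 0. L (\<gamma> t - \<gamma> 0) $ i = t ^ l i + t ^ Suc (l i) * r t)"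
    using \<gamma>(1) unfolding curve_of_type_def by blast
  have bl: "bounded_linear (\<lambda>x. L x $ i)" for i
    using bounded_linear_compose[OF bounded_linear_vec_nth] L by (simp add: linear_conv_bounded_linear)
  have Ds: "smooth_germ (velocity h) t" if "smooth_germ h t" for h :: "real \<Rightarrow> real ^ 'm::{finite,linorder}" and t
    by (rule smooth_germ_FD[OF that])
  have DL: "\<forall>\<^sub>F t in nhds 0. velocity (\<lambda>t. L (h t) $ i) t = L (velocity h t) $ i"
    if "smooth_germ h 0" for h :: "real \<Rightarrow> real ^ 'm::{finite,linorder}" and i
    using smooth_germ_eventually[OF that]
    by eventually_elim (simp add: FD_bounded_linear[OF bl])
  have D1: "\<forall>\<^sub>F t in nhds 0. velocity (\<lambda>t. L (\<gamma> t - \<gamma> 0) $ i) t = L (velocity \<gamma> t) $ i" for i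
    using smooth_germ_eventually[OF \<gamma>s]
    by eventually_elim
      (simp add: FD_bounded_linear[OF bl] FD_diff smooth_intros
        frechet_derivative_const)
  have factor: "\<exists>w. smooth_germ w 0 \<and> w 0 = 1 \<and> (\<forall>\<^sub>F t in nhds 0. L (\<gamma> t - \<gamma> 0) $ i = t ^ pos i * w t)"
    if i: "pos i \<le> 3" for i
  proof -
    obtain r where r: "smooth_germ r 0" "\<forall>\<^sub>F t in nhds 0. L (\<gamma> t - \<gamma> 0) $ i = t ^ l i + t ^ Suc (l i) * r t"
      using Lr by blast
    have "l i = pos i" using \<gamma>(2) i by (simp add: type_123_def)
    with r(2) have "\<forall>\<^sub>F t in nhds 0. L (\<gamma> t - \<gamma> 0) $ i = t ^ pos i * (1 + t * r t)"
      by (auto elim!: eventually_mono simp: algebra_simps)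
    then show ?thesis using r(1)
      by (intro exI[of _ "\<lambda>t. 1 + t * r t"]) (auto intro!: smooth_intros)
  qed
  have step: "\<exists>w'. smooth_germ w' 0 \<and> w' 0 = real (Suc k) * w 0 \<and> (\<forall>\<^sub>F t in nhds 0. h' t = t ^ k * w' t)"
    if h: "smooth_germ w 0" "\<forall>\<^sub>F t in nhds 0. h t = t ^ Suc k * w t" "\<forall>\<^sub>F t in nhds 0. velocity h t = h' t"
    for h h' w :: "real \<Rightarrow> real" and k
  proof -
    obtain w' where w': "smooth_germ w' 0" "w' 0 = real (Suc k) * w 0"
      "\<forall>\<^sub>F t in nhds 0. FD h t 1 = t ^ k * w' t"
      by (rule power_factor_deriv[OF h(1,2)])
    have "\<forall>\<^sub>F t in nhds 0. h' t = t ^ k * w' t"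
      using w'(3) h(3) by eventually_elim simp
    then show ?thesis using w' by blast
  qed
  note s1 = Ds[OF \<gamma>s] and s2 = Ds[OF Ds[OF \<gamma>s]]
  obtain i1 i2 i3 :: "'m::{finite,linorder}" where i1: "pos i1 = 1" and i2: "pos i2 = 2" and i3: "pos i3 = 3"
    by (rule first_three_indices[OF m])
  have 1: "L (velocity \<gamma> 0) $ i1 \<noteq> 0"
  proof -
    obtain w where w: "smooth_germ w 0" "w 0 = 1" "\<forall>\<^sub>F t in nhds 0. L (\<gamma> t - \<gamma> 0) $ i1 = t ^ Suc 0 * w t"
      using factor[of i1] i1 by auto
    from step[OF w(1,3) D1] obtain w1 where "w1 0 = real (Suc 0) * w 0" "\<forall>\<^sub>F t in nhds 0. L (velocity \<gamma> t) $ i1 = t ^ 0 * w1 t"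
      by blast
    then show ?thesis using eventually_nhds_x_imp_x w(2) by fastforce
  qed
  have 2: "L (velocity \<gamma> 0) $ i2 = 0 \<and> L (velocity (velocity \<gamma>) 0) $ i2 \<noteq> 0"
  proof -
    obtain w where w: "smooth_germ w 0" "w 0 = 1" "\<forall>\<^sub>F t in nhds 0. L (\<gamma> t - \<gamma> 0) $ i2 = t ^ Suc 1 * w t"
      using factor[of i2] i2 by (auto simp: numeral_2_eq_2)
    from step[OF w(1,3) D1] obtain w1 where w1: "smooth_germ w1 0" "w1 0 = real (Suc 1) * w 0"
      "\<forall>\<^sub>F t in nhds 0. L (velocity \<gamma> t) $ i2 = t ^ 1 * w1 t" by blast
    from step[OF w1(1) w1(3)[unfolded One_nat_def] DL[OF s1]] obtain w2 where
      w2: "w2 0 = real (Suc 0) * w1 0" "\<forall>\<^sub>F t in nhds 0. L (velocity (velocity \<gamma>) t) $ i2 = t ^ 0 * w2 t" by blast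
    show ?thesis
      using eventually_nhds_x_imp_x[OF w1(3)] eventually_nhds_x_imp_x[OF w2(2)] w(2) w1(2) w2(1) by simp
  qed
  have 3: "L (velocity \<gamma> 0) $ i3 = 0 \<and> L (velocity (velocity \<gamma>) 0) $ i3 = 0 \<and> L (velocity (velocity (velocity \<gamma>)) 0) $ i3 \<noteq> 0"
  proof -
    obtain w where w: "smooth_germ w 0" "w 0 = 1" "\<forall>\<^sub>F t in nhds 0. L (\<gamma> t - \<gamma> 0) $ i3 = t ^ Suc 2 * w t"
      using factor[of i3] i3 by (auto simp: numeral_3_eq_3 numeral_2_eq_2)
    from step[OF w(1,3) D1] obtain w1 where w1: "smooth_germ w1 0" "w1 0 = real (Suc 2) * w 0"
      "\<forall>\<^sub>F t in nhds 0. L (velocity \<gamma> t) $ i3 = t ^ 2 * w1 t" by blast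
    from step[OF w1(1) w1(3)[unfolded numeral_2_eq_2] DL[OF s1]] obtain w2 where
      w2: "smooth_germ w2 0" "w2 0 = real (Suc 1) * w1 0" "\<forall>\<^sub>F t in nhds 0. L (velocity (velocity \<gamma>) t) $ i3 = t ^ 1 * w2 t"
      by auto
    from step[OF w2(1) w2(3)[unfolded One_nat_def] DL[OF s2]] obtain w3 where
      w3: "w3 0 = real (Suc 0) * w2 0" "\<forall>\<^sub>F t in nhds 0. L (velocity (velocity (velocity \<gamma>)) t) $ i3 = t ^ 0 * w3 t" by blast
    show ?thesis
      using eventually_nhds_x_imp_x[OF w1(3)] eventually_nhds_x_imp_x[OF w2(3)] eventually_nhds_x_imp_x[OF w3(2)]
        w(2) w1(2) w2(2) w3(1) by simp
  qed
  show ?thesis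
    unfolding indep3_def
  proof (intro allI impI)
    fix x y z assume 0: "x *\<^sub>R velocity \<gamma> 0 + y *\<^sub>R velocity (velocity \<gamma>) 0 + z *\<^sub>R velocity (velocity (velocity \<gamma>)) 0 = 0"
    have "x * L (velocity \<gamma> 0) $ i + y * L (velocity (velocity \<gamma>) 0) $ i + z * L (velocity (velocity (velocity \<gamma>)) 0) $ i = 0" for i
      using arg_cong[OF 0, of "\<lambda>v. L v $ i"] by (simp add: linear_add[OF L] linear_cmul[OF L] linear_0[OF L])
    from this[of i1] this[of i2] this[of i3] show "x = 0 \<and> y = 0 \<and> z = 0"
      using 1 2 3 by auto
  qed
qed

text \<open>
  The field \<open>X = \<partial>\<^sub>t - \<partial>\<^sub>u\<close> annihilates \<open>p = t + u\<close> and sends \<open>\<gamma>(t) + u \<gamma>'(t)\<close> to \<open>u \<gamma>''(t)\<close>.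
\<close>

lemma tangent_surface_cuspidal:
  fixes \<gamma> :: "real \<Rightarrow> real ^ 'm::{finite,linorder}"
  assumes m: "CARD('m) \<ge> 3" and \<gamma>: "curve_of_type \<gamma> l" "type_123 l"
  shows "A_equivalent (tangent_surface 1 \<gamma>) 0 cuspidal_edge_normal_form 0"
    and "smooth_germ (tangent_surface 1 \<gamma>) 0"
proof -
  let ?D = "\<lambda>h t. FD h t (1::real)"
  have \<gamma>s: "smooth_germ \<gamma> 0" using \<gamma>(1) by (simp add: curve_of_type_def)
  note \<gamma>1 = smooth_germ_FD[OF \<gamma>s, of 1]
  note \<gamma>2 = smooth_germ_FD[OF \<gamma>1, of 1]
  have vd: "\<forall>\<^sub>F t in nhds 0. vector_derivative \<gamma> (at t) = ?D \<gamma> t"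
    using smooth_germ_eventually[OF \<gamma>s]
  proof eventually_elim
    case (elim t)
    have "(\<gamma> has_derivative (\<lambda>x. x *\<^sub>R ?D \<gamma> t)) (at t)"
    proof (rule has_derivative_eq_rhs[OF smooth_germ_has_derivative[OF elim]], rule ext)
      show "FD \<gamma> t x = x *\<^sub>R ?D \<gamma> t" for x
        using linear_cmul[OF smooth_germ_linear_derivative[OF elim], of x 1] by simp
    qed
    then show ?case by (intro vector_derivative_at) (simp add: has_vector_derivative_def)
  qed
  have "((\<lambda>t. vector_derivative \<gamma> (at t)) \<longlongrightarrow> ?D \<gamma> 0) (at 0)"
  proof (rule Lim_transform_eventually)
    show "(?D \<gamma> \<longlongrightarrow> ?D \<gamma> 0) (at 0)" using smooth_germ_isCont[OF \<gamma>1] by (simp add: isCont_def)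
    show "\<forall>\<^sub>F t in at 0. ?D \<gamma> t = vector_derivative \<gamma> (at t)"
      using vd by (auto simp: eventually_at_filter elim!: eventually_mono)
  qed
  then have "Lim (at 0) (\<lambda>t. vector_derivative \<gamma> (at t)) = ?D \<gamma> 0" by (intro tendsto_Lim) auto
  with vd have td: "\<forall>\<^sub>F t in nhds 0. tangent_direction 1 \<gamma> t = ?D \<gamma> t"
    by (auto simp: tangent_direction_def elim!: eventually_mono)
  let ?f = "\<lambda>z :: real ^ 2. \<gamma> (z $ 1) + (z $ 2) *\<^sub>R ?D \<gamma> (z $ 1)"
  have ev1: "\<forall>\<^sub>F z :: real ^ 2 in nhds 0. R (z $ 1)" if "\<forall>\<^sub>F t in nhds 0. R t" for R :: "real \<Rightarrow> bool"
    using smooth_germ_eventually_compose[of "\<lambda>z :: real ^ 2. z $ 1" 0 R] that by (simp add: smooth_intros)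
  have eq: "\<forall>\<^sub>F z in nhds 0. ?f z = tangent_surface 1 \<gamma> z"
    using ev1[OF td] by eventually_elim (simp add: tangent_surface_def)
  have c1: "smooth_germ (\<lambda>z :: real ^ 2. h (z $ 1)) z"
    and d1: "FD (\<lambda>z :: real ^ 2. h (z $ 1)) z v = v $ 1 *\<^sub>R ?D h (z $ 1)"
    if h: "smooth_germ h (z $ 1)" for h :: "real \<Rightarrow> real ^ 'm::{finite,linorder}" and z v :: "real ^ 2"
  proof -
    have n: "smooth_germ (\<lambda>z :: real ^ 2. z $ 1) z" by (intro smooth_intros)
    show "smooth_germ (\<lambda>z :: real ^ 2. h (z $ 1)) z" by (rule smooth_germ_compose[where f = "\<lambda>z. z $ 1", OF h n])
    show "FD (\<lambda>z :: real ^ 2. h (z $ 1)) z v = v $ 1 *\<^sub>R ?D h (z $ 1)"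
      using FD_compose[where f = "\<lambda>z. z $ 1", OF h n]
        linear_cmul[OF smooth_germ_linear_derivative[OF h], of "v $ 1" 1] by simp
  qed
  have fs: "smooth_germ ?f 0"
    using c1[of \<gamma> 0] c1[of "?D \<gamma>" 0] \<gamma>s \<gamma>1 by (intro smooth_intros) simp_all
  then show ts: "smooth_germ (tangent_surface 1 \<gamma>) 0" by (rule smooth_germ_cong[OF eq])
  have df: "\<forall>\<^sub>F z in nhds 0. \<forall>v. FD (tangent_surface 1 \<gamma>) z v =
      v $ 1 *\<^sub>R ?D \<gamma> (z $ 1) + (z $ 2 * v $ 1) *\<^sub>R ?D (?D \<gamma>) (z $ 1) + v $ 2 *\<^sub>R ?D \<gamma> (z $ 1)"
    using eventually_FD_cong[OF eq] ev1[OF smooth_germ_eventually[OF \<gamma>s]]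
      ev1[OF smooth_germ_eventually[OF \<gamma>1]]
  proof eventually_elim
    case (elim z)
    show ?case unfolding elim(1)[symmetric]
      using c1[OF elim(2)] c1[OF elim(3)] d1[OF elim(2)] d1[OF elim(3)]
      by (simp add: FD_add FD_scaleR smooth_intros)
  qed
  show "A_equivalent (tangent_surface 1 \<gamma>) 0 cuspidal_edge_normal_form 0"
  proof (rule cuspidal_edge_recognition[OF m ts, where X = "\<lambda>z. pt 1 (- 1)" and p = "\<lambda>z. z $ 1 + z $ 2"
        and \<Lambda> = "\<lambda>z. z $ 2" and G = "\<lambda>z. ?D (?D \<gamma>) (z $ 1)" and w = "axis 1 1"])
    show "smooth_germ (\<lambda>z :: real ^ 2. ?D (?D \<gamma>) (z $ 1)) 0"
      using c1[of "?D (?D \<gamma>)" 0] \<gamma>2 by simp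
    show "\<forall>\<^sub>F z in nhds 0. FD (tangent_surface 1 \<gamma>) z (pt 1 (- 1)) = (z $ 2) *\<^sub>R ?D (?D \<gamma>) (z $ 1)"
      using df by eventually_elim simp
    have "FD (tangent_surface 1 \<gamma>) 0 (axis 1 1) = ?D \<gamma> 0"
      using eventually_nhds_x_imp_x[OF df] by (simp add: axis2_nth)
    moreover have "FD (\<lambda>z :: real ^ 2. ?D (?D \<gamma>) (z $ 1)) 0 (pt 1 (- 1)) = ?D (?D (?D \<gamma>)) 0"
      using d1[of "?D (?D \<gamma>)" 0] \<gamma>2 by simp
    ultimately show "indep3 (FD (tangent_surface 1 \<gamma>) 0 (axis 1 1)) (?D (?D \<gamma>) (0 $ 1))
       (FD (\<lambda>z :: real ^ 2. ?D (?D \<gamma>) (z $ 1)) 0 (pt 1 (- 1)))"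
      using curve_type_123_derivatives[OF m \<gamma>] by simp
  qed (auto simp: FD_add smooth_intros axis2_nth)
qed

text \<open>
  One implication requires a single curve, for which \<open>(t, t\<^sup>2, \<dots>, t\<^sup>m)\<close> is taken.
\<close>

lemma cuspidal_edge_iff_normal_form:
  fixes f :: "real ^ 2 \<Rightarrow> real ^ 'm::{finite,linorder}"
  assumes m: "CARD('m) \<ge> 3"
  shows "is_cuspidal_edge f a \<longleftrightarrow> A_equivalent f a cuspidal_edge_normal_form 0"
proof
  assume "is_cuspidal_edge f a"
  then show "A_equivalent f a cuspidal_edge_normal_form 0"
    unfolding is_cuspidal_edge_def using tangent_surface_cuspidal(1)[OF m] A_equivalent_trans by blast
next
  assume f: "A_equivalent f a cuspidal_edge_normal_form 0"
  let ?\<gamma> = "\<lambda>t. \<chi> i. t ^ pos i :: real ^ 'm::{finite,linorder}"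
  have \<gamma>: "curve_of_type ?\<gamma> pos"
    unfolding curve_of_type_def
  proof (intro conjI allI)
    show "smooth_germ ?\<gamma> 0" by (intro smooth_germ_vec_lambda smooth_germ_power smooth_germ_id)
    show "strict_mono (pos :: 'm::{finite,linorder} \<Rightarrow> nat)" by (auto intro: strict_monoI pos_less)
    have p1: "1 \<le> pos i" for i :: "'m::{finite,linorder}"
    proof -
      have "card {j. j \<le> i} > 0" by (subst card_gt_0_iff) auto
      then show ?thesis by (simp add: pos_def Suc_le_eq)
    qed
    then show "1 \<le> pos i" for i :: "'m::{finite,linorder}" .
    show "\<exists>L :: real ^ 'm::{finite,linorder} \<Rightarrow> real ^ 'm::{finite,linorder}. linear L \<and> bij L \<and> (\<forall>i. \<exists>r. smooth_germ r 0 \<and>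
        (\<forall>\<^sub>F t in nhds 0. L (?\<gamma> t - ?\<gamma> 0) $ i = t ^ pos i + t ^ Suc (pos i) * r t))"
    proof (rule exI[of _ id], intro conjI allI)
      fix i :: "'m::{finite,linorder}"
      have "pos i \<noteq> 0" using p1[of i] by simp
      then have "\<forall>\<^sub>F t in nhds 0. id (?\<gamma> t - ?\<gamma> 0) $ i = t ^ pos i + t ^ Suc (pos i) * 0"
        by (simp add: zero_power)
      then show "\<exists>r. smooth_germ r 0 \<and> (\<forall>\<^sub>F t in nhds 0.
          id (?\<gamma> t - ?\<gamma> 0) $ i = t ^ pos i + t ^ Suc (pos i) * r t)"
        by (intro exI[of _ "\<lambda>_. 0"] conjI smooth_germ_const)
    qed (auto simp: linear_id)
  qed
  moreover have t: "type_123 (pos :: 'm::{finite,linorder} \<Rightarrow> nat)" by (simp add: type_123_def)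
  moreover have "A_equivalent f a (tangent_surface 1 ?\<gamma>) 0"
    by (rule A_equivalent_trans[OF f A_equivalent_sym[OF tangent_surface_cuspidal[OF m \<gamma> t]]])
  ultimately show "is_cuspidal_edge f a" unfolding is_cuspidal_edge_def by blast
qed


section \<open>Iterated derivatives along a vector field\<close>

lemma smooth_germ_field_deriv [smooth_intros]:
  fixes h :: "real ^ 'n::finite \<Rightarrow> real"
  shows "smooth_germ h a \<Longrightarrow> smooth_germ \<eta> a \<Longrightarrow> smooth_germ (field_deriv \<eta> h) a"
  unfolding field_deriv_def by (rule smooth_germ_FD_field)

lemma eventually_field_deriv_cong:
  fixes h :: "real ^ 'n::finite \<Rightarrow> real"
  assumes "\<forall>\<^sub>F t in nhds a. h t = g t"
  shows "\<forall>\<^sub>F t in nhds a. field_deriv \<eta> h t = field_deriv \<eta> g t"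
  using eventually_FD_cong[OF assms] unfolding field_deriv_def by eventually_elim simp

lemma field_deriv_cong:
  fixes h :: "real ^ 'n::finite \<Rightarrow> real"
  assumes "\<forall>\<^sub>F t in nhds a. h t = g t"
  shows "field_deriv \<eta> h a = field_deriv \<eta> g a"
  by (rule eventually_nhds_x_imp_x[OF eventually_field_deriv_cong[OF assms]])

lemma field_deriv_mult:
  fixes h g :: "real ^ 'n::finite \<Rightarrow> real"
  assumes "smooth_germ h a" "smooth_germ g a"
  shows "field_deriv \<eta> (\<lambda>t. h t * g t) a = h a * field_deriv \<eta> g a + field_deriv \<eta> h a * g a"
  unfolding field_deriv_def by (rule FD_mult[OF assms])

lemma field_deriv_add:
  fixes h g :: "real ^ 'n::finite \<Rightarrow> real"
  assumes "smooth_germ h a" "smooth_germ g a"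
  shows "field_deriv \<eta> (\<lambda>t. h t + g t) a = field_deriv \<eta> h a + field_deriv \<eta> g a"
  unfolding field_deriv_def by (rule FD_add[OF assms])

lemma field_deriv_diff:
  fixes h g :: "real ^ 'n::finite \<Rightarrow> real"
  assumes "smooth_germ h a" "smooth_germ g a"
  shows "field_deriv \<eta> (\<lambda>t. h t - g t) a = field_deriv \<eta> h a - field_deriv \<eta> g a"
  unfolding field_deriv_def by (rule FD_diff[OF assms])

text \<open>
  Expanding by the Leibniz rule, all terms with an undifferentiated \<open>A\<close> or \<open>B\<close> vanish at \<open>a\<close>.
\<close>

lemma third_derivation:
  fixes \<phi> q1 q2 A B :: "real ^ 'n::finite \<Rightarrow> real"
  assumes sm: "smooth_germ \<eta> a" "smooth_germ q1 a" "smooth_germ q2 a" "smooth_germ A a" "smooth_germ B a"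
    and eq: "\<forall>\<^sub>F t in nhds a. field_deriv \<eta> \<phi> t = q1 t * A t + q2 t * B t"
    and 0: "A a = 0" "B a = 0"
  shows "field_deriv \<eta> \<phi> a = 0"
    and "field_deriv \<eta> (field_deriv \<eta> \<phi>) a = q1 a * field_deriv \<eta> A a + q2 a * field_deriv \<eta> B a"
    and "field_deriv \<eta> (field_deriv \<eta> (field_deriv \<eta> \<phi>)) a =
      2 * (field_deriv \<eta> q1 a * field_deriv \<eta> A a + field_deriv \<eta> q2 a * field_deriv \<eta> B a) +
      q1 a * field_deriv \<eta> (field_deriv \<eta> A) a + q2 a * field_deriv \<eta> (field_deriv \<eta> B) a"
proof -
  let ?d = "field_deriv \<eta>"
  show "?d \<phi> a = 0" using eventually_nhds_x_imp_x[OF eq] 0 by simp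
  let ?e = "\<lambda>t. (q1 t * ?d A t + ?d q1 t * A t) + (q2 t * ?d B t + ?d q2 t * B t)"
  have "\<forall>\<^sub>F t in nhds a. ?d (\<lambda>t. q1 t * A t + q2 t * B t) t = ?e t"
    using smooth_germ_eventually[OF sm(2)] smooth_germ_eventually[OF sm(3)]
      smooth_germ_eventually[OF sm(4)] smooth_germ_eventually[OF sm(5)]
    by eventually_elim (simp add: field_deriv_add field_deriv_mult smooth_germ_mult)
  with eventually_field_deriv_cong[OF eq, of \<eta>]
  have e: "\<forall>\<^sub>F t in nhds a. ?d (?d \<phi>) t = ?e t" by eventually_elim simp
  show "?d (?d \<phi>) a = q1 a * ?d A a + q2 a * ?d B a"
    using eventually_nhds_x_imp_x[OF e] 0 by simp
  have "?d (?d (?d \<phi>)) a = ?d ?e a" by (rule field_deriv_cong[OF e])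
  also have "\<dots> = 2 * (?d q1 a * ?d A a + ?d q2 a * ?d B a) + q1 a * ?d (?d A) a + q2 a * ?d (?d B) a"
    using sm 0 by (simp add: field_deriv_add field_deriv_mult smooth_germ_mult smooth_germ_add
        smooth_germ_field_deriv algebra_simps)
  finally show "?d (?d (?d \<phi>)) a = \<dots>" .
qed

lemma ord_along_eq_3:
  "ord_along \<eta> a h = 3 \<longleftrightarrow> h a = 0 \<and> field_deriv \<eta> h a = 0 \<and> field_deriv \<eta> (field_deriv \<eta> h) a = 0 \<and>
    field_deriv \<eta> (field_deriv \<eta> (field_deriv \<eta> h)) a \<noteq> 0"
proof -
  let ?d = "\<lambda>i. (field_deriv \<eta> ^^ i) h a"
  let ?A = "{i. ?d i \<noteq> 0}"
  have "ord_along \<eta> a h = 3 \<longleftrightarrow> 3 \<in> ?A \<and> (\<forall>i\<in>?A. 3 \<le> i)"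
  proof
    assume o: "ord_along \<eta> a h = 3"
    have ne: "?A \<noteq> {}"
    proof
      assume "?A = {}"
      then have "ord_along \<eta> a h = top" unfolding ord_along_def by (simp only: image_empty Inf_empty)
      then show False using o by (simp add: top_enat_def numeral_eq_enat)
    qed
    then have "Inf (enat ` ?A) \<in> enat ` ?A"
      using LeastI_ex[of "\<lambda>x. x \<in> enat ` ?A"] by (auto simp: Inf_enat_def)
    then have "3 \<in> enat ` ?A" using o by (simp add: ord_along_def)
    moreover have "\<forall>i\<in>?A. (3::enat) \<le> enat i"
      using o unfolding ord_along_def by (metis INF_lower)
    ultimately show "3 \<in> ?A \<and> (\<forall>i\<in>?A. 3 \<le> i)" by (auto simp: numeral_eq_enat)
  next
    assume "3 \<in> ?A \<and> (\<forall>i\<in>?A. 3 \<le> i)"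
    then have "3 \<in> ?A" "\<And>i. i \<in> ?A \<Longrightarrow> 3 \<le> i" by auto
    then show "ord_along \<eta> a h = 3"
      unfolding ord_along_def numeral_eq_enat by (intro antisym INF_greatest INF_lower) auto
  qed
  also have "\<dots> \<longleftrightarrow> ?d 3 \<noteq> 0 \<and> ?d 0 = 0 \<and> ?d 1 = 0 \<and> ?d 2 = 0"
  proof -
    have "(\<forall>i\<in>?A. 3 \<le> i) \<longleftrightarrow> (\<forall>i<3. ?d i = 0)" by (auto simp: not_less)
    also have "\<dots> \<longleftrightarrow> ?d 0 = 0 \<and> ?d 1 = 0 \<and> ?d 2 = 0"
      by (auto simp: numeral_3_eq_3 numeral_2_eq_2 less_Suc_eq)
    finally show ?thesis by simp
  qed
  finally show ?thesis by (auto simp: numeral_3_eq_3 numeral_2_eq_2)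
qed

text \<open>
  In a direction of the kernel of \<open>df(a)\<close> the base point \<open>f t\<close> is stationary to first order, so only the
  vector \<open>c t\<close> contributes to the derivative.
\<close>

lemma smooth_germ_derivative_along:
  fixes x :: "real ^ 'm \<Rightarrow> 'b::euclidean_space" and f c :: "'a::euclidean_space \<Rightarrow> real ^ 'm"
  assumes x: "smooth_germ x (f a)" and f: "smooth_germ f a" and c: "smooth_germ c a"
  shows "smooth_germ (\<lambda>t. FD x (f t) (c t)) a"
    and "FD f a k = 0 \<Longrightarrow>
      FD (\<lambda>t. FD x (f t) (c t)) a k =
      FD x (f a) (FD c a k)"
proof -
  let ?e = "\<lambda>t. \<Sum>b\<in>Basis. (c t \<bullet> b) *\<^sub>R FD x (f t) b"
  have ev: "\<forall>\<^sub>F t in nhds a. ?e t = FD x (f t) (c t)"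
    using smooth_germ_eventually_compose[OF f smooth_germ_eventually[OF x]]
    by eventually_elim (rule linear_sum_Basis[OF smooth_germ_linear_derivative])
  have D: "smooth_germ (\<lambda>t. FD x (f t) b) a" for b
    by (rule smooth_germ_compose[where g = "\<lambda>y. FD x y b", OF smooth_germ_FD[OF x] f])
  have "smooth_germ ?e a" by (intro smooth_intros D c)
  then show "smooth_germ (\<lambda>t. FD x (f t) (c t)) a"
    by (rule smooth_germ_cong[OF ev])
  assume k: "FD f a k = 0"
  have D0: "FD (\<lambda>t. FD x (f t) b) a k = 0" for b
    using FD_compose[where g = "\<lambda>y. FD x y b", OF smooth_germ_FD[OF x] f, of k]
      linear_0[OF smooth_germ_linear_derivative[OF smooth_germ_FD[OF x, of b]]] k by simp
  have "FD (\<lambda>t. FD x (f t) (c t)) a k = FD ?e a k"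
    using FD_cong_nhds[OF ev] by simp
  also have "\<dots> = (\<Sum>b\<in>Basis. (FD c a k \<bullet> b) *\<^sub>R FD x (f a) b)"
  proof -
    have "((\<lambda>t. \<Sum>b\<in>Basis. (c t \<bullet> b) *\<^sub>R FD x (f t) b) has_derivative
       (\<lambda>v. \<Sum>b\<in>Basis. FD (\<lambda>t. (c t \<bullet> b) *\<^sub>R FD x (f t) b) a v)) (at a)"
      by (intro has_derivative_sum smooth_germ_has_derivative smooth_intros D c)
    then have "FD ?e a k =
       (\<Sum>b\<in>Basis. FD (\<lambda>t. (c t \<bullet> b) *\<^sub>R FD x (f t) b) a k)"
      by (simp add: FD_eqI)
    also have "\<dots> = (\<Sum>b\<in>Basis. (FD c a k \<bullet> b) *\<^sub>R FD x (f a) b)"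
    proof (rule sum.cong[OF refl])
      fix b
      have cb: "smooth_germ (\<lambda>t. c t \<bullet> b) a" by (intro smooth_intros c)
      show "FD (\<lambda>t. (c t \<bullet> b) *\<^sub>R FD x (f t) b) a k =
          (FD c a k \<bullet> b) *\<^sub>R FD x (f a) b"
        using FD_scaleR[OF cb D[of b], of k] D0[of b]
          FD_bounded_linear[OF bounded_linear_inner_left c, of b k] by simp
    qed
    finally show ?thesis .
  qed
  also have "\<dots> = FD x (f a) (FD c a k)"
    by (rule linear_sum_Basis[OF smooth_germ_linear_derivative[OF x]])
  finally show "FD (\<lambda>t. FD x (f t) (c t)) a k =
      FD x (f a) (FD c a k)" .
qed

lemma diffeo_germ_bij_derivative:
  assumes "diffeo_germ s a a'"
  shows "bij (FD s a)"
proof -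
  obtain r where r: "diffeo_germ r a' a" "\<forall>\<^sub>F t in nhds a. r (s t) = t" "\<forall>\<^sub>F t in nhds a'. s (r t) = t"
    using assms by (rule diffeo_germE)
  have s: "smooth_germ s a" "s a = a'" and r': "smooth_germ r a'" "r a' = a"
    using assms r(1) by (auto simp: diffeo_germ_def)
  have "FD r a' (FD s a v) = v" for v
    using FD_compose[of r s a v] s r' FD_cong_nhds[OF r(2)]
    by (simp add: frechet_derivative_ident)
  moreover have "FD s a (FD r a' v) = v" for v
    using FD_compose[of s r a' v] s r' FD_cong_nhds[OF r(3)]
    by (simp add: frechet_derivative_ident)
  ultimately show ?thesis by (intro o_bij[of "FD r a'"]) (auto simp: fun_eq_iff)
qed

section \<open>Frontals in a chart of the Grassmannian\<close>

text \<open>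
  A frontal germ in a chart of the Grassmannian. The columns of \<open>M\<close> span the plane of the lift, and its
  rows selected by \<open>s\<close> form the identity matrix; therefore the coefficients of \<open>df\<close> with respect to the
  columns are the differentials of the components \<open>P\<close> and \<open>Q\<close> of \<open>f\<close> selected by \<open>s\<close>. The function \<open>Lam\<close>
  is the Jacobian determinant of \<open>(P, Q)\<close>.
\<close>

locale plane_frame =
  fixes f :: "real ^ 2 \<Rightarrow> real ^ 'm::{finite,linorder}" and a :: "real ^ 2"
    and s :: "2 \<Rightarrow> 'm::{finite,linorder}" and M :: "real ^ 2 \<Rightarrow> real ^ 2 ^ 'm::{finite,linorder}"
  assumes f: "smooth_germ f a" and M: "smooth_germ M a" and inj_s: "inj s"
    and rows: "\<forall>\<^sub>F t in nhds a. \<forall>j. M t $ s j = axis j 1"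
    and factor: "\<forall>\<^sub>F t in nhds a. \<forall>v. FD f t v =
      (FD f t v $ s 1) *\<^sub>R column 1 (M t) + (FD f t v $ s 2) *\<^sub>R column 2 (M t)"
begin

definition P :: "real ^ 2 \<Rightarrow> real" where "P t = f t $ s 1"
definition Q :: "real ^ 2 \<Rightarrow> real" where "Q t = f t $ s 2"
definition C :: "2 \<Rightarrow> real ^ 2 \<Rightarrow> real ^ 'm::{finite,linorder}" where "C j t = column j (M t)"
definition dP :: "real ^ 2 \<Rightarrow> real ^ 2 \<Rightarrow> real" where "dP v t = FD P t v"
definition dQ :: "real ^ 2 \<Rightarrow> real ^ 2 \<Rightarrow> real" where "dQ v t = FD Q t v"
definition Lam :: "real ^ 2 \<Rightarrow> real" where
  "Lam t = dP (axis 1 1) t * dQ (axis 2 1) t - dP (axis 2 1) t * dQ (axis 1 1) t"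

lemma P: "smooth_germ P a" and Q: "smooth_germ Q a" and C: "smooth_germ (C j) a"
  unfolding P_def[abs_def] Q_def[abs_def] C_def[abs_def] column_def by (intro smooth_intros f M)+

lemma dPs: "smooth_germ (dP v) a" and dQs: "smooth_germ (dQ v) a"
  unfolding dP_def[abs_def] dQ_def[abs_def] by (intro smooth_intros P Q)+

lemma Lam: "smooth_germ Lam a"
  unfolding Lam_def[abs_def] by (intro smooth_intros dPs dQs)

lemma df: "\<forall>\<^sub>F t in nhds a. \<forall>v. FD f t v = dP v t *\<^sub>R C 1 t + dQ v t *\<^sub>R C 2 t"
  using factor smooth_germ_eventually[OF f]
proof eventually_elim
  case (elim t)
  then show ?case
    by (simp add: dP_def dQ_def C_def P_def[abs_def] Q_def[abs_def] FD_vec_nth)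
qed

lemma df_at: "FD f a v = dP v a *\<^sub>R C 1 a + dQ v a *\<^sub>R C 2 a"
  using eventually_nhds_x_imp_x[OF df] by blast

lemma C_rows: "\<forall>\<^sub>F t in nhds a. C j t $ s i = (if i = j then 1 else 0)"
  using rows by eventually_elim (auto simp: C_def column_def axis_def)

lemma C_rows_at: "C j a $ s i = (if i = j then 1 else 0)"
  by (rule eventually_nhds_x_imp_x[OF C_rows])

lemma dC_rows: "FD (C j) a v $ s i = 0"
proof -
  have "FD (C j) a v $ s i = FD (\<lambda>t. C j t $ s i) a v"
    by (rule FD_vec_nth[OF C, symmetric])
  also have "\<dots> = 0"
    using FD_cong_nhds[OF C_rows[of j i]] by (simp add: frechet_derivative_const)
  finally show ?thesis .
qed

lemma dP_linear: "linear (\<lambda>v. dP v a)" and dQ_linear: "linear (\<lambda>v. dQ v a)"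
  unfolding dP_def dQ_def
  using smooth_germ_linear_derivative[OF P] smooth_germ_linear_derivative[OF Q] by simp_all

text \<open>
  The identity \<open>dP \<and> dQ = Lam dt\<^sub>1 \<and> dt\<^sub>2\<close>.
\<close>

lemma wedge:
  "\<forall>\<^sub>F t in nhds a. \<forall>v w. dP v t * dQ w t - dQ v t * dP w t = Lam t * (v $ 1 * w $ 2 - v $ 2 * w $ 1)"
  using smooth_germ_eventually[OF P] smooth_germ_eventually[OF Q]
proof eventually_elim
  case (elim t)
  note l = smooth_germ_linear_derivative[OF elim(1)] smooth_germ_linear_derivative[OF elim(2)]
  have e: "dP v t = v $ 1 * dP (axis 1 1) t + v $ 2 * dP (axis 2 1) t"
    "dQ v t = v $ 1 * dQ (axis 1 1) t + v $ 2 * dQ (axis 2 1) t" for v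
    using linear_add[OF l(1), of "(v $ 1) *\<^sub>R axis 1 1" "(v $ 2) *\<^sub>R axis 2 1"]
      linear_add[OF l(2), of "(v $ 1) *\<^sub>R axis 1 1" "(v $ 2) *\<^sub>R axis 2 1"]
      linear_cmul[OF l(1)] linear_cmul[OF l(2)]
    by (simp_all add: dP_def dQ_def flip: pt_def)
  show ?case
  proof (intro allI)
    fix v w
    show "dP v t * dQ w t - dQ v t * dP w t = Lam t * (v $ 1 * w $ 2 - v $ 2 * w $ 1)"
      unfolding e[of v] e[of w] Lam_def by (simp add: algebra_simps)
  qed
qed

lemma kernel_iff: "FD f a v = 0 \<longleftrightarrow> dP v a = 0 \<and> dQ v a = 0"
proof
  assume "FD f a v = 0"
  then have "(dP v a *\<^sub>R C 1 a + dQ v a *\<^sub>R C 2 a) $ s i = 0" for i using df_at by simp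
  from this[of 1] this[of 2] show "dP v a = 0 \<and> dQ v a = 0" by (simp add: C_rows_at)
qed (simp add: df_at)

lemma immersive_iff:
  assumes k: "FD f a k = 0" "k \<noteq> 0"
    and line: "\<And>v. FD f a v = 0 \<Longrightarrow> \<exists>r. v = r *\<^sub>R k"
  shows "inj (FD (\<lambda>t. (f t, M t)) a) \<longleftrightarrow> (\<exists>j. FD (C j) a k \<noteq> 0)"
proof -
  have d: "FD (\<lambda>t. (f t, M t)) a = (\<lambda>v. (FD f a v, FD M a v))"
    by (intro FD_eqI has_derivative_Pair smooth_germ_has_derivative f M)
  have lin: "linear (FD (\<lambda>t. (f t, M t)) a)"
    unfolding d using smooth_germ_linear_derivative[OF f] smooth_germ_linear_derivative[OF M]
    by (auto intro!: linearI simp: linear_add linear_cmul)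
  have C_nth: "FD (C j) a k $ i = FD M a k $ i $ j" for i j
  proof -
    have Mi: "smooth_germ (\<lambda>t. M t $ i) a" by (intro smooth_intros M)
    have "FD (C j) a k $ i = FD (\<lambda>t. C j t $ i) a k"
      by (rule FD_vec_nth[OF C, symmetric])
    also have "\<dots> = FD (\<lambda>t. M t $ i $ j) a k" by (simp add: C_def column_def)
    also have "\<dots> = FD M a k $ i $ j"
      by (simp add: FD_vec_nth[OF Mi] FD_vec_nth[OF M])
    finally show ?thesis .
  qed
  have "inj (FD (\<lambda>t. (f t, M t)) a) \<longleftrightarrow> FD M a k \<noteq> 0"
    unfolding linear_injective_0[OF lin] unfolding d
  proof
    assume "\<forall>x. (FD f a x, FD M a x) = 0 \<longrightarrow> x = 0"
    then show "FD M a k \<noteq> 0" using k by (auto simp: zero_prod_def)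
  next
    assume Mk: "FD M a k \<noteq> 0"
    show "\<forall>x. (FD f a x, FD M a x) = 0 \<longrightarrow> x = 0"
    proof (intro allI impI)
      fix x assume x: "(FD f a x, FD M a x) = 0"
      then obtain r where r: "x = r *\<^sub>R k" using line[of x] by (auto simp: zero_prod_def)
      then have "r *\<^sub>R FD M a k = 0"
        using x linear_cmul[OF smooth_germ_linear_derivative[OF M], of r k] by (simp add: zero_prod_def)
      then show "x = 0" using Mk r by simp
    qed
  qed
  also have "\<dots> \<longleftrightarrow> (\<exists>j. FD (C j) a k \<noteq> 0)"
    by (auto simp: vec_eq_iff C_nth)
  finally show ?thesis .
qed

text \<open>
  The exterior derivative of \<open>df = C\<^sub>1 dP + C\<^sub>2 dQ\<close> vanishes. Evaluated on \<open>(k, w)\<close> at \<open>a\<close>, where \<open>k\<close> is in the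
  kernel of \<open>dP\<close> and \<open>dQ\<close>, this is the stated relation.
\<close>

lemma integrability:
  assumes k: "FD f a k = 0"
  shows "dP w a *\<^sub>R FD (C 1) a k + dQ w a *\<^sub>R FD (C 2) a k = 0"
proof -
  have along: "\<forall>\<^sub>F t in nhds a. FD f t v = dP v t *\<^sub>R C 1 t + dQ v t *\<^sub>R C 2 t" for v
    using df by eventually_elim simp
  have D: "FD (\<lambda>t. FD f t v) a u =
      (dP v a *\<^sub>R FD (C 1) a u + FD (dP v) a u *\<^sub>R C 1 a) +
      (dQ v a *\<^sub>R FD (C 2) a u + FD (dQ v) a u *\<^sub>R C 2 a)" for u v
    using FD_cong_nhds[OF along[of v]]
    by (simp add: FD_add FD_scaleR smooth_germ_scaleR dPs dQs C)
  have "FD (dP w) a k = FD (dP k) a w"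
    "FD (dQ w) a k = FD (dQ k) a w"
    unfolding dP_def[abs_def] dQ_def[abs_def] by (rule second_derivative_commute P Q)+
  moreover have "FD (\<lambda>t. FD f t w) a k =
      FD (\<lambda>t. FD f t k) a w"
    by (rule second_derivative_commute[OF f])
  moreover have "dP k a = 0" "dQ k a = 0" using k kernel_iff by auto
  ultimately show ?thesis unfolding D by (simp add: algebra_simps)
qed

text \<open>
  The derivative of \<open>\<phi>\<close> along \<open>\<eta>\<close> is \<open>q\<^sub>1 \<eta>P + q\<^sub>2 \<eta>Q\<close>, where \<open>q\<^sub>j\<close> is the \<open>i\<close>-th coordinate of \<open>dx(C\<^sub>j)\<close>, and
  \<open>\<eta>P\<close>, \<open>\<eta>Q\<close> vanish at \<open>a\<close>. So \<open>third_derivation\<close> applies.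
\<close>

lemma coordinate_derivations:
  fixes x :: "real ^ 'm::{finite,linorder} \<Rightarrow> real ^ 'm::{finite,linorder}" and i :: "'m::{finite,linorder}"
  assumes \<eta>: "smooth_germ \<eta> a" and k: "FD f a (\<eta> a) = 0" and x: "smooth_germ x (f a)"
  defines "\<phi> \<equiv> \<lambda>t. x (f t) $ i" and "l \<equiv> \<lambda>v. FD x (f a) v $ i"
    and "d \<equiv> field_deriv \<eta>"
  shows "d \<phi> a = 0"
    and "d (d \<phi>) a = l (C 1 a) * d (d P) a + l (C 2 a) * d (d Q) a"
    and "d (d (d \<phi>)) a =
      2 * (l (FD (C 1) a (\<eta> a)) * d (d P) a + l (FD (C 2) a (\<eta> a)) * d (d Q) a) +
      l (C 1 a) * d (d (d P)) a + l (C 2 a) * d (d (d Q)) a"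
proof -
  let ?q = "\<lambda>j t. FD x (f t) (C j t)"
  note qs = smooth_germ_derivative_along(1)[where x = x, OF x f C]
  have q: "smooth_germ (\<lambda>t. ?q j t $ i) a" for j by (intro smooth_intros qs)
  have dq: "d (\<lambda>t. ?q j t $ i) a = l (FD (C j) a (\<eta> a))" for j
    unfolding d_def field_deriv_def l_def FD_vec_nth[OF qs]
    by (subst smooth_germ_derivative_along(2)[where x = x, OF x f C k]) (rule refl)
  have eq: "\<forall>\<^sub>F t in nhds a. d \<phi> t = ?q 1 t $ i * d P t + ?q 2 t $ i * d Q t"
    using df smooth_germ_eventually[OF f] smooth_germ_eventually_compose[OF f smooth_germ_eventually[OF x]]
  proof eventually_elim
    case (elim t)
    note lx = smooth_germ_linear_derivative[OF elim(3)]
    have xf: "smooth_germ (\<lambda>t. x (f t)) t" by (rule smooth_germ_compose[where g = x and f = f, OF elim(3,2)])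
    have "d \<phi> t = FD x (f t) (FD f t (\<eta> t)) $ i"
      unfolding d_def field_deriv_def \<phi>_def FD_vec_nth[OF xf]
      by (subst FD_compose[where g = x and f = f, OF elim(3,2)]) (rule refl)
    also have "\<dots> = ?q 1 t $ i * d P t + ?q 2 t $ i * d Q t"
      using elim(1) by (simp add: linear_add[OF lx] linear_cmul[OF lx] d_def field_deriv_def dP_def dQ_def)
    finally show ?case .
  qed
  have 0: "d P a = 0" "d Q a = 0"
    using k kernel_iff[of "\<eta> a"] by (auto simp: d_def field_deriv_def dP_def dQ_def)
  have sm: "smooth_germ (d P) a" "smooth_germ (d Q) a" unfolding d_def by (intro smooth_intros P Q \<eta>)+
  note * = third_derivation[OF \<eta> q q sm[unfolded d_def] eq[unfolded d_def] 0[unfolded d_def]]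
  show "d \<phi> a = 0" unfolding d_def by (rule *(1))
  show "d (d \<phi>) a = l (C 1 a) * d (d P) a + l (C 2 a) * d (d Q) a"
    unfolding d_def l_def by (rule *(2))
  show "d (d (d \<phi>)) a =
      2 * (l (FD (C 1) a (\<eta> a)) * d (d P) a + l (FD (C 2) a (\<eta> a)) * d (d Q) a) +
      l (C 1 a) * d (d (d P)) a + l (C 2 a) * d (d (d Q)) a"
    using *(3) dq unfolding d_def l_def by simp
qed

text \<open>
  Apply \<open>wedge\<close> to \<open>\<eta>\<close> and \<open>w\<close> and differentiate along \<open>\<eta>\<close>; the functions \<open>\<eta>P\<close>, \<open>\<eta>Q\<close> and \<open>Lam\<close> vanish at \<open>a\<close>.
\<close>

lemma Lam_derivative:
  assumes \<eta>: "smooth_germ \<eta> a" and k: "FD f a (\<eta> a) = 0" and Lam0: "Lam a = 0"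
  shows "field_deriv \<eta> Lam a * (\<eta> a $ 1 * w $ 2 - \<eta> a $ 2 * w $ 1) =
    field_deriv \<eta> (field_deriv \<eta> P) a * dQ w a - field_deriv \<eta> (field_deriv \<eta> Q) a * dP w a"
proof -
  let ?d = "field_deriv \<eta>"
  have sm: "smooth_germ (?d P) a" "smooth_germ (?d Q) a" by (intro smooth_intros P Q \<eta>)+
  have 0: "?d P a = 0" "?d Q a = 0"
    using k kernel_iff[of "\<eta> a"] by (auto simp: field_deriv_def dP_def dQ_def)
  have "\<forall>\<^sub>F t in nhds a. ?d P t * dQ w t - ?d Q t * dP w t = Lam t * (\<eta> t $ 1 * w $ 2 - \<eta> t $ 2 * w $ 1)"
    using wedge by eventually_elim (simp add: field_deriv_def flip: dP_def dQ_def)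
  from field_deriv_cong[OF this, of \<eta>] show ?thesis
    using 0 Lam0
    by (simp add: field_deriv_diff field_deriv_mult smooth_intros sm dPs dQs Lam \<eta>)
qed

end


section \<open>Jacobi ideal and kernel fields\<close>

lemma corank_1E:
  fixes f :: "real ^ 2 \<Rightarrow> real ^ 'm"
  assumes f: "smooth_germ f a" and "corank f a = 1"
  obtains k w where "k \<noteq> 0" "FD f a k = 0" "FD f a w \<noteq> 0"
    "\<And>v. FD f a v = 0 \<Longrightarrow> \<exists>r. v = r *\<^sub>R k"
proof -
  let ?V = "{v. FD f a v = 0}"
  obtain B where B: "B \<subseteq> ?V" "independent B" "?V \<subseteq> span B" "card B = dim ?V"
    using basis_exists by blast
  then have "card B = 1" using assms(2) by (simp add: corank_def)
  then obtain k where k: "B = {k}" by (rule card_1_singletonE)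
  have "?V \<noteq> UNIV"
  proof
    assume "?V = UNIV"
    then have "dim (UNIV :: (real ^ 2) set) = 1" using assms(2) by (simp add: corank_def)
    then show False by simp
  qed
  then obtain w where w: "FD f a w \<noteq> 0" by blast
  show ?thesis
  proof (rule that[OF _ _ w])
    show "k \<noteq> 0" using B(2) k by (metis dependent_zero singletonI)
    show "FD f a k = 0" using B(1) k by simp
    show "\<exists>r. v = r *\<^sub>R k" if "FD f a v = 0" for v
    proof -
      have "v \<in> span {k}" using that B(3) k by auto
      then show ?thesis by (auto simp: span_singleton)
    qed
  qed
qed

lemma det_ne_0_not_parallel:
  fixes k w :: "real ^ 2"
  assumes "k \<noteq> 0" "\<And>r. w \<noteq> r *\<^sub>R k"
  shows "k $ 1 * w $ 2 - k $ 2 * w $ 1 \<noteq> 0"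
proof
  assume 0: "k $ 1 * w $ 2 - k $ 2 * w $ 1 = 0"
  let ?n = "k $ 1 * k $ 1 + k $ 2 * k $ 2"
  have n: "?n \<noteq> 0" using assms(1) by (auto simp: vec_eq_iff forall_2 add_nonneg_eq_0_iff)
  have "?n * w $ 1 = (k $ 1 * w $ 1 + k $ 2 * w $ 2) * k $ 1"
    using 0 by algebra
  moreover have "?n * w $ 2 = (k $ 1 * w $ 1 + k $ 2 * w $ 2) * k $ 2"
    using 0 by algebra
  ultimately have "w = ((k $ 1 * w $ 1 + k $ 2 * w $ 2) / ?n) *\<^sub>R k"
    using n by (simp add: vec_eq_iff forall_2 field_simps)
  then show False using assms(2) by blast
qed

lemma germ_ideal_self: "smooth_germ l a \<Longrightarrow> l \<in> germ_ideal a {l}"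
  unfolding germ_ideal_def
  by (auto intro!: exI[of _ "{l}"] exI[of _ "\<lambda>_ _. 1"] smooth_germ_const)

context plane_frame
begin

text \<open>
  Every minor of \<open>df = M d(P, Q)\<close> is the corresponding minor of \<open>M\<close> times \<open>Lam\<close>; with the next lemma, \<open>Lam\<close>
  generates the Jacobi ideal.
\<close>

lemma minor_eq:
  "\<forall>\<^sub>F t in nhds a. det (\<chi> i. jacobian f (at t) $ s' i) =
    (C 1 t $ s' 1 * C 2 t $ s' 2 - C 2 t $ s' 1 * C 1 t $ s' 2) * Lam t"
  using df
proof eventually_elim
  case (elim t)
  then show ?case
    by (simp add: det_2 jacobian_def matrix_def Lam_def algebra_simps)
qed

lemma Lam_eq_minor: "\<forall>\<^sub>F t in nhds a. Lam t = det (\<chi> i. jacobian f (at t) $ s i)"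
  using minor_eq[of s] C_rows[of 1 1] C_rows[of 1 2] C_rows[of 2 1] C_rows[of 2 2]
  by eventually_elim simp

lemma in_jacobi_idealI:
  assumes "smooth_germ h a" "smooth_germ u a" "\<forall>\<^sub>F t in nhds a. h t = u t * Lam t"
  shows "h \<in> jacobi_ideal f a"
  unfolding jacobi_ideal_def germ_ideal_def
proof (intro CollectI conjI exI)
  let ?g = "\<lambda>t. det (\<chi> i. jacobian f (at t) $ s i)"
  show "smooth_germ h a" by fact
  show "finite {?g}" by simp
  show "{?g} \<subseteq> {(\<lambda>t. det (\<chi> i. jacobian f (at t) $ s i)) | s. inj s}" using inj_s by blast
  show "\<forall>g\<in>{?g}. smooth_germ u a" using assms(2) by blast
  show "\<forall>\<^sub>F t in nhds a. h t = (\<Sum>g\<in>{?g}. u t * g t)"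
    using assms(3) Lam_eq_minor by eventually_elim simp
qed

lemma in_jacobi_idealE:
  assumes "h \<in> jacobi_ideal f a"
  obtains u where "smooth_germ u a" "\<forall>\<^sub>F t in nhds a. h t = u t * Lam t"
proof -
  obtain S c where S: "finite S" "S \<subseteq> {(\<lambda>t. det (\<chi> i. jacobian f (at t) $ s i)) | s. inj s}"
    "\<And>g. g \<in> S \<Longrightarrow> smooth_germ (c g) a" "\<forall>\<^sub>F t in nhds a. h t = (\<Sum>g\<in>S. c g t * g t)"
    using assms unfolding jacobi_ideal_def germ_ideal_def by blast
  have "\<exists>m. smooth_germ m a \<and> (\<forall>\<^sub>F t in nhds a. g t = m t * Lam t)" if g: "g \<in> S" for g
  proof -
    obtain s' where "g = (\<lambda>t. det (\<chi> i. jacobian f (at t) $ s' i))" using S(2) g by blast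
    then show ?thesis
      using minor_eq[of s']
      by (intro exI[of _ "\<lambda>t. C 1 t $ s' 1 * C 2 t $ s' 2 - C 2 t $ s' 1 * C 1 t $ s' 2"])
        (auto intro!: smooth_intros C)
  qed
  then have "\<exists>m. \<forall>g\<in>S. smooth_germ (m g) a \<and> (\<forall>\<^sub>F t in nhds a. g t = m g t * Lam t)"
    by (intro bchoice ballI)
  then obtain m where m: "\<And>g. g \<in> S \<Longrightarrow> smooth_germ (m g) a"
    "\<And>g. g \<in> S \<Longrightarrow> \<forall>\<^sub>F t in nhds a. g t = m g t * Lam t" by blast
  show ?thesis
  proof (rule that[of "\<lambda>t. \<Sum>g\<in>S. c g t * m g t"])
    show "smooth_germ (\<lambda>t. \<Sum>g\<in>S. c g t * m g t) a"
      by (intro smooth_germ_sum smooth_germ_mult S m)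
    have "\<forall>\<^sub>F t in nhds a. \<forall>g\<in>S. g t = m g t * Lam t"
      by (intro eventually_ball_finite S ballI m)
    with S(4) show "\<forall>\<^sub>F t in nhds a. h t = (\<Sum>g\<in>S. c g t * m g t) * Lam t"
      by eventually_elim (simp add: sum_distrib_right mult.assoc)
  qed
qed

lemma Lam_at:
  assumes "FD f a k = 0" "k \<noteq> 0"
  shows "Lam a = 0"
proof -
  have "dP k a = 0" "dQ k a = 0" using assms(1) kernel_iff by auto
  then have "Lam a * (k $ 1 * k $ 1 + k $ 2 * k $ 2) = 0"
    using spec[OF spec[OF eventually_nhds_x_imp_x[OF wedge], of k], of "pt (- k $ 2) (k $ 1)"] by simp
  moreover have "k $ 1 * k $ 1 + k $ 2 * k $ 2 \<noteq> 0"
    using assms(2) by (auto simp: vec_eq_iff forall_2 add_nonneg_eq_0_iff)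
  ultimately show ?thesis using mult_eq_0_iff by blast
qed

text \<open>
  The germs \<open>lam\<close> and \<open>Lam\<close> are multiples of each other and vanish at \<open>a\<close>, so their differentials at \<open>a\<close>
  are multiples of each other too.
\<close>

lemma jacobian_derivative:
  assumes lam: "is_jacobian f a lam" and Lam0: "Lam a = 0"
  shows "lam a = 0" and "FD lam a k \<noteq> 0 \<longleftrightarrow> FD Lam a k \<noteq> 0"
proof -
  have ls: "smooth_germ lam a" and id: "germ_ideal a {lam} = jacobi_ideal f a"
    using lam by (auto simp: is_jacobian_def)
  have "lam \<in> jacobi_ideal f a" using germ_ideal_self[OF ls] id by simp
  then obtain u where u: "smooth_germ u a" "\<forall>\<^sub>F t in nhds a. lam t = u t * Lam t"
    by (rule in_jacobi_idealE)
  show l0: "lam a = 0" using eventually_nhds_x_imp_x[OF u(2)] Lam0 by simp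
  have "Lam \<in> germ_ideal a {lam}"
    unfolding id by (rule in_jacobi_idealI[OF Lam smooth_germ_const[of 1]]) simp
  then obtain S c where S: "S \<subseteq> {lam}" "\<And>g. g \<in> S \<Longrightarrow> smooth_germ (c g) a"
    "\<forall>\<^sub>F t in nhds a. Lam t = (\<Sum>g\<in>S. c g t * g t)"
    unfolding germ_ideal_def by blast
  have "\<exists>v. smooth_germ v a \<and> (\<forall>\<^sub>F t in nhds a. Lam t = v t * lam t)"
  proof (cases "S = {}")
    case True
    then show ?thesis using S(3) by (intro exI[of _ "\<lambda>_. 0"]) (auto intro: smooth_germ_const)
  next
    case False
    then have "S = {lam}" using S(1) by blast
    then show ?thesis using S(2,3) by (intro exI[of _ "c lam"]) auto
  qed
  then obtain v where v: "smooth_germ v a" "\<forall>\<^sub>F t in nhds a. Lam t = v t * lam t" by blast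
  have "FD lam a k = u a * FD Lam a k"
    using FD_cong_nhds[OF u(2)] by (simp add: FD_mult u Lam Lam0)
  moreover have "FD Lam a k = v a * FD lam a k"
    using FD_cong_nhds[OF v(2)] by (simp add: FD_mult v ls l0)
  ultimately show "FD lam a k \<noteq> 0 \<longleftrightarrow> FD Lam a k \<noteq> 0"
    by auto
qed

text \<open>
  The adjugate of the Jacobi matrix of \<open>(P, Q)\<close> applied to the constant vector \<open>(e1, e2)\<close>. Its image under
  that matrix is \<open>Lam (e1, e2)\<close>.
\<close>

definition X :: "real \<Rightarrow> real \<Rightarrow> real ^ 2 \<Rightarrow> real ^ 2" where
  "X e1 e2 t = pt (e1 * dQ (axis 2 1) t - e2 * dP (axis 2 1) t) (e2 * dP (axis 1 1) t - e1 * dQ (axis 1 1) t)"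

lemma smooth_germ_X: "smooth_germ (X e1 e2) a"
  unfolding X_def[abs_def] by (intro smooth_intros dPs dQs)

lemma X_derivatives:
  "\<forall>\<^sub>F t in nhds a. dP (X e1 e2 t) t = e1 * Lam t \<and> dQ (X e1 e2 t) t = e2 * Lam t"
  using smooth_germ_eventually[OF P] smooth_germ_eventually[OF Q]
proof eventually_elim
  case (elim t)
  note l = smooth_germ_linear_derivative[OF elim(1)] smooth_germ_linear_derivative[OF elim(2)]
  have "dP (pt x y) t = x * dP (axis 1 1) t + y * dP (axis 2 1) t"
    "dQ (pt x y) t = x * dQ (axis 1 1) t + y * dQ (axis 2 1) t" for x y
    by (simp_all add: pt_def dP_def dQ_def linear_add[OF l(1)] linear_cmul[OF l(1)]
        linear_add[OF l(2)] linear_cmul[OF l(2)])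
  then show ?case by (simp add: X_def Lam_def algebra_simps)
qed

lemma X_f: "\<forall>\<^sub>F t in nhds a. FD f t (X e1 e2 t) = Lam t *\<^sub>R (e1 *\<^sub>R C 1 t + e2 *\<^sub>R C 2 t)"
  using df X_derivatives[of e1 e2] by eventually_elim (simp add: algebra_simps)

lemma X_in_kernel_module: "X e1 e2 \<in> kernel_module f a"
  unfolding kernel_module_def
proof (intro CollectI conjI allI)
  show "smooth_germ (X e1 e2) a" by (rule smooth_germ_X)
  fix i
  show "field_deriv (X e1 e2) (\<lambda>t. f t $ i) \<in> jacobi_ideal f a"
  proof (rule in_jacobi_idealI)
    show "smooth_germ (field_deriv (X e1 e2) (\<lambda>t. f t $ i)) a"
      by (intro smooth_intros f smooth_germ_X)
    show "smooth_germ (\<lambda>t. e1 * C 1 t $ i + e2 * C 2 t $ i) a"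
      by (intro smooth_intros C)
    show "\<forall>\<^sub>F t in nhds a. field_deriv (X e1 e2) (\<lambda>t. f t $ i) t = (e1 * C 1 t $ i + e2 * C 2 t $ i) * Lam t"
      using X_f[of e1 e2] smooth_germ_eventually[OF f]
      by eventually_elim (simp add: field_deriv_def FD_vec_nth)
  qed
qed

text \<open>
  Up to a rotation by a right angle, \<open>X e1 e2\<close> is the gradient of \<open>e1 Q - e2 P\<close>.
\<close>

lemma X_ne_0:
  assumes "e1 * dQ w a - e2 * dP w a \<noteq> 0"
  shows "X e1 e2 a \<noteq> 0"
proof
  assume 0: "X e1 e2 a = 0"
  have "w = (w $ 1) *\<^sub>R axis 1 1 + (w $ 2) *\<^sub>R axis 2 1" by (simp flip: pt_def)
  then have "e1 * dQ w a - e2 * dP w a = w $ 1 * (e1 * dQ (axis 1 1) a - e2 * dP (axis 1 1) a) +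
      w $ 2 * (e1 * dQ (axis 2 1) a - e2 * dP (axis 2 1) a)"
    using linear_add[OF dP_linear, of "(w $ 1) *\<^sub>R axis 1 1" "(w $ 2) *\<^sub>R axis 2 1"]
      linear_add[OF dQ_linear, of "(w $ 1) *\<^sub>R axis 1 1" "(w $ 2) *\<^sub>R axis 2 1"]
      linear_cmul[OF dP_linear] linear_cmul[OF dQ_linear] by (simp add: algebra_simps)
  also have "\<dots> = 0"
    using arg_cong[OF 0, of "\<lambda>v. v $ 1"] arg_cong[OF 0, of "\<lambda>v. v $ 2"] by (simp add: X_def)
  finally show False using assms by simp
qed

text \<open>
  Some \<open>X e1 e2\<close> does not vanish at \<open>a\<close>. As it belongs to the kernel module, it is \<open>c \<eta> + lam \<zeta>\<close>, and \<open>lam\<close>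
  vanishes at \<open>a\<close>; so \<open>\<eta>\<close> cannot vanish there.
\<close>

lemma kernel_field_at:
  assumes w: "FD f a w \<noteq> 0" and k: "FD f a k = 0" "k \<noteq> 0"
    and lam: "is_jacobian f a lam" and \<eta>: "kernel_field f a lam \<eta>"
  shows "smooth_germ \<eta> a" "FD f a (\<eta> a) = 0" "\<eta> a \<noteq> 0"
proof -
  note Lam0 = Lam_at[OF k]
  show "smooth_germ \<eta> a" using \<eta> by (simp add: kernel_field_def kernel_module_def)
  show "FD f a (\<eta> a) = 0"
  proof (subst vec_eq_iff, intro allI)
    fix i
    have "field_deriv \<eta> (\<lambda>t. f t $ i) \<in> jacobi_ideal f a"
      using \<eta> by (simp add: kernel_field_def kernel_module_def)
    then obtain u where "\<forall>\<^sub>F t in nhds a. field_deriv \<eta> (\<lambda>t. f t $ i) t = u t * Lam t"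
      by (rule in_jacobi_idealE)
    from eventually_nhds_x_imp_x[OF this] show "FD f a (\<eta> a) $ i = 0 $ i"
      by (simp add: Lam0 field_deriv_def FD_vec_nth[OF f])
  qed
  have "dP w a \<noteq> 0 \<or> dQ w a \<noteq> 0" using w kernel_iff by auto
  then obtain e1 e2 :: real where e: "e1 * dQ w a - e2 * dP w a \<noteq> 0"
    by (metis diff_0 diff_zero mult_cancel_right1 mult_zero_left neg_equal_0_iff_equal)
  obtain c \<zeta> where "\<forall>\<^sub>F t in nhds a. X e1 e2 t = c t *\<^sub>R \<eta> t + lam t *\<^sub>R \<zeta> t"
    using \<eta> X_in_kernel_module[of e1 e2] unfolding kernel_field_def by blast
  from eventually_nhds_x_imp_x[OF this] have "X e1 e2 a = c a *\<^sub>R \<eta> a"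
    using jacobian_derivative(1)[OF lam Lam0] by simp
  then show "\<eta> a \<noteq> 0" using X_ne_0[OF e] by auto
qed

text \<open>
  The right-hand side says that \<open>(\<eta>\<eta>P, \<eta>\<eta>Q)(a)\<close> is not in the image of \<open>d(P, Q)(a)\<close>, a line spanned by
  \<open>(dP(w), dQ(w))\<close>.
\<close>

lemma nondegenerate_iff:
  assumes w: "FD f a w \<noteq> 0" and lam: "is_jacobian f a lam"
    and \<eta>: "smooth_germ \<eta> a" "FD f a (\<eta> a) = 0" "\<eta> a \<noteq> 0"
  shows "field_deriv \<eta> lam a \<noteq> 0 \<longleftrightarrow>
    field_deriv \<eta> (field_deriv \<eta> P) a * dQ w a - field_deriv \<eta> (field_deriv \<eta> Q) a * dP w a \<noteq> 0"
proof -
  note Lam0 = Lam_at[OF \<eta>(2,3)]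
  have "w \<noteq> r *\<^sub>R \<eta> a" for r
    using w \<eta>(2) linear_cmul[OF smooth_germ_linear_derivative[OF f], of r "\<eta> a"] by auto
  then have "\<eta> a $ 1 * w $ 2 - \<eta> a $ 2 * w $ 1 \<noteq> 0" by (rule det_ne_0_not_parallel[OF \<eta>(3)])
  then have "field_deriv \<eta> Lam a \<noteq> 0 \<longleftrightarrow>
    field_deriv \<eta> (field_deriv \<eta> P) a * dQ w a - field_deriv \<eta> (field_deriv \<eta> Q) a * dP w a \<noteq> 0"
    using Lam_derivative[OF \<eta>(1,2) Lam0, of w] by (metis mult_eq_0_iff)
  moreover have "field_deriv \<eta> lam a \<noteq> 0 \<longleftrightarrow> field_deriv \<eta> Lam a \<noteq> 0"
    unfolding field_deriv_def by (rule jacobian_derivative(2)[OF lam Lam0])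
  ultimately show ?thesis by simp
qed

text \<open>
  By \<open>integrability\<close> the derivative of \<open>M\<close> in direction \<open>k\<close> annihilates \<open>(dP(w), dQ(w))\<close>. If it also
  annihilated \<open>(e1, e2)\<close>, which is not parallel to that vector, it would be zero.
\<close>

lemma dC_combination_ne_0:
  assumes k: "FD f a k = 0"
    and ne: "\<exists>j. FD (C j) a k \<noteq> 0" and e: "e1 * dQ w a - e2 * dP w a \<noteq> 0"
  shows "e1 *\<^sub>R FD (C 1) a k + e2 *\<^sub>R FD (C 2) a k \<noteq> 0"
proof
  let ?c1 = "FD (C 1) a k" and ?c2 = "FD (C 2) a k"
  assume 0: "e1 *\<^sub>R ?c1 + e2 *\<^sub>R ?c2 = 0"
  note I = integrability[OF k, of w]
  have "?c1 $ i = 0 \<and> ?c2 $ i = 0" for i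
  proof -
    have 1: "e1 * ?c1 $ i + e2 * ?c2 $ i = 0" using arg_cong[OF 0, of "\<lambda>v. v $ i"] by simp
    have 2: "dP w a * ?c1 $ i + dQ w a * ?c2 $ i = 0" using arg_cong[OF I, of "\<lambda>v. v $ i"] by simp
    have "(e1 * dQ w a - e2 * dP w a) * ?c1 $ i = 0" "(e1 * dQ w a - e2 * dP w a) * ?c2 $ i = 0"
      using 1 2 by algebra+
    then show ?thesis using e mult_eq_0_iff by blast
  qed
  then have "?c1 = 0" "?c2 = 0" by (simp_all add: vec_eq_iff)
  then show False using ne by (metis exhaust_2)
qed

text \<open>
  The components selected by \<open>s\<close> separate the plane of the lift and vanish on \<open>V\<close>.
\<close>

lemma indep3_frame:
  assumes d: "x1 * y2 - x2 * y1 \<noteq> 0" and V: "V \<noteq> 0" "\<And>j. V $ s j = 0"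
  shows "indep3 (x1 *\<^sub>R C 1 a + x2 *\<^sub>R C 2 a) (y1 *\<^sub>R C 1 a + y2 *\<^sub>R C 2 a) V"
  unfolding indep3_def
proof (intro allI impI)
  fix p q r :: real
  assume 0: "p *\<^sub>R (x1 *\<^sub>R C 1 a + x2 *\<^sub>R C 2 a) + q *\<^sub>R (y1 *\<^sub>R C 1 a + y2 *\<^sub>R C 2 a) + r *\<^sub>R V = 0"
  have 1: "p * x1 + q * y1 = 0" "p * x2 + q * y2 = 0"
    using arg_cong[OF 0, of "\<lambda>v. v $ s 1"] arg_cong[OF 0, of "\<lambda>v. v $ s 2"] V(2) by (simp_all add: C_rows_at)
  then have "p * (x1 * y2 - x2 * y1) = 0" "q * (x1 * y2 - x2 * y1) = 0" by algebra+
  then have "p = 0" "q = 0" using d mult_eq_0_iff by blast+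
  then show "p = 0 \<and> q = 0 \<and> r = 0" using 0 V(1) by simp
qed

text \<open>
  The data of \<open>cuspidal_edge_recognition\<close> are \<open>X e1 e2\<close>, \<open>p = e1 Q - e2 P\<close>, \<open>Lam\<close> and \<open>G = e1 C\<^sub>1 + e2 C\<^sub>2\<close>, for
  a vector \<open>(e1, e2)\<close> outside the image of \<open>d(P, Q)(a)\<close>.
\<close>

lemma normal_form:
  assumes m: "CARD('m) \<ge> 3" and w: "FD f a w \<noteq> 0"
    and k: "FD f a k = 0" "k \<noteq> 0"
    and line: "\<And>v. FD f a v = 0 \<Longrightarrow> \<exists>r. v = r *\<^sub>R k"
    and Lamk: "FD Lam a k \<noteq> 0"
    and ne: "\<exists>j. FD (C j) a k \<noteq> 0"
  shows "A_equivalent f a cuspidal_edge_normal_form 0"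
proof -
  have "dP w a \<noteq> 0 \<or> dQ w a \<noteq> 0" using w kernel_iff by auto
  then obtain e1 e2 :: real where e: "e1 * dQ w a - e2 * dP w a \<noteq> 0"
    by (metis diff_0 diff_zero mult_cancel_right1 mult_zero_left neg_equal_0_iff_equal)
  note Lam0 = Lam_at[OF k]
  have "FD f a (X e1 e2 a) = 0"
    using eventually_nhds_x_imp_x[OF X_f[of e1 e2]] Lam0 by simp
  then obtain r where r: "X e1 e2 a = r *\<^sub>R k" using line by blast
  have r0: "r \<noteq> 0" using X_ne_0[OF e] r by auto
  let ?p = "\<lambda>t. e1 * Q t - e2 * P t" and ?G = "\<lambda>t. e1 *\<^sub>R C 1 t + e2 *\<^sub>R C 2 t"
  have dp: "FD ?p t v = e1 * dQ v t - e2 * dP v t"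
    if "smooth_germ P t" "smooth_germ Q t" for t v
    by (simp add: FD_diff FD_mult smooth_intros that frechet_derivative_const
        dP_def dQ_def)
  have dG: "FD ?G a v = e1 *\<^sub>R FD (C 1) a v + e2 *\<^sub>R FD (C 2) a v" for v
    by (simp add: FD_add FD_scaleR smooth_intros C frechet_derivative_const)
  show ?thesis
  proof (rule cuspidal_edge_recognition[OF m f smooth_germ_X _ Lam _ _ X_f Lam0, where p = ?p and w = w])
    show "smooth_germ ?p a" by (intro smooth_intros P Q)
    show Gs: "smooth_germ ?G a" by (intro smooth_intros C)
    show "\<forall>\<^sub>F t in nhds a. FD ?p t (X e1 e2 t) = 0"
      using X_derivatives[of e1 e2] smooth_germ_eventually[OF P] smooth_germ_eventually[OF Q]
      by eventually_elim (simp add: dp)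
    show "FD Lam a (X e1 e2 a) \<noteq> 0"
      using r r0 Lamk linear_cmul[OF smooth_germ_linear_derivative[OF Lam], of r k] by simp
    show "FD ?p a w \<noteq> 0" using dp[OF P Q] e by simp
    have "FD ?G a (X e1 e2 a) = r *\<^sub>R FD ?G a k"
      unfolding r by (rule linear_cmul[OF smooth_germ_linear_derivative[OF Gs]])
    then show "indep3 (FD f a w) (?G a) (FD ?G a (X e1 e2 a))"
      unfolding df_at
    proof (simp only:, intro indep3_frame)
      show "dP w a * e2 - dQ w a * e1 \<noteq> 0" using e by (simp add: algebra_simps)
      show "r *\<^sub>R FD ?G a k \<noteq> 0"
        using dC_combination_ne_0[OF k(1) ne e] r0 dG by simp
      show "(r *\<^sub>R FD ?G a k) $ s j = 0" for j by (simp add: dG dC_rows)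
    qed
  qed
qed

end


section \<open>The characterizations of the cuspidal edge\<close>

lemma field_deriv_const: "field_deriv \<eta> (\<lambda>t. c) t = 0"
  by (simp add: field_deriv_def frechet_derivative_const)

lemma plane_frame_of_lift:
  fixes f :: "real ^ 2 \<Rightarrow> real ^ 'm::{finite,linorder}"
  assumes f: "smooth_germ f a" and W: "smooth_plane_field_coords W a s M"
    and sub: "\<forall>\<^sub>F t in nhds a. range (FD f t) \<subseteq> W t"
  shows "plane_frame f a s M" and "W a = span {column 1 (M a), column 2 (M a)}"
proof -
  have M: "smooth_germ M a" and gr: "\<forall>\<^sub>F t in nhds a. gr_coords s (W t) (M t)"
    using W by (auto simp: smooth_plane_field_coords_def)
  have mv: "A *v u = (u $ 1) *\<^sub>R column 1 A + (u $ 2) *\<^sub>R column 2 A" for A :: "real ^ 2 ^ 'm::{finite,linorder}" and u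
    by (simp add: matrix_mult_sum sum_2 scalar_mult_eq_scaleR)
  show "plane_frame f a s M"
  proof
    show "inj s" using eventually_nhds_x_imp_x[OF gr] by (simp add: gr_coords_def)
    show "\<forall>\<^sub>F t in nhds a. \<forall>j. M t $ s j = axis j 1"
      using gr by eventually_elim (simp add: gr_coords_def)
    show "\<forall>\<^sub>F t in nhds a. \<forall>v. FD f t v =
      (FD f t v $ s 1) *\<^sub>R column 1 (M t) + (FD f t v $ s 2) *\<^sub>R column 2 (M t)"
      using gr sub
    proof eventually_elim
      case (elim t)
      show ?case
      proof
        fix v
        have "FD f t v \<in> range ((*v) (M t))"
          using elim unfolding gr_coords_def by blast
        then obtain u where u: "FD f t v = M t *v u" by blast
        have "FD f t v $ s j = u $ j" for j
        proof -
          have "M t $ s i $ j = (if i = j then 1 else 0)" for i j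
            using elim(1) by (auto simp: gr_coords_def axis_def)
          then show ?thesis unfolding u mv by (cases "j = 1") (use exhaust_2[of j] in \<open>auto simp: column_def\<close>)
        qed
        then show "FD f t v =
          (FD f t v $ s 1) *\<^sub>R column 1 (M t) + (FD f t v $ s 2) *\<^sub>R column 2 (M t)"
          using u mv by simp
      qed
    qed
  qed (fact f M)+
  have "W a = range (\<lambda>u :: real ^ 2. (u $ 1) *\<^sub>R column 1 (M a) + (u $ 2) *\<^sub>R column 2 (M a))"
    using eventually_nhds_x_imp_x[OF gr] by (simp add: gr_coords_def mv)
  also have "\<dots> = span {column 1 (M a), column 2 (M a)}"
  proof (intro equalityI subsetI)
    fix v assume "v \<in> range (\<lambda>u :: real ^ 2. (u $ 1) *\<^sub>R column 1 (M a) + (u $ 2) *\<^sub>R column 2 (M a))"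
    then obtain u :: "real ^ 2" where v: "v = (u $ 1) *\<^sub>R column 1 (M a) + (u $ 2) *\<^sub>R column 2 (M a)" by blast
    show "v \<in> span {column 1 (M a), column 2 (M a)}"
      unfolding v by (intro span_add span_scale span_base) auto
  next
    fix v assume "v \<in> span {column 1 (M a), column 2 (M a)}"
    then obtain x y where "v = x *\<^sub>R column 1 (M a) + y *\<^sub>R column 2 (M a)"
      by (auto simp: span_insert span_singleton algebra_simps)
    then have "v = (\<lambda>u :: real ^ 2. (u $ 1) *\<^sub>R column 1 (M a) + (u $ 2) *\<^sub>R column 2 (M a)) (pt x y)" by simp
    then show "v \<in> range (\<lambda>u :: real ^ 2. (u $ 1) *\<^sub>R column 1 (M a) + (u $ 2) *\<^sub>R column 2 (M a))" by blast
  qed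
  finally show "W a = span {column 1 (M a), column 2 (M a)}" .
qed

context plane_frame
begin

text \<open>
  Let \<open>\<tau> \<circ> f\<close> be the normal form in the source coordinates \<open>\<sigma>\<close>, and let \<open>u\<close> be the second component of
  \<open>\<sigma>\<close>. Two components of \<open>\<tau> \<circ> f\<close> are \<open>u\<^sup>2\<close> and \<open>u\<^sup>3\<close>, and \<open>(\<eta>u)(a) \<noteq> 0\<close>. By \<open>coordinate_derivations\<close>, the
  second derivative of \<open>u\<^sup>2\<close> along \<open>\<eta>\<close> separates \<open>(\<eta>\<eta>P, \<eta>\<eta>Q)(a)\<close> from the image of \<open>d(P, Q)(a)\<close>. The differential
  of the third component of \<open>\<tau>\<close> then kills the plane of the lift, so the nonzero third derivative of
  \<open>u\<^sup>3\<close> can only come from the derivative of \<open>M\<close>.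
\<close>

lemma normal_form_imp_nondegenerate_immersive:
  assumes m: "CARD('m) \<ge> 3" and w: "FD f a w \<noteq> 0"
    and \<eta>: "smooth_germ \<eta> a" "FD f a (\<eta> a) = 0" "\<eta> a \<noteq> 0"
    and A: "A_equivalent f a cuspidal_edge_normal_form 0"
  shows "field_deriv \<eta> (field_deriv \<eta> P) a * dQ w a - field_deriv \<eta> (field_deriv \<eta> Q) a * dP w a \<noteq> 0"
    and "\<exists>j. FD (C j) a (\<eta> a) \<noteq> 0"
proof -
  let ?d = "field_deriv \<eta>"
  obtain \<sigma> and \<tau> :: "real ^ 'm::{finite,linorder} \<Rightarrow> real ^ 'm::{finite,linorder}"
    where \<sigma>: "diffeo_germ \<sigma> a 0" and \<tau>: "diffeo_germ \<tau> (f a) (cuspidal_edge_normal_form 0)"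
    and eq: "\<forall>\<^sub>F t in nhds a. \<tau> (f t) = cuspidal_edge_normal_form (\<sigma> t)"
    using A unfolding A_equivalent_def by blast
  have \<sigma>s: "smooth_germ \<sigma> a" "\<sigma> a = 0" and \<tau>s: "smooth_germ \<tau> (f a)"
    using \<sigma> \<tau> by (auto simp: diffeo_germ_def)
  obtain i1 i2 i3 :: "'m::{finite,linorder}" where i1: "pos i1 = 1" and i2: "pos i2 = 2" and i3: "pos i3 = 3"
    by (rule first_three_indices[OF m])
  define u where "u t = \<sigma> t $ 2" for t
  have us: "smooth_germ u a" unfolding u_def[abs_def] by (intro smooth_intros \<sigma>s)
  have u0: "u a = 0" by (simp add: u_def \<sigma>s)
  have e1: "\<forall>\<^sub>F t in nhds a. \<tau> (f t) $ i1 = \<sigma> t $ 1" and e2: "\<forall>\<^sub>F t in nhds a. \<tau> (f t) $ i2 = u t * u t"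
    and e3: "\<forall>\<^sub>F t in nhds a. \<tau> (f t) $ i3 = u t * (u t * u t)"
    using eq by (eventually_elim, simp add: cuspidal_edge_normal_form_def i1 i2 i3 u_def power2_eq_square power3_eq_cube)+
  let ?l = "\<lambda>i v. FD \<tau> (f a) v $ i"
  have dl: "FD (\<lambda>t. \<tau> (f t) $ i) a v = ?l i (FD f a v)" for i v
    using FD_vec_nth[OF smooth_germ_compose[OF \<tau>s f]] FD_compose[OF \<tau>s f] by simp
  have l_add: "?l i (x *\<^sub>R y + x' *\<^sub>R y') = x * ?l i y + x' * ?l i y'" for i x x' y y'
    using smooth_germ_linear_derivative[OF \<tau>s] by (simp add: linear_add linear_cmul)
  have l_0: "?l i 0 = 0" for i using smooth_germ_linear_derivative[OF \<tau>s] by (simp add: linear_0)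
  have du: "?d u a \<noteq> 0"
  proof
    assume "?d u a = 0"
    then have "FD \<sigma> a (\<eta> a) $ 2 = 0"
      by (simp add: field_deriv_def u_def[abs_def] FD_vec_nth[OF \<sigma>s(1)])
    moreover have "FD (\<lambda>t. \<sigma> t $ 1) a (\<eta> a) = 0"
      using FD_cong_nhds[OF e1] dl[of i1 "\<eta> a"] \<eta>(2) l_0 by simp
    then have "FD \<sigma> a (\<eta> a) $ 1 = 0"
      by (simp add: FD_vec_nth[OF \<sigma>s(1)])
    ultimately have "FD \<sigma> a (\<eta> a) = FD \<sigma> a 0"
      by (simp add: vec_eq_iff forall_2 linear_0[OF smooth_germ_linear_derivative[OF \<sigma>s(1)]])
    then show False
      using diffeo_germ_bij_derivative[OF \<sigma>] \<eta>(3) by (metis bij_def injD)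
  qed
  have dus: "smooth_germ (?d u) a" by (intro smooth_intros us \<eta>)
  have "\<forall>\<^sub>F t in nhds a. ?d (\<lambda>t. u t * u t) t = (2 * ?d u t) * u t + 0 * 0"
    using smooth_germ_eventually[OF us] by eventually_elim (simp add: field_deriv_mult)
  with eventually_field_deriv_cong[OF e2, of \<eta>]
  have "\<forall>\<^sub>F t in nhds a. ?d (\<lambda>t. \<tau> (f t) $ i2) t = (2 * ?d u t) * u t + 0 * 0" by eventually_elim simp
  note u2 = third_derivation[OF \<eta>(1) _ smooth_germ_const us smooth_germ_const this u0 refl]
  have r2: "?d (?d (\<lambda>t. \<tau> (f t) $ i2)) a = 2 * ?d u a * ?d u a"
    using u2(2) by (simp add: smooth_intros dus)
  have "\<forall>\<^sub>F t in nhds a. ?d (\<lambda>t. u t * (u t * u t)) t = (3 * (u t * ?d u t)) * u t + 0 * 0"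
    using smooth_germ_eventually[OF us]
    by eventually_elim (simp add: field_deriv_mult smooth_germ_mult algebra_simps)
  with eventually_field_deriv_cong[OF e3, of \<eta>]
  have "\<forall>\<^sub>F t in nhds a. ?d (\<lambda>t. \<tau> (f t) $ i3) t = (3 * (u t * ?d u t)) * u t + 0 * 0" by eventually_elim simp
  note u3 = third_derivation[OF \<eta>(1) _ smooth_germ_const us smooth_germ_const this u0 refl]
  have r3: "?d (?d (\<lambda>t. \<tau> (f t) $ i3)) a = 0"
    using u3(2) by (simp add: smooth_intros dus us u0)
  have "?d (\<lambda>t. 3 * (u t * ?d u t)) a = 3 * (?d u a * ?d u a)"
    using u0 by (simp add: field_deriv_mult smooth_intros us dus field_deriv_const)
  then have r3': "?d (?d (?d (\<lambda>t. \<tau> (f t) $ i3))) a = 6 * ?d u a * (?d u a * ?d u a)"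
    using u3(3) u0 by (simp add: smooth_intros dus us field_deriv_const)
  note cd = coordinate_derivations[OF \<eta>(1,2) \<tau>s]
  let ?a2 = "?l i2 (C 1 a)" and ?b2 = "?l i2 (C 2 a)" and ?a3 = "?l i3 (C 1 a)" and ?b3 = "?l i3 (C 2 a)"
  let ?r1 = "?d (?d P) a" and ?r2 = "?d (?d Q) a" and ?x = "dP w a" and ?y = "dQ w a"
  \<comment> \<open>\<open>(a\<^sub>j, b\<^sub>j)\<close> is the \<open>j\<close>-th coordinate of \<open>d\<tau>\<close> on the plane of the lift; \<open>(x, y)\<close> spans the image of \<open>d(P, Q)(a)\<close>\<close>
  have A2: "?a2 * ?r1 + ?b2 * ?r2 \<noteq> 0" unfolding cd(2)[of i2, symmetric] r2 using du by simp
  have duu: "FD (\<lambda>t. u t * u t) a w = 0"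
    "FD (\<lambda>t. u t * (u t * u t)) a w = 0"
    by (simp_all add: FD_mult smooth_intros us u0)
  have B2: "?a2 * ?x + ?b2 * ?y = 0"
    using dl[of i2 w] FD_cong_nhds[OF e2] duu unfolding df_at by (simp add: l_add mult.commute)
  have A3: "?a3 * ?r1 + ?b3 * ?r2 = 0" using cd(2)[of i3] r3 by simp
  have B3: "?a3 * ?x + ?b3 * ?y = 0"
    using dl[of i3 w] FD_cong_nhds[OF e3] duu unfolding df_at by (simp add: l_add mult.commute)
  have xy: "?x \<noteq> 0 \<or> ?y \<noteq> 0" using w kernel_iff by auto
  show nd: "?r1 * ?y - ?r2 * ?x \<noteq> 0"
  proof
    assume 0: "?r1 * ?y - ?r2 * ?x = 0"
    have "?x * (?a2 * ?r1 + ?b2 * ?r2) = 0" "?y * (?a2 * ?r1 + ?b2 * ?r2) = 0" using 0 B2 by algebra+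
    then show False using A2 xy mult_eq_0_iff by blast
  qed
  have "(?r1 * ?y - ?r2 * ?x) * ?a3 = 0" "(?r1 * ?y - ?r2 * ?x) * ?b3 = 0" using A3 B3 by algebra+
  then have c3: "?a3 = 0" "?b3 = 0" using nd mult_eq_0_iff by blast+
  show "\<exists>j. FD (C j) a (\<eta> a) \<noteq> 0"
  proof (rule ccontr)
    assume "\<nexists>j. FD (C j) a (\<eta> a) \<noteq> 0"
    then have "?d (?d (?d (\<lambda>t. \<tau> (f t) $ i3))) a = 0"
      using cd(3)[of i3] c3 l_0 by simp
    then show False using r3' du by simp
  qed
qed

text \<open>
  Affine coordinates suffice: the first two axes are sent to a basis of the plane of the lift and the
  third one to the vector \<open>V\<close> that \<open>coordinate_derivations\<close> shows to govern the third derivatives.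
\<close>

lemma adapted_coordinates_exist:
  assumes m: "CARD('m) \<ge> 3" and W: "legendre_lift f a W" "W a = span {C 1 a, C 2 a}"
    and \<eta>: "smooth_germ \<eta> a" "FD f a (\<eta> a) = 0"
    and nd: "field_deriv \<eta> (field_deriv \<eta> P) a * dQ w a - field_deriv \<eta> (field_deriv \<eta> Q) a * dP w a \<noteq> 0"
    and ne: "\<exists>j. FD (C j) a (\<eta> a) \<noteq> 0"
  shows "\<exists>x. adapted_coords f a x \<and> (\<exists>i. 3 \<le> pos i \<and> ord_along \<eta> a (\<lambda>t. x (f t) $ i) = 3)"
proof -
  let ?d = "field_deriv \<eta>" and ?k = "\<eta> a"
  let ?V = "?d (?d P) a *\<^sub>R FD (C 1) a ?k + ?d (?d Q) a *\<^sub>R FD (C 2) a ?k"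
  have "?V \<noteq> 0" by (rule dC_combination_ne_0[OF \<eta>(2) ne nd])
  then have "indep3 (1 *\<^sub>R C 1 a + 0 *\<^sub>R C 2 a) (0 *\<^sub>R C 1 a + 1 *\<^sub>R C 2 a) ?V"
    by (intro indep3_frame) (simp_all add: dC_rows)
  then have ind: "indep3 (C 1 a) (C 2 a) ?V" by simp
  obtain i1 i2 i3 :: "'m::{finite,linorder}" where i1: "pos i1 = 1" and i2: "pos i2 = 2" and i3: "pos i3 = 3"
    by (rule first_three_indices[OF m])
  have ne3: "i1 \<noteq> i2" "i1 \<noteq> i3" "i2 \<noteq> i3" using i1 i2 i3 by auto
  obtain \<Phi> :: "real ^ 'm::{finite,linorder} \<Rightarrow> real ^ 'm::{finite,linorder}"
    where \<Phi>: "linear \<Phi>" "bij \<Phi>" "\<Phi> (axis i1 1) = C 1 a" "\<Phi> (axis i2 1) = C 2 a" "\<Phi> (axis i3 1) = ?V"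
    by (rule indep3_linear_bij[OF ind ne3])
  let ?L = "inv \<Phi>"
  have lL: "linear ?L" by (rule inj_linear_imp_inv_linear[OF \<Phi>(1) bij_is_inj[OF \<Phi>(2)]])
  then have bL: "bounded_linear ?L" and b\<Phi>: "bounded_linear \<Phi>"
    using \<Phi>(1) by (auto simp: linear_conv_bounded_linear)
  have L\<Phi>: "?L (\<Phi> v) = v" and \<Phi>L: "\<Phi> (?L v) = v" for v
    using \<Phi>(2) by (auto simp: bij_is_inj bij_is_surj surj_f_inv_f)
  define x where "x y = ?L (y - f a)" for y
  have xs: "smooth_germ x y" for y
    unfolding x_def[abs_def] by (intro smooth_germ_bounded_linear[OF bL] smooth_intros)
  have dx: "FD x y = ?L" for y
    unfolding x_def[abs_def]
    by (rule ext) (simp add: FD_bounded_linear[OF bL] FD_diff smooth_intros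
        frechet_derivative_ident frechet_derivative_const)
  have "diffeo_germ x (f a) 0"
    unfolding diffeo_germ_def
  proof (intro conjI xs exI[of _ "\<lambda>v. \<Phi> v + f a"])
    show "x (f a) = 0" by (simp add: x_def linear_0[OF lL])
    show "smooth_germ (\<lambda>v. \<Phi> v + f a) 0"
      by (intro smooth_germ_add smooth_germ_bounded_linear[OF b\<Phi>] smooth_germ_id smooth_germ_const)
  qed (simp_all add: x_def L\<Phi> \<Phi>L linear_0[OF \<Phi>(1)])
  moreover have "W a = span ((\<lambda>i. inv (FD x (f a)) (axis i 1)) ` {i. pos i \<le> CARD(2)})"
  proof -
    have "{i. pos i \<le> 2} = {i1, i2}"
    proof (intro equalityI subsetI)
      fix i :: "'m::{finite,linorder}" assume "i \<in> {i. pos i \<le> 2}"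
      moreover have "pos i \<ge> 1"
      proof -
        have "card {j. j \<le> i} > 0" by (subst card_gt_0_iff) auto
        then show ?thesis by (simp add: pos_def Suc_le_eq)
      qed
      ultimately have "pos i = pos i1 \<or> pos i = pos i2" using i1 i2 by auto
      then show "i \<in> {i1, i2}" using injD[OF inj_pos] by blast
    qed (use i1 i2 in auto)
    then show ?thesis using W(2) \<Phi> inv_inv_eq[OF \<Phi>(2)] by (simp add: dx)
  qed
  ultimately have "adapted_coords f a x" unfolding adapted_coords_def using W(1) by blast
  moreover have "ord_along \<eta> a (\<lambda>t. x (f t) $ i3) = 3"
  proof -
    note cd = coordinate_derivations[where i = i3, OF \<eta> xs]
    have l: "?L (C 1 a) $ i3 = 0" "?L (C 2 a) $ i3 = 0" "?L ?V $ i3 = 1"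
      using L\<Phi>[of "axis i1 1"] L\<Phi>[of "axis i2 1"] L\<Phi>[of "axis i3 1"] \<Phi>(3-5) ne3
      by (simp_all add: axis_def)
    have "?d (?d (?d (\<lambda>t. x (f t) $ i3))) a = 2 * ?L ?V $ i3"
      using cd(3) l(1,2) by (simp add: dx linear_add[OF lL] linear_cmul[OF lL] mult.commute)
    then show ?thesis
      unfolding ord_along_eq_3 using cd(1,2) l by (simp add: dx x_def linear_0[OF lL])
  qed
  ultimately show ?thesis using i3 by (intro exI[of _ x] conjI exI[of _ i3]) auto
qed

text \<open>
  The differential of \<open>x\<^sub>i\<close> kills the plane of the lift, so the third derivative is a combination of
  derivatives of the columns of \<open>M\<close>.
\<close>

lemma adapted_order_3_imp_immersive:
  fixes x :: "real ^ 'm::{finite,linorder} \<Rightarrow> real ^ 'm::{finite,linorder}"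
  assumes x: "diffeo_germ x (f a) 0"
    and W: "span {C 1 a, C 2 a} = span ((\<lambda>i. inv (FD x (f a)) (axis i 1)) ` {i. pos i \<le> CARD(2)})"
    and \<eta>: "smooth_germ \<eta> a" "FD f a (\<eta> a) = 0"
    and i: "3 \<le> pos i" and ord: "ord_along \<eta> a (\<lambda>t. x (f t) $ i) = 3"
  shows "\<exists>j. FD (C j) a (\<eta> a) \<noteq> 0"
proof (rule ccontr)
  assume none: "\<nexists>j. FD (C j) a (\<eta> a) \<noteq> 0"
  have xs: "smooth_germ x (f a)" using x by (simp add: diffeo_germ_def)
  let ?x' = "FD x (f a)"
  have lin: "linear ?x'" by (rule smooth_germ_linear_derivative[OF xs])
  have surj: "?x' (inv ?x' v) = v" for v
    using diffeo_germ_bij_derivative[OF x] by (simp add: bij_is_surj surj_f_inv_f)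
  have sub: "subspace {v. ?x' v $ i = 0}"
    by (auto simp: subspace_def linear_0[OF lin] linear_add[OF lin] linear_cmul[OF lin])
  have "span ((\<lambda>i. inv ?x' (axis i 1)) ` {i. pos i \<le> CARD(2)}) \<subseteq> {v. ?x' v $ i = 0}"
    by (rule span_minimal[OF _ sub]) (use i surj in \<open>auto simp: axis_def\<close>)
  moreover have "C j a \<in> span {C 1 a, C 2 a}" for j using exhaust_2[of j] by (auto intro: span_base)
  ultimately have l: "?x' (C j a) $ i = 0" for j using W by blast
  have "field_deriv \<eta> (field_deriv \<eta> (field_deriv \<eta> (\<lambda>t. x (f t) $ i))) a = 0"
    using coordinate_derivations(3)[OF \<eta> xs, of i] l none by (simp add: linear_0[OF lin])
  then show False using ord unfolding ord_along_eq_3 by simp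
qed

end

theorem theorem3p10:
  fixes f :: "real ^ 2 \<Rightarrow> real ^ 'm::{finite,linorder}"
    and a :: "real ^ 2"
    and b :: "real ^ 'm::{finite,linorder}"
    and lam :: "real ^ 2 \<Rightarrow> real"
    and \<eta> :: "real ^ 2 \<Rightarrow> real ^ 2"
  assumes "CARD('m) \<ge> 3"
    and "f a = b"
    and "frontal f a"
    and "corank f a = 1"
    and "is_jacobian f a lam"
    and "kernel_field f a lam \<eta>"
  shows "(is_cuspidal_edge f a \<longleftrightarrow> A_equivalent f a cuspidal_edge_normal_form 0)
       \<and> (A_equivalent f a cuspidal_edge_normal_form 0 \<longleftrightarrow> front f a \<and> field_deriv \<eta> lam a \<noteq> 0)
       \<and> (front f a \<and> field_deriv \<eta> lam a \<noteq> 0 \<longleftrightarrow>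
            field_deriv \<eta> lam a \<noteq> 0 \<and>
            (\<exists>x. adapted_coords f a x \<and>
               (\<exists>i. 3 \<le> pos i \<and> ord_along \<eta> a (\<lambda>t. x (f t) $ i) = 3)))"
proof -
  have m: "CARD('m) \<ge> 3" and fs: "smooth_germ f a" using assms(1,3) by (auto simp: frontal_def)
  obtain k w where k: "k \<noteq> 0" "FD f a k = 0" and w: "FD f a w \<noteq> 0"
    and line: "\<And>v. FD f a v = 0 \<Longrightarrow> \<exists>r. v = r *\<^sub>R k"
    using corank_1E[OF fs assms(4)] by blast
  have frame: "plane_frame f a s M \<and> W a = span {column 1 (M a), column 2 (M a)}"
    if "smooth_plane_field_coords W a s M" "legendre_lift f a W" for W s M
    using plane_frame_of_lift[OF fs that(1)] that(2) unfolding legendre_lift_def by blast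
  obtain W0 where W0: "legendre_lift f a W0" using assms(3) by (auto simp: frontal_def)
  then obtain s0 M0 where c0: "smooth_plane_field_coords W0 a s0 M0" by (auto simp: legendre_lift_def)
  interpret F0: plane_frame f a s0 M0 using frame[OF c0 W0] by blast
  note \<eta> = F0.kernel_field_at[OF w k(2,1) assms(5,6)]
  have line\<eta>: "\<exists>r. v = r *\<^sub>R \<eta> a" if v0: "FD f a v = 0" for v
  proof -
    obtain r where r: "\<eta> a = r *\<^sub>R k" using line[OF \<eta>(2)] by blast
    obtain r' where "v = r' *\<^sub>R k" using line[OF v0] by blast
    then have "v = (r' / r) *\<^sub>R \<eta> a" using r \<eta>(3) by auto
    then show ?thesis by blast
  qed
  have front_iff: "front f a \<longleftrightarrow> (\<exists>W s M. smooth_plane_field_coords W a s M \<and> legendre_lift f a W \<and>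
      (\<exists>j. FD (plane_frame.C M j) a (\<eta> a) \<noteq> 0))"
  proof -
    have "inj (FD (\<lambda>t. (f t, M t)) a) \<longleftrightarrow>
        (\<exists>j. FD (plane_frame.C M j) a (\<eta> a) \<noteq> 0)"
      if "smooth_plane_field_coords W a s M" "legendre_lift f a W" for W s M
    proof -
      interpret plane_frame f a s M using frame[OF that] by blast
      show ?thesis by (rule immersive_iff[OF \<eta>(2,3) line\<eta>])
    qed
    then show ?thesis unfolding front_def immersive_lift_def using assms(3) by blast
  qed
  have "A_equivalent f a cuspidal_edge_normal_form 0 \<longleftrightarrow> front f a \<and> field_deriv \<eta> lam a \<noteq> 0"
  proof
    assume A: "A_equivalent f a cuspidal_edge_normal_form 0"
    note nf = F0.normal_form_imp_nondegenerate_immersive[OF m w \<eta> A]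
    show "front f a \<and> field_deriv \<eta> lam a \<noteq> 0"
      unfolding front_iff using c0 W0 nf(2) F0.nondegenerate_iff[OF w assms(5) \<eta>] nf(1) by blast
  next
    assume A: "front f a \<and> field_deriv \<eta> lam a \<noteq> 0"
    then obtain W s M where c: "smooth_plane_field_coords W a s M" "legendre_lift f a W"
      and ne: "\<exists>j. FD (plane_frame.C M j) a (\<eta> a) \<noteq> 0"
      using front_iff by blast
    interpret F: plane_frame f a s M using frame[OF c] by blast
    have "FD F.Lam a (\<eta> a) \<noteq> 0"
      using F.jacobian_derivative(2)[OF assms(5) F.Lam_at[OF \<eta>(2,3)], of "\<eta> a"] A by (simp add: field_deriv_def)
    then show "A_equivalent f a cuspidal_edge_normal_form 0"
      using F.normal_form[OF m w \<eta>(2,3) line\<eta> _ ne] by blast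
  qed
  moreover have "front f a \<longleftrightarrow> (\<exists>x. adapted_coords f a x \<and>
      (\<exists>i. 3 \<le> pos i \<and> ord_along \<eta> a (\<lambda>t. x (f t) $ i) = 3))"
    if nd: "field_deriv \<eta> lam a \<noteq> 0"
  proof
    assume "front f a"
    then obtain W s M where c: "smooth_plane_field_coords W a s M" "legendre_lift f a W"
      and ne: "\<exists>j. FD (plane_frame.C M j) a (\<eta> a) \<noteq> 0"
      using front_iff by blast
    interpret F: plane_frame f a s M using frame[OF c] by blast
    have "W a = span {F.C 1 a, F.C 2 a}" using frame[OF c] by (simp add: F.C_def)
    from F.adapted_coordinates_exist[OF m c(2) this \<eta>(1,2) _ ne]
    show "\<exists>x. adapted_coords f a x \<and> (\<exists>i. 3 \<le> pos i \<and> ord_along \<eta> a (\<lambda>t. x (f t) $ i) = 3)"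
      using F.nondegenerate_iff[OF w assms(5) \<eta>] nd by blast
  next
    assume "\<exists>x. adapted_coords f a x \<and> (\<exists>i. 3 \<le> pos i \<and> ord_along \<eta> a (\<lambda>t. x (f t) $ i) = 3)"
    then obtain x :: "real ^ 'm::{finite,linorder} \<Rightarrow> real ^ 'm::{finite,linorder}" and i W where x: "diffeo_germ x (f a) 0" and W: "legendre_lift f a W"
      and Wa: "W a = span ((\<lambda>i. inv (FD x (f a)) (axis i 1)) ` {i. pos i \<le> CARD(2)})"
      and i: "3 \<le> pos i" "ord_along \<eta> a (\<lambda>t. x (f t) $ i) = 3"
      unfolding adapted_coords_def by blast
    obtain s M where c: "smooth_plane_field_coords W a s M" using W by (auto simp: legendre_lift_def)
    interpret F: plane_frame f a s M using frame[OF c W] by blast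
    have "span {F.C 1 a, F.C 2 a} = W a" using frame[OF c W] by (simp add: F.C_def)
    then have "\<exists>j. FD (F.C j) a (\<eta> a) \<noteq> 0"
      using F.adapted_order_3_imp_immersive[OF x _ \<eta>(1,2) i] Wa by simp
    then show "front f a" using front_iff c W by blast
  qed
  ultimately show ?thesis using cuspidal_edge_iff_normal_form[OF m, of f a] by blast
qed

end
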